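(* For any integer $k\ge 1$ there exist (closed) symplectic manifolds with matrix Massey products, in real cohomology, whose weights are strictly equal to $2k$.
   Context: All symplectic manifolds are closed (compact without boundary). $N(W)$ denotes the set of finite rectangular matrices with homogeneous entries in $W$. Matrix Massey products. Let $(\mathcal{A},d)$ be an augmented graded-commutative differential graded algebra over $\mathbb{R}$ with augmentation ideal $I$; for a manifold $M$ take $\mathcal{A}=\mathcal{E}^{\ast}(M)$, the smooth forms, augmented by restriction to a point, with $H^{\ast}(\mathcal{A})=H^{\ast}(M,\mathbb{R})$; quasi-isomorphic algebras may be used instead. Put $\bar a=(-1)^{\deg a}a$, applied entrywise to matrices. For $X=(x_{ij})\in N(I)$ let $\mathcal{D}(X)=(\deg x_{ij})$. Matrices $X$ of size $p\times q$ and $Y$ of size $r\times s$ are multipliable (in this order) if $q=r$ and $\deg x_{ij}+\deg y_{jk}$ is independent of $j$ for all $(i,k)$; then $\mathcal{D}(X)\ast\mathcal{D}(Y)=(\deg x_{ij}+\deg y_{jk})_{ik}$. For an integer matrix $K$ and an integer $t$, $K+t$ is obtained by adding $t$ to every entry. Let $n\ge 2$, $V_1,\dots,V_n\in N(H^+(\mathcal{A}))$ with $V_i,V_{i+1}$ multipliable, and let $X_i\in N(I)$ be matrices of cocycles with $[X_i]=V_i$. A defining system for $\langle X_1,\dots,X_n\rangle$ is a family $A=(X(i,j))$, $1\le i\le j\le n$, $(i,j)\ne(1,n)$, in $N(I)$ with: (1) $X(i,i)=X_i$; (2) $\mathcal{D}(X(i,j))=(\mathcal{D}(X_i)-1)\ast\cdots\ast(\mathcal{D}(X_j)-1)+1$;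 (3) $dX(i,j)=\sum_{r=i}^{j-1}\overline{X(i,r)}\cdot X(r+1,j)$. Its cocycle is $c(A)=\sum_{r=1}^{n-1}\overline{X(1,r)}\cdot X(r+1,n)$. The product is defined if a defining system exists; then the $n$-tuple matrix Massey product $\langle V_1,\dots,V_n\rangle$ is the set of matrix cohomology classes $[c(A)]$ over all defining systems (it depends only on $V_1,\dots,V_n$). Weight. The weight of a (defined) $k$-tuple matrix Massey product $\langle X_1,\dots,X_k\rangle$ in $H^{\ast}(M,\mathbb{R})$ is strictly equal to $k$ if there is an element $a\in\langle X_1,\dots,X_k\rangle$ that does not belong to the linear subspace generated by all (defined) matrix Massey products $\langle Y_1,\dots,Y_l\rangle$ in $H^{\ast}(M,\mathbb{R})$ with $l<k$, $l\ge 2$. (For matrices, membership is read entrywise: all entries of $a$ are linear combinations of entries of elements of such products; when $a$ is a $1\times 1$ matrix it is a cohomology class.) *)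

theory Defs
  imports
    "HOL-Analysis.Analysis"
    "HOL-Library.Function_Algebras"
    "Jordan_Normal_Form.Matrix"
begin

section \<open>Pointwise real vector space structure on functions\<close>

instantiation "fun" :: (type, scaleR) scaleR
begin

definition scaleR_fun :: "real \<Rightarrow> ('a \<Rightarrow> 'b) \<Rightarrow> 'a \<Rightarrow> 'b" where
  "scaleR_fun r f = (\<lambda>x. r *\<^sub>R f x)"

instance ..

end

instance "fun" :: (type, real_vector) real_vector
  by standard (simp_all add: scaleR_fun_def fun_eq_iff scaleR_add_left scaleR_add_right)


section \<open>Closed smooth manifolds\<close>

text \<open>
  The model space of an \<open>n\<close>-manifold is \<^const>\<open>Euclidean_space\<close> \<open>n\<close>, the sequences of reals that
  vanish from index \<open>n\<close> on.  A function on an open subset \<open>V\<close> of it is smooth if all its iterated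
  partial derivatives exist and are continuous on \<open>V\<close>.
\<close>

definition partial_deriv :: "nat \<Rightarrow> ((nat \<Rightarrow> real) \<Rightarrow> real) \<Rightarrow> (nat \<Rightarrow> real) \<Rightarrow> real" where
  "partial_deriv i f x = deriv (\<lambda>t. f (x(i := t))) (x i)"

definition smooth_on :: "nat \<Rightarrow> (nat \<Rightarrow> real) set \<Rightarrow> ((nat \<Rightarrow> real) \<Rightarrow> real) \<Rightarrow> bool" where
  "smooth_on n V f \<longleftrightarrow>
     (\<forall>is \<in> lists {..<n}. let g = foldr partial_deriv is f in
        continuous_map (subtopology (Euclidean_space n) V) euclideanreal g \<and>
        (\<forall>x\<in>V. \<forall>i<n. (\<lambda>t. g (x(i := t))) field_differentiable at (x i)))"

record 'a manifold =
  mtop :: "'a topology"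
  mdim :: nat
  atlas :: "('a set \<times> ('a \<Rightarrow> nat \<Rightarrow> real)) set"

definition is_chart :: "'a topology \<Rightarrow> nat \<Rightarrow> 'a set \<times> ('a \<Rightarrow> nat \<Rightarrow> real) \<Rightarrow> bool" where
  "is_chart X n = (\<lambda>(U, \<phi>).
     openin X U \<and> openin (Euclidean_space n) (\<phi> ` U) \<and>
     homeomorphic_map (subtopology X U) (subtopology (Euclidean_space n) (\<phi> ` U)) \<phi>)"

text \<open>The atlas need not be maximal; any smooth atlas determines the smooth structure.\<close>

definition smooth_manifold :: "'a manifold \<Rightarrow> bool" where
  "smooth_manifold M \<longleftrightarrow>
     Hausdorff_space (mtop M) \<and> second_countable (mtop M) \<and>
     (\<forall>c \<in> atlas M. is_chart (mtop M) (mdim M) c) \<and>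
     \<Union> (fst ` atlas M) = topspace (mtop M) \<and>
     (\<forall>(U, \<phi>) \<in> atlas M. \<forall>(W, \<psi>) \<in> atlas M. \<forall>i < mdim M.
        smooth_on (mdim M) (\<phi> ` (U \<inter> W)) (\<lambda>x. \<psi> (inv_into U \<phi> x) i))"

definition closed_manifold :: "'a manifold \<Rightarrow> bool" where
  "closed_manifold M \<longleftrightarrow> smooth_manifold M \<and> compact_space (mtop M)"


section \<open>Differential forms\<close>

text \<open>
  Smooth functions are normalised to be \<open>0\<close> off the manifold, vector fields to be \<open>0\<close> on functions
  that are not smooth, and forms to be \<open>0\<close> on lists that do not consist of vector fields, so that
  equality in HOL is the intended equality of functions, fields and forms.
\<close>

definition smooth_functions :: "'a manifold \<Rightarrow> ('a \<Rightarrow> real) set" where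
  "smooth_functions M = {f.
     (\<forall>x. x \<notin> topspace (mtop M) \<longrightarrow> f x = 0) \<and>
     (\<forall>(U, \<phi>) \<in> atlas M. smooth_on (mdim M) (\<phi> ` U) (\<lambda>x. f (inv_into U \<phi> x)))}"

type_synonym 'a vfield = "('a \<Rightarrow> real) \<Rightarrow> 'a \<Rightarrow> real"

text \<open>Vector fields are the derivations of the algebra of smooth functions.\<close>

definition vector_fields :: "'a manifold \<Rightarrow> 'a vfield set" where
  "vector_fields M = {X.
     (\<forall>f. f \<notin> smooth_functions M \<longrightarrow> X f = 0) \<and>
     (\<forall>f \<in> smooth_functions M. X f \<in> smooth_functions M) \<and>
     (\<forall>f \<in> smooth_functions M. \<forall>g \<in> smooth_functions M. \<forall>a b.
        X (a *\<^sub>R f + b *\<^sub>R g) = a *\<^sub>R X f + b *\<^sub>R X g) \<and>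
     (\<forall>f \<in> smooth_functions M. \<forall>g \<in> smooth_functions M. X (f * g) = f * X g + g * X f)}"

definition lie_bracket :: "'a vfield \<Rightarrow> 'a vfield \<Rightarrow> 'a vfield" where
  "lie_bracket X Y = (\<lambda>f. X (Y f) - Y (X f))"

type_synonym 'a dform = "'a vfield list \<Rightarrow> 'a \<Rightarrow> real"

text \<open>
  A form of degree \<open>p\<close> is an alternating map on \<open>p\<close>-tuples of vector fields that is multilinear over the
  smooth functions.  A \<open>0\<close>-form is its value on the empty list, a smooth function.  Forms of mixed
  degree are elements of the same type, the degree \<open>p\<close> component being the restriction to lists of
  length \<open>p\<close>.
\<close>

definition forms :: "'a manifold \<Rightarrow> nat \<Rightarrow> 'a dform set" where
  "forms M p = {\<omega>.
     (\<forall>xs. \<not> (length xs = p \<and> set xs \<subseteq> vector_fields M) \<longrightarrow> \<omega> xs = 0) \<and>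
     (\<forall>xs. length xs = p \<and> set xs \<subseteq> vector_fields M \<longrightarrow>
        \<omega> xs \<in> smooth_functions M \<and>
        (\<forall>i<p. \<forall>X \<in> vector_fields M. \<forall>Y \<in> vector_fields M.
           \<forall>f \<in> smooth_functions M. \<forall>g \<in> smooth_functions M.
             \<omega> (xs[i := (\<lambda>h. f * X h + g * Y h)]) = f * \<omega> (xs[i := X]) + g * \<omega> (xs[i := Y])) \<and>
        (\<forall>j<p. \<forall>i<j. xs ! i = xs ! j \<longrightarrow> \<omega> xs = 0))}"

text \<open>
  The shuffle formula: in the term for \<open>S\<close>, the fields with positions in \<open>S\<close> go into the first
  factor, and the sign is that of the permutation that lists \<open>S\<close> before its complement.
\<close>

definition wedge :: "'a dform \<Rightarrow> 'a dform \<Rightarrow> 'a dform" where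
  "wedge \<alpha> \<beta> = (\<lambda>xs. \<Sum>S \<in> Pow {..<length xs}.
     (-1) ^ card {(i, j). i < j \<and> j \<in> S \<and> i \<notin> S} *\<^sub>R (\<alpha> (nths xs S) * \<beta> (nths xs (- S))))"

text \<open>The invariant (Koszul) formula for the exterior derivative, without normalising factor.\<close>

definition ext_deriv :: "'a manifold \<Rightarrow> 'a dform \<Rightarrow> 'a dform" where
  "ext_deriv M \<omega> = (\<lambda>xs. if set xs \<subseteq> vector_fields M then
     (\<Sum>i<length xs. (-1) ^ i *\<^sub>R (xs ! i) (\<omega> (nths xs (- {i})))) +
     (\<Sum>j<length xs. \<Sum>i<j.
        (-1) ^ (i + j) *\<^sub>R \<omega> (lie_bracket (xs ! i) (xs ! j) # nths xs (- {i, j})))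
     else 0)"

text \<open>
  The tangent vectors at \<open>p\<close> are the maps \<open>f \<mapsto> X f p\<close> for vector fields \<open>X\<close>, so the last condition
  is non-degeneracy of the form on each tangent space.
\<close>

definition symplectic_form :: "'a manifold \<Rightarrow> 'a dform \<Rightarrow> bool" where
  "symplectic_form M \<omega> \<longleftrightarrow>
     \<omega> \<in> forms M 2 \<and> ext_deriv M \<omega> = 0 \<and>
     (\<forall>p \<in> topspace (mtop M). \<forall>X \<in> vector_fields M.
        (\<forall>Y \<in> vector_fields M. \<omega> [X, Y] p = 0) \<longrightarrow> (\<forall>f \<in> smooth_functions M. X f p = 0))"


section \<open>Augmented differential graded algebras and their cohomology\<close>

text \<open>
  Only the operations are recorded.  \<open>grade A n\<close> is the space of homogeneous elements of degree \<open>n\<close>;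
  the algebra itself is the linear span of these spaces.
\<close>

record 'b dga =
  grade :: "nat \<Rightarrow> 'b set"
  dmult :: "'b \<Rightarrow> 'b \<Rightarrow> 'b"
  diff :: "'b \<Rightarrow> 'b"
  aug :: "'b \<Rightarrow> real"

definition de_Rham :: "'a manifold \<Rightarrow> 'a \<Rightarrow> 'a dform dga" where
  "de_Rham M p =
     \<lparr>grade = forms M, dmult = wedge, diff = ext_deriv M, aug = (\<lambda>\<omega>. \<omega> [] p)\<rparr>"

definition dga_carrier :: "'b::real_vector dga \<Rightarrow> 'b set" where
  "dga_carrier A = span (\<Union>n. grade A n)"

definition coh_class :: "'b::real_vector dga \<Rightarrow> 'b \<Rightarrow> 'b set" where
  "coh_class A z = {z + diff A y | y. y \<in> dga_carrier A}"

definition cohomology :: "'b::real_vector dga \<Rightarrow> nat \<Rightarrow> 'b set set" where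
  "cohomology A n = coh_class A ` {z \<in> grade A n. diff A z = 0}"

text \<open>
  The linear subspace of the total cohomology generated by a set \<open>S\<close> of classes.  As classes are
  cosets, \<open>\<Union>S\<close> consists of all the cocycles representing members of \<open>S\<close>.
\<close>

definition coh_span :: "'b::real_vector dga \<Rightarrow> 'b set set \<Rightarrow> 'b set set" where
  "coh_span A S = coh_class A ` span (\<Union>S)"


section \<open>Matrix Massey products\<close>

text \<open>
  Since \<open>0\<close> is homogeneous of every degree, the degrees of the entries of a matrix are carried along
  explicitly, as a matrix of the same size.
\<close>

definition homog_mat :: "'b dga \<Rightarrow> nat mat \<Rightarrow> 'b mat \<Rightarrow> bool" where
  "homog_mat A D X \<longleftrightarrow>
     dim_row X = dim_row D \<and> dim_col X = dim_col D \<and>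
     (\<forall>a < dim_row D. \<forall>b < dim_col D. X $$ (a, b) \<in> grade A (D $$ (a, b)) \<and> aug A (X $$ (a, b)) = 0)"

definition multipliable :: "nat mat \<Rightarrow> nat mat \<Rightarrow> bool" where
  "multipliable D E \<longleftrightarrow>
     dim_col D = dim_row E \<and>
     (\<forall>a < dim_row D. \<forall>c < dim_col E. \<forall>b < dim_col D. \<forall>b' < dim_col D.
        D $$ (a, b) + E $$ (b, c) = D $$ (a, b') + E $$ (b', c))"

definition deg_star :: "nat mat \<Rightarrow> nat mat \<Rightarrow> nat mat" where
  "deg_star D E = mat (dim_row D) (dim_col E) (\<lambda>(a, c). D $$ (a, 0) + E $$ (0, c))"

definition bar :: "nat mat \<Rightarrow> 'b::real_vector mat \<Rightarrow> 'b mat" where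
  "bar D X = mat (dim_row X) (dim_col X) (\<lambda>(a, b). (-1) ^ (D $$ (a, b)) *\<^sub>R X $$ (a, b))"

definition mat_prod :: "'b::real_vector dga \<Rightarrow> 'b mat \<Rightarrow> 'b mat \<Rightarrow> 'b mat" where
  "mat_prod A X Y = mat (dim_row X) (dim_col Y)
     (\<lambda>(a, c). \<Sum>b < dim_col X. dmult A (X $$ (a, b)) (Y $$ (b, c)))"

text \<open>
  A matrix over \<open>H\<^sup>+\<close> is a pair of a matrix of positive degrees and a matrix of cohomology classes of
  these degrees.
\<close>

definition coh_mat :: "'b::real_vector dga \<Rightarrow> nat mat \<times> 'b set mat \<Rightarrow> bool" where
  "coh_mat A = (\<lambda>(D, V).
     0 < dim_row D \<and> 0 < dim_col D \<and> dim_row V = dim_row D \<and> dim_col V = dim_col D \<and>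
     (\<forall>a < dim_row D. \<forall>b < dim_col D.
        0 < D $$ (a, b) \<and> V $$ (a, b) \<in> cohomology A (D $$ (a, b))))"

definition massey_tuple :: "'b::real_vector dga \<Rightarrow> (nat mat \<times> 'b set mat) list \<Rightarrow> bool" where
  "massey_tuple A Vs \<longleftrightarrow>
     2 \<le> length Vs \<and> (\<forall>V \<in> set Vs. coh_mat A V) \<and>
     (\<forall>i. Suc i < length Vs \<longrightarrow> multipliable (fst (Vs ! i)) (fst (Vs ! Suc i)))"

text \<open>
  The degrees \<open>(D\<^sub>i - 1) * \<dots> * (D\<^sub>j - 1) + 1\<close> of the \<open>(i, j)\<close> entry of a defining system.  All \<open>D\<^sub>i\<close> have
  positive entries, so the subtraction is not truncated.  Indices start at \<open>0\<close>.
\<close>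

definition deg_mat :: "(nat mat \<times> 'b set mat) list \<Rightarrow> nat \<Rightarrow> nat \<Rightarrow> nat mat" where
  "deg_mat Vs i j = map_mat Suc
     (foldl (\<lambda>D r. deg_star D (map_mat (\<lambda>d. d - 1) (fst (Vs ! r))))
        (map_mat (\<lambda>d. d - 1) (fst (Vs ! i))) [Suc i..<Suc j])"

definition massey_sum ::
  "'b::real_vector dga \<Rightarrow> (nat mat \<times> 'b set mat) list \<Rightarrow> (nat \<Rightarrow> nat \<Rightarrow> 'b mat) \<Rightarrow> nat \<Rightarrow> nat \<Rightarrow> 'b mat"
where
  "massey_sum A Vs X i j = mat (dim_row (X i i)) (dim_col (X j j))
     (\<lambda>ab. \<Sum>r = i..<j. mat_prod A (bar (deg_mat Vs i r) (X i r)) (X (Suc r) j) $$ ab)"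

definition defining_system ::
  "'b::real_vector dga \<Rightarrow> (nat mat \<times> 'b set mat) list \<Rightarrow> (nat \<Rightarrow> nat \<Rightarrow> 'b mat) \<Rightarrow> bool" where
  "defining_system A Vs X \<longleftrightarrow>
     (\<forall>i < length Vs. map_mat (coh_class A) (X i i) = snd (Vs ! i)) \<and>
     (\<forall>j < length Vs. \<forall>i \<le> j. (i, j) \<noteq> (0, length Vs - 1) \<longrightarrow>
        homog_mat A (deg_mat Vs i j) (X i j) \<and>
        map_mat (diff A) (X i j) = massey_sum A Vs X i j)"

definition massey_product :: "'b::real_vector dga \<Rightarrow> (nat mat \<times> 'b set mat) list \<Rightarrow> 'b set mat set" where
  "massey_product A Vs =
     {map_mat (coh_class A) (massey_sum A Vs X 0 (length Vs - 1)) | X. defining_system A Vs X}"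

text \<open>All entries of elements of matrix Massey products of fewer than \<open>k\<close> matrices.\<close>

definition lower_massey_entries :: "'b::real_vector dga \<Rightarrow> nat \<Rightarrow> 'b set set" where
  "lower_massey_entries A k =
     (\<Union>Ws \<in> {Ws. massey_tuple A Ws \<and> length Ws < k}. \<Union>a \<in> massey_product A Ws. elements_mat a)"

text \<open>
  The product of the tuple is defined and its weight is strictly equal to the length of the tuple.
\<close>

definition strict_weight :: "'b::real_vector dga \<Rightarrow> (nat mat \<times> 'b set mat) list \<Rightarrow> bool" where
  "strict_weight A Vs \<longleftrightarrow>
     massey_tuple A Vs \<and>
     (\<exists>a \<in> massey_product A Vs.
        \<not> elements_mat a \<subseteq> coh_span A (lower_massey_entries A (length Vs)))"

text \<open>
  A type of points for closed manifolds.  A manifold has at most continuum many points, so each is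
  diffeomorphic to one whose points are elements of this type.
\<close>

type_synonym point = "(nat \<Rightarrow> real) set"

end

theory Submission
  imports Defs "HOL-Computational_Algebra.Polynomial"
begin

text \<open>
  Let \<open>n = 2 k\<close> and let \<open>M\<close> be the mapping torus of a unipotent automorphism of the torus of dimension
  \<open>n - 1\<close>, that is, the compact quotient of the filiform nilpotent Lie group of dimension \<open>n\<close>. It has a
  global frame \<open>E 0, \<dots>, E (n - 1)\<close> with \<open>[E 0, E i] = E (i + 1)\<close> for \<open>i \<ge> 1\<close>. If
  \<open>\<omega> i\<close> is the dual coframe, the alternating sum of the \<open>\<omega> i \<and> \<omega> (n - 1 - i)\<close> is a
  symplectic form, and the forms \<open>\<omega> i\<close> provide a defining system for the \<open>n\<close>-tuple product
  \<open>\<langle>\<omega> 0, \<dots>, \<omega> 0, \<omega> 1\<rangle>\<close> with cocycle \<open>- \<omega> 0 \<and> \<omega> (n - 1)\<close>.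
  Its integral over a 2-torus tangent to \<open>E 0\<close> and the central field \<open>E (n - 1)\<close> is nonzero.

  For an \<open>l\<close>-tuple product with \<open>l < n\<close> whose cocycle has degree 2 the relevant part of a defining system
  consists of 1-forms. It is a connection with values in strictly upper triangular matrices of \<open>l + 1\<close> blocks which
  is flat except in the corner. A power of the central generator is an \<open>(n - 2)\<close>-fold iterated commutator
  in the fundamental group and unipotent matrices are torsion-free, hence its transport is trivial between levels that differ by less than \<open>n - 1\<close>.
  Integrating the corner equation over the 2-torus, Stokes' theorem shows that the integral of the cocycle vanishes.
  This is a linear condition, so the long product is not a combination of shorter ones.
\<close>

section \<open>Smooth functions of finitely many coordinates\<close>

text \<open>The corner entry of a defining system does not exist, so there is no transport from
  level \<open>0\<close> to level \<open>l\<close>. For \<open>l < n\<close> all other pairs of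
  levels differ by at most \<open>l - 1 \<le> n - 2\<close>, which is just too little to see the
  centre. The primitive of the cocycle built from the transport lives on the universal cover and is
  not invariant under deck transformations, so Stokes' theorem leaves boundary terms; they vanish by
  the same triviality of the central holonomy, used a second time. Evaluation on \<open>E 0\<close>
  and \<open>E (n - 1)\<close> discards all components of degree other than 2, and it kills exact
  forms because these fields commute, so it gives a functional on cohomology. Evenness of
  \<open>n\<close> makes the symplectic form alternating and closed. No Lie group is constructed:
  the manifold is a quotient of a coordinate space by an explicit relation, and calculus is done on
  lifts. Since forms are functions on derivations, every derivation has to be expanded in the frame
  before anything can be computed; Hadamard's lemma and bump functions serve this purpose.\<close>

definition Rn :: "nat \<Rightarrow> (nat \<Rightarrow> real) set" where
  "Rn n = {x. \<forall>i\<ge>n. x i = 0}"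

lemma topspace_Euclidean: "topspace (Euclidean_space n) = Rn n"
  by (simp add: topspace_Euclidean_space Rn_def)

lemma Euclidean_space_eq: "Euclidean_space n = top_of_set (Rn n)"
  by (simp add: Euclidean_space_def Rn_def euclidean_product_topology)

lemma Rn_upd: "x \<in> Rn n \<Longrightarrow> i < n \<Longrightarrow> x(i := t) \<in> Rn n"
  by (auto simp: Rn_def)

abbreviation open_Rn :: "nat \<Rightarrow> (nat \<Rightarrow> real) set \<Rightarrow> bool" where
  "open_Rn n V \<equiv> openin (top_of_set (Rn n)) V"

lemma open_Rn_subset: "open_Rn n V \<Longrightarrow> V \<subseteq> Rn n"
  using openin_imp_subset by blast

lemma open_Rn_Rn [simp]: "open_Rn n (Rn n)"
  by simp

lemma continuous_on_fun_upd:
  fixes x :: "nat \<Rightarrow> real"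
  shows "continuous_on A (\<lambda>t. x(i := t))"
proof (rule continuous_on_coordinatewise_then_product)
  fix j
  show "continuous_on A (\<lambda>t. (x(i := t)) j)"
    by (cases "j = i") (auto intro!: continuous_intros)
qed

text \<open>Changing a coordinate below \<open>n\<close> does not leave \<open>Rn n\<close>, so
  relative openness suffices. This makes partial derivatives local although \<open>Rn n\<close> has
  empty interior in the product.\<close>

lemma eventually_line:
  assumes "open_Rn n V" "x \<in> V" "i < n"
  shows "\<forall>\<^sub>F t in nhds (x i). x(i := t) \<in> V"
proof -
  obtain W where W: "open W" "V = Rn n \<inter> W"
    using assms(1) by (auto simp: openin_open)
  have "open ((\<lambda>t. x(i := t)) -` W)"
    using continuous_on_fun_upd[of UNIV x i] W(1) by (simp add: continuous_on_open_vimage)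
  moreover have "x i \<in> (\<lambda>t. x(i := t)) -` W"
    using assms(2) W by simp
  ultimately have "\<forall>\<^sub>F t in nhds (x i). t \<in> (\<lambda>t. x(i := t)) -` W"
    by (rule eventually_nhds_in_open)
  then show ?thesis
    by eventually_elim (use assms W open_Rn_subset in \<open>auto intro: Rn_upd\<close>)
qed

text \<open>Differentiability order by order, peeling off the innermost derivative. Unlike the
  quantification over lists of indices in \<open>smooth_on\<close>, this supports induction on the
  order with the function generalised.\<close>

primrec ck :: "nat \<Rightarrow> (nat \<Rightarrow> real) set \<Rightarrow> nat \<Rightarrow> ((nat \<Rightarrow> real) \<Rightarrow> real) \<Rightarrow> bool" where
  "ck n V 0 f \<longleftrightarrow> continuous_on V f"
| "ck n V (Suc m) f \<longleftrightarrow> continuous_on V f \<and>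
     (\<forall>x\<in>V. \<forall>i<n. (\<lambda>t. f (x(i := t))) field_differentiable at (x i)) \<and>
     (\<forall>i<n. ck n V m (partial_deriv i f))"

lemma ck_continuous: "ck n V m f \<Longrightarrow> continuous_on V f"
  by (cases m) auto

lemma ck_deriv:
  "ck n V (Suc m) f \<Longrightarrow> x \<in> V \<Longrightarrow> i < n \<Longrightarrow>
    ((\<lambda>t. f (x(i := t))) has_real_derivative partial_deriv i f x) (at (x i))"
  by (auto simp: partial_deriv_def DERIV_deriv_iff_field_differentiable)

lemma ck_partial: "ck n V (Suc m) f \<Longrightarrow> i < n \<Longrightarrow> ck n V m (partial_deriv i f)"
  by simp

lemma ck_differentiable:
  "ck n V (Suc m) f \<Longrightarrow> x \<in> V \<Longrightarrow> i < n \<Longrightarrow> (\<lambda>t. f (x(i := t))) field_differentiable at (x i)"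
  by simp

lemma ck_Suc: "ck n V (Suc m) f \<Longrightarrow> ck n V m f"
  by (induction m arbitrary: f) auto

lemma smooth_on_iff_ck:
  assumes "V \<subseteq> Rn n"
  shows "smooth_on n V f \<longleftrightarrow> (\<forall>m. ck n V m f)"
proof -
  have cont: "continuous_map (subtopology (Euclidean_space n) V) euclideanreal g \<longleftrightarrow> continuous_on V g" for g
  proof -
    have "Rn n \<inter> V = V" using assms by auto
    then show ?thesis
      by (simp add: Euclidean_space_eq subtopology_subtopology)
  qed
  have smooth: "continuous_on V (foldr partial_deriv js f) \<and>
      (\<forall>x\<in>V. \<forall>i<n. (\<lambda>t. foldr partial_deriv js f (x(i := t))) field_differentiable at (x i))"
    if "smooth_on n V f" "js \<in> lists {..<n}" for f js
    using that by (simp add: smooth_on_def Let_def cont)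
  have "ck n V m f" if "smooth_on n V f" for m
    using that
  proof (induction m arbitrary: f)
    case 0
    then show ?case
      using smooth[of f "[]"] by simp
  next
    case (Suc m)
    have "smooth_on n V (partial_deriv i f)" if "i < n" for i
      unfolding smooth_on_def Let_def cont
    proof
      fix js assume "js \<in> lists {..<n}"
      then have "js @ [i] \<in> lists {..<n}" using that by auto
      from smooth[OF Suc.prems this] show "continuous_on V (foldr partial_deriv js (partial_deriv i f)) \<and>
         (\<forall>x\<in>V. \<forall>k<n. (\<lambda>t. foldr partial_deriv js (partial_deriv i f) (x(k := t))) field_differentiable at (x k))"
        by simp
    qed
    then show ?case
      using Suc.IH smooth[OF Suc.prems, of "[]"] by simp
  qed
  moreover have "smooth_on n V f" if *: "\<forall>m. ck n V m f"
  proof -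
    have "continuous_on V (foldr partial_deriv js f) \<and>
      (\<forall>x\<in>V. \<forall>i<n. (\<lambda>t. foldr partial_deriv js f (x(i := t))) field_differentiable at (x i))"
      if "js \<in> lists {..<n}" for js
      using * that
    \<comment> \<open>\<open>foldr\<close> applies the last index of the list first, so the list is
      taken apart from its end.\<close>
    proof (induction js arbitrary: f rule: rev_induct)
      case Nil
      then have "ck n V (Suc 0) f" by blast
      from ck_continuous[OF this] ck_differentiable[OF this] show ?case
        by (simp only: foldr.simps id_apply) blast
    next
      case (snoc i js)
      have "\<forall>m. ck n V m (partial_deriv i f)"
        using snoc.prems by (auto intro: ck_partial)
      then show ?case
        using snoc.IH snoc.prems(2) by simp
    qed
    then show "smooth_on n V f"
      by (simp add: smooth_on_def cont Let_def)
  qed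
  ultimately show ?thesis by blast
qed

lemma field_differentiable_cong_ev:
  fixes f g :: "real \<Rightarrow> real"
  assumes "\<forall>\<^sub>F t in nhds a. f t = g t"
  shows "f field_differentiable at a \<longleftrightarrow> g field_differentiable at a"
proof -
  have "f a = g a" using assms by (rule eventually_nhds_x_imp_x)
  then show ?thesis
    unfolding field_differentiable_def
    using has_field_derivative_cong_ev[of a a UNIV f g] assms eventually_mono by fastforce
qed

lemma partial_deriv_cong:
  assumes "open_Rn n V" "\<And>x. x \<in> V \<Longrightarrow> f x = g x" "x \<in> V" "i < n"
  shows "partial_deriv i f x = partial_deriv i g x"
  unfolding partial_deriv_def
  by (rule deriv_cong_ev) (use eventually_line[OF assms(1,3,4)] in \<open>auto elim!: eventually_mono simp: assms(2)\<close>)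

lemma ck_cong:
  assumes "open_Rn n V" "\<And>x. x \<in> V \<Longrightarrow> f x = g x" "ck n V m f"
  shows "ck n V m g"
  using assms(2,3)
proof (induction m arbitrary: f g)
  case 0
  then show ?case using continuous_on_cong by force
next
  case (Suc m)
  have "(\<lambda>t. g (x(i := t))) field_differentiable at (x i)" if "x \<in> V" "i < n" for x i
  proof -
    have "\<forall>\<^sub>F t in nhds (x i). f (x(i := t)) = g (x(i := t))"
      using eventually_line[OF assms(1) that] by eventually_elim (rule Suc.prems)
    then show ?thesis
      by (rule iffD1[OF field_differentiable_cong_ev ck_differentiable[OF Suc.prems(2) that]])
  qed
  moreover have "continuous_on V g"
    using Suc.prems continuous_on_cong by force
  moreover have "ck n V m (partial_deriv i g)" if "i < n" for i
    by (rule Suc.IH[OF _ ck_partial[OF Suc.prems(2) that]])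
      (rule partial_deriv_cong[OF assms(1) Suc.prems(1) _ that])
  ultimately show ?case unfolding ck.simps by blast
qed

text \<open>The working rule for all closure properties: any functions \<open>D i\<close> that are
  the partial derivatives on an open \<open>V\<close> may replace \<open>partial_deriv i f\<close>,
  since \<open>ck\<close> depends only on values in \<open>V\<close>.\<close>

lemma ck_SucI:
  assumes "open_Rn n V" "continuous_on V f"
    and "\<And>x i. x \<in> V \<Longrightarrow> i < n \<Longrightarrow> ((\<lambda>t. f (x(i := t))) has_real_derivative D i x) (at (x i))"
    and "\<And>i. i < n \<Longrightarrow> ck n V m (D i)"
  shows "ck n V (Suc m) f"
proof -
  have "partial_deriv i f x = D i x" if "x \<in> V" "i < n" for x i
    unfolding partial_deriv_def by (rule DERIV_imp_deriv) (rule assms(3)[OF that])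
  then have "ck n V m (partial_deriv i f)" if "i < n" for i
    by (intro ck_cong[OF assms(1) _ assms(4)[OF that]]) (use that in auto)
  then show ?thesis
    using assms(2,3) unfolding ck.simps field_differentiable_def by blast
qed

lemma ck_subset:
  assumes "V' \<subseteq> V" "ck n V m f"
  shows "ck n V' m f"
  using assms(2)
proof (induction m arbitrary: f)
  case 0
  then show ?case using assms(1) continuous_on_subset by auto
next
  case (Suc m)
  then show ?case unfolding ck.simps using assms(1) continuous_on_subset by blast
qed

lemma continuous_on_local_Rn:
  fixes f :: "(nat \<Rightarrow> real) \<Rightarrow> real"
  assumes "V \<subseteq> Rn n" "\<And>x. x \<in> V \<Longrightarrow> \<exists>W. open_Rn n W \<and> x \<in> W \<and> continuous_on W f"
  shows "continuous_on V f"
proof -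
  have "continuous (at x within V) f" if "x \<in> V" for x
  proof -
    from assms(2)[OF that] obtain W where W: "open_Rn n W" "x \<in> W" "continuous_on W f"
      by (elim exE conjE)
    obtain S where S: "open S" "W = Rn n \<inter> S"
      using W(1) by (auto simp: openin_open)
    have "continuous (at x within W) f"
      using W by (simp add: continuous_on_eq_continuous_within)
    moreover have "at x within V = at x within (V \<inter> S)"
      by (rule at_within_nhd[of x S]) (use S W in auto)
    moreover have "V \<inter> S \<subseteq> W" using assms(1) S by auto
    ultimately show ?thesis
      by (metis continuous_within_subset)
  qed
  then show ?thesis by (simp add: continuous_on_eq_continuous_within)
qed

text \<open>Smoothness is local, so that it can be checked separately near each point, with a
  formula for the function that depends on the point.\<close>

lemma ck_local:
  assumes "V \<subseteq> Rn n" "\<And>x. x \<in> V \<Longrightarrow> \<exists>W. open_Rn n W \<and> x \<in> W \<and> ck n W m f"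
  shows "ck n V m f"
  using assms(2)
proof (induction m arbitrary: f)
  case 0
  then show ?case by (simp add: continuous_on_local_Rn[OF assms(1)])
next
  case (Suc m)
  have W: "\<exists>W. open_Rn n W \<and> x \<in> W \<and> continuous_on W f \<and> (\<forall>i<n. (\<lambda>t. f (x(i := t))) field_differentiable at (x i)) \<and>
     (\<forall>i<n. ck n W m (partial_deriv i f))" if "x \<in> V" for x
    using Suc.prems[OF that] by (elim exE conjE, unfold ck.simps) metis
  have "continuous_on V f"
  proof (rule continuous_on_local_Rn[OF assms(1)])
    fix x assume "x \<in> V"
    from W[OF this] show "\<exists>W. open_Rn n W \<and> x \<in> W \<and> continuous_on W f" by metis
  qed
  moreover have "ck n V m (partial_deriv i f)" if "i < n" for i
  proof (rule Suc.IH)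
    fix x assume "x \<in> V"
    from W[OF this] show "\<exists>W. open_Rn n W \<and> x \<in> W \<and> ck n W m (partial_deriv i f)" using that by metis
  qed
  moreover have "(\<lambda>t. f (x(i := t))) field_differentiable at (x i)" if "x \<in> V" "i < n" for x i
    using W[OF that(1)] that(2) by metis
  ultimately show ?case
    unfolding ck.simps by metis
qed

lemma ck_const: "open_Rn n V \<Longrightarrow> ck n V m (\<lambda>x. c)"
proof (induction m arbitrary: c)
  case (Suc m)
  then show ?case
    by (intro ck_SucI[where D="\<lambda>i x. 0"]) auto
qed auto

lemma continuous_on_coord [continuous_intros]: "continuous_on V (\<lambda>x. x i :: real)"
  by (rule continuous_on_subset[OF continuous_on_product_coordinates]) simp

lemma ck_coord: "open_Rn n V \<Longrightarrow> ck n V m (\<lambda>x. x j)"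
proof (cases m)
  case (Suc m')
  assume V: "open_Rn n V"
  show ?thesis
    unfolding Suc
  proof (rule ck_SucI[OF V, where D="\<lambda>i x. if i = j then 1 else 0"])
    fix x :: "nat \<Rightarrow> real" and i
    show "((\<lambda>t. (x(i := t)) j) has_real_derivative (if i = j then 1 else 0)) (at (x i))"
      by (auto intro!: derivative_eq_intros)
  qed (auto intro!: ck_const[OF V] continuous_on_coord)
qed (auto intro: continuous_on_coord)

lemma ck_add: "open_Rn n V \<Longrightarrow> ck n V m f \<Longrightarrow> ck n V m g \<Longrightarrow> ck n V m (\<lambda>x. f x + g x)"
proof (induction m arbitrary: f g)
  case 0
  then show ?case by (auto intro: continuous_on_add)
next
  case (Suc m)
  show ?case
  proof (intro ck_SucI[where D="\<lambda>i x. partial_deriv i f x + partial_deriv i g x"])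
    show "continuous_on V (\<lambda>x. f x + g x)"
      using Suc.prems ck_continuous by (blast intro: continuous_on_add)
  next
    fix x i assume "x \<in> V" "i < n"
    then show "((\<lambda>t. f (x(i := t)) + g (x(i := t))) has_real_derivative
            partial_deriv i f x + partial_deriv i g x) (at (x i))"
      by (intro DERIV_add ck_deriv[OF Suc.prems(2)] ck_deriv[OF Suc.prems(3)])
  qed (intro Suc ck_partial; assumption)+
qed

lemma ck_mult: "open_Rn n V \<Longrightarrow> ck n V m f \<Longrightarrow> ck n V m g \<Longrightarrow> ck n V m (\<lambda>x. f x * g x)"
proof (induction m arbitrary: f g)
  case 0
  then show ?case by (auto intro: continuous_on_mult)
next
  case (Suc m)
  show ?case
  proof (intro ck_SucI[where D="\<lambda>i x. partial_deriv i f x * g x + partial_deriv i g x * f x"])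
    fix i assume i: "i < n"
    show "ck n V m (\<lambda>x. partial_deriv i f x * g x + partial_deriv i g x * f x)"
      by (intro ck_add Suc.IH Suc.prems(1) ck_partial[OF Suc.prems(2) i] ck_partial[OF Suc.prems(3) i]
          ck_Suc[OF Suc.prems(2)] ck_Suc[OF Suc.prems(3)])
  next
    fix x i assume x: "x \<in> V" "i < n"
    show "((\<lambda>t. f (x(i := t)) * g (x(i := t))) has_real_derivative
            partial_deriv i f x * g x + partial_deriv i g x * f x) (at (x i))"
      using DERIV_mult[OF ck_deriv[OF Suc.prems(2) x] ck_deriv[OF Suc.prems(3) x]] by (simp only: fun_upd_triv)
  next
    show "continuous_on V (\<lambda>x. f x * g x)"
      using Suc.prems ck_continuous by (blast intro: continuous_on_mult)
  qed (rule Suc.prems)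
qed

lemma ck_sum:
  assumes "open_Rn n V" "\<And>i. i \<in> I \<Longrightarrow> ck n V m (f i)"
  shows "ck n V m (\<lambda>x. \<Sum>i\<in>I. f i x)"
  using assms(2)
proof (induction I rule: infinite_finite_induct)
  case (insert a I)
  then show ?case using ck_add[OF assms(1)] by simp
qed (auto intro: ck_const assms)

lemma ck_prod:
  assumes "open_Rn n V" "\<And>i. i \<in> I \<Longrightarrow> ck n V m (f i)"
  shows "ck n V m (\<lambda>x. \<Prod>i\<in>I. f i x)"
  using assms(2)
proof (induction I rule: infinite_finite_induct)
  case (insert a I)
  then show ?case using ck_mult[OF assms(1)] by simp
qed (auto intro: ck_const assms)

lemma ck_diff: "open_Rn n V \<Longrightarrow> ck n V m f \<Longrightarrow> ck n V m g \<Longrightarrow> ck n V m (\<lambda>x. f x - g x)"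
  using ck_add[of n V m f "\<lambda>x. -1 * g x"] ck_mult[of n V m "\<lambda>x. -1" g] ck_const[of n V m "-1"] by simp

lemma ck_inverse:
  assumes V: "open_Rn n V" and nz: "\<And>x. x \<in> V \<Longrightarrow> f x \<noteq> 0"
  shows "ck n V m f \<Longrightarrow> ck n V m (\<lambda>x. inverse (f x))"
proof (induction m)
  case 0
  then show ?case using nz by (auto intro: continuous_on_inverse)
next
  case (Suc m)
  show ?case
  proof (intro ck_SucI[where D="\<lambda>i x. -1 * (inverse (f x) * (partial_deriv i f x * inverse (f x)))"] V)
    fix i assume i: "i < n"
    show "ck n V m (\<lambda>x. -1 * (inverse (f x) * (partial_deriv i f x * inverse (f x))))"
      by (intro ck_mult V ck_const Suc.IH ck_partial[OF Suc.prems i] ck_Suc[OF Suc.prems])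
  next
    fix x i assume x: "x \<in> V" "i < n"
    show "((\<lambda>t. inverse (f (x(i := t)))) has_real_derivative
            -1 * (inverse (f x) * (partial_deriv i f x * inverse (f x)))) (at (x i))"
      by (rule DERIV_cong[OF DERIV_inverse_fun[OF ck_deriv[OF Suc.prems x]]]) (use nz x in simp_all)
  next
    show "continuous_on V (\<lambda>x. inverse (f x))"
      using ck_continuous[OF Suc.prems] nz by (blast intro: continuous_on_inverse)
  qed
qed

section \<open>Chain rule and composition\<close>

lemma tendsto_coordinatewise:
  fixes f :: "'a \<Rightarrow> 'b \<Rightarrow> 'c::topological_space"
  assumes "\<And>i. ((\<lambda>x. f x i) \<longlongrightarrow> l i) F"
  shows "(f \<longlongrightarrow> l) F"
proof -
  have "limitin (product_topology (\<lambda>i. euclidean) UNIV) f l F"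
    unfolding limitin_componentwise using assms by (auto simp: limitin_canonical_iff)
  then show ?thesis
    by (simp add: euclidean_product_topology limitin_canonical_iff)
qed

lemma continuous_on_Rn_compose:
  fixes F :: "(nat \<Rightarrow> real) \<Rightarrow> real" and a :: "'a::topological_space \<Rightarrow> nat \<Rightarrow> real"
  assumes "continuous_on (Rn p) F" "\<And>i. continuous_on S (\<lambda>z. a z i)" "\<And>z. z \<in> S \<Longrightarrow> a z \<in> Rn p"
  shows "continuous_on S (\<lambda>z. F (a z))"
  by (rule continuous_on_compose2[OF assms(1) continuous_on_coordinatewise_then_product[OF assms(2)]])
    (use assms(3) in auto)

text \<open>The coordinates are moved from \<open>c s0\<close> to \<open>c s\<close> one at a time;
  \<open>mix k s\<close> has moved those below \<open>k\<close>. Moving one more needs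
  differentiability in the pair of the parameter and the new coordinate, which holds because the
  partial derivative in the new coordinate is continuous.\<close>

lemma chain_rule_curve:
  fixes F :: "(nat \<Rightarrow> real) \<Rightarrow> real" and c :: "real \<Rightarrow> nat \<Rightarrow> real"
  assumes F: "ck p (Rn p) (Suc 0) F" and c: "\<And>s. c s \<in> Rn p"
    and dc: "\<And>j. j < p \<Longrightarrow> ((\<lambda>s. c s j) has_real_derivative c' j) (at s0)"
  shows "((\<lambda>s. F (c s)) has_real_derivative (\<Sum>j<p. c' j * partial_deriv j F (c s0))) (at s0)"
proof -
  define mix where "mix = (\<lambda>k s j. if j < k then c s j else c s0 j)"
  have mix_Rn: "mix k s \<in> Rn p" for k s
    using c by (auto simp: mix_def Rn_def)
  have "((\<lambda>s. F (mix k s)) has_real_derivative (\<Sum>j<k. c' j * partial_deriv j F (c s0))) (at s0)" if "k \<le> p" for k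
    using that
  proof (induction k)
    case 0
    then show ?case by (simp add: mix_def)
  next
    case (Suc k)
    then have k: "k < p" by simp
    let ?pt = "\<lambda>s r. (mix k s)(k := r)"
    let ?D = "partial_deriv k F"
    have pt: "?pt s r \<in> Rn p" for s r
      using Rn_upd[OF mix_Rn k] .
    have pt0: "?pt s0 (c s0 k) = c s0"
      by (auto simp: mix_def)
    have mixk: "?pt s (c s0 k) = mix k s" for s
      by (auto simp: mix_def)
    have tend: "((\<lambda>z. ?D (?pt (fst z) (snd z))) \<longlongrightarrow> ?D (c s0)) (at (s0, c s0 k))"
    proof (rule continuous_on_tendsto_compose[of "Rn p" ?D])
      show "continuous_on (Rn p) ?D"
        using ck_continuous[OF ck_partial[OF F k]] .
      show "((\<lambda>z. ?pt (fst z) (snd z)) \<longlongrightarrow> c s0) (at (s0, c s0 k))"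
      proof (rule tendsto_coordinatewise)
        fix i
        consider "i = k" | "i < k" | "i > k" by linarith
        then show "((\<lambda>z. ?pt (fst z) (snd z) i) \<longlongrightarrow> c s0 i) (at (s0, c s0 k))"
        proof cases
          case 1
          have "((\<lambda>z. snd z) \<longlongrightarrow> snd (s0, c s0 k)) (at (s0, c s0 k))"
            by (intro tendsto_intros)
          then show ?thesis using 1 by simp
        next
          case 2
          have "isCont (\<lambda>s. c s i) s0"
            using dc[of i] 2 k DERIV_isCont by force
          then have "((\<lambda>z. c (fst z) i) \<longlongrightarrow> c s0 i) (at (s0, c s0 k))"
            by (rule isCont_tendsto_compose) (use tendsto_fst[OF tendsto_ident_at, of "(s0, c s0 k)" UNIV] in simp)
          then show ?thesis using 2 by (simp add: mix_def)
        next
          case 3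
          then show ?thesis by (simp add: mix_def)
        qed
      qed
    qed (use c pt in auto)
    have "((\<lambda>(s, r). F (?pt s r)) has_derivative
       (\<lambda>(hs, hr). (\<Sum>j<k. c' j * partial_deriv j F (c s0)) * hs + blinfun_mult_right (?D (?pt s0 (c s0 k))) hr))
       (at (s0, c s0 k) within UNIV \<times> UNIV)"
    proof (rule has_derivative_partialsI[where fy="\<lambda>s r. blinfun_mult_right (?D (?pt s r))"])
      show "((\<lambda>s. F (?pt s (c s0 k))) has_derivative (*) (\<Sum>j<k. c' j * partial_deriv j F (c s0))) (at s0)"
        using Suc.IH k unfolding mixk by (simp add: has_field_derivative_def)
    next
      fix s r :: real
      have "((\<lambda>t. F ((?pt s r)(k := t))) has_real_derivative ?D (?pt s r)) (at (?pt s r k))"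
        by (rule ck_deriv[OF F pt k])
      then show "((\<lambda>r. F (?pt s r)) has_derivative blinfun_apply (blinfun_mult_right (?D (?pt s r)))) (at r)"
        by (simp add: has_field_derivative_def)
    next
      have "((\<lambda>z. blinfun_mult_right (?D (?pt (fst z) (snd z)))) \<longlongrightarrow> blinfun_mult_right (?D (c s0))) (at (s0, c s0 k))"
        by (rule bounded_linear.tendsto[OF bounded_linear_blinfun_mult_right tend])
      then show "continuous (at (s0, c s0 k) within UNIV \<times> UNIV) (\<lambda>(s, r). blinfun_mult_right (?D (?pt s r)))"
        unfolding continuous_within case_prod_beta fst_conv snd_conv pt0 UNIV_Times_UNIV .
    qed auto
    then have 1: "((\<lambda>(s, r). F (?pt s r)) has_derivative
       (\<lambda>(hs, hr). (\<Sum>j<k. c' j * partial_deriv j F (c s0)) * hs + ?D (c s0) * hr)) (at (s0, c s0 k))"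
      unfolding pt0 by simp
    have 2: "((\<lambda>s. (s, c s k)) has_derivative (\<lambda>h. (h, c' k * h))) (at s0)"
      using dc[OF k] by (auto intro!: derivative_eq_intros simp: has_field_derivative_def)
    have "((\<lambda>s. F (?pt s (c s k))) has_derivative
       (\<lambda>h. (\<Sum>j<k. c' j * partial_deriv j F (c s0)) * h + ?D (c s0) * (c' k * h))) (at s0)"
      using has_derivative_compose[OF 2 1] by simp
    moreover have "?pt s (c s k) = mix (Suc k) s" for s
      by (auto simp: mix_def less_Suc_eq)
    ultimately have *: "((\<lambda>s. F (mix (Suc k) s)) has_derivative
       (\<lambda>h. (\<Sum>j<k. c' j * partial_deriv j F (c s0)) * h + ?D (c s0) * (c' k * h))) (at s0)"
      by simp
    show ?case
      unfolding has_field_derivative_def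
      by (rule has_derivative_eq_rhs[OF *]) (simp add: fun_eq_iff algebra_simps)
  qed
  moreover have "mix p s = c s" for s
    using c[of s] c[of s0] by (auto simp: mix_def Rn_def)
  ultimately show ?thesis by force
qed

text \<open>The tuple of inner functions is padded with 0 from index \<open>p\<close> on to be a
  point of \<open>Rn p\<close>. The induction generalises \<open>F\<close>, since the chain rule
  replaces it by its partial derivatives.\<close>

lemma ck_compose:
  assumes V: "open_Rn n V" and \<phi>: "\<And>j m. j < p \<Longrightarrow> ck n V m (\<phi> j)"
    and F: "\<And>m. ck p (Rn p) m F"
  shows "ck n V m (\<lambda>x. F (\<lambda>j. if j < p then \<phi> j x else 0))"
  using F
proof (induction m arbitrary: F)
  case 0
  have "continuous_on V (\<lambda>x. F (\<lambda>j. if j < p then \<phi> j x else 0))"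
  proof (rule continuous_on_Rn_compose[where a="\<lambda>x j. if j < p then \<phi> j x else 0"])
    show "continuous_on (Rn p) F" using ck_continuous[OF 0] .
    show "continuous_on V (\<lambda>x. if i < p then \<phi> i x else 0)" for i
      by (cases "i < p") (use ck_continuous[OF \<phi>] in auto)
  qed (auto simp: Rn_def)
  then show ?case by simp
next
  case (Suc m)
  show ?case
  proof (intro ck_SucI[where D="\<lambda>i x. \<Sum>j<p. partial_deriv i (\<phi> j) x * partial_deriv j F (\<lambda>j. if j < p then \<phi> j x else 0)"] V)
    show "continuous_on V (\<lambda>x. F (\<lambda>j. if j < p then \<phi> j x else 0))"
    proof (rule continuous_on_Rn_compose[where a="\<lambda>x j. if j < p then \<phi> j x else 0"])
      show "continuous_on (Rn p) F" using ck_continuous[OF Suc.prems] .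
      show "continuous_on V (\<lambda>x. if i < p then \<phi> i x else 0)" for i
        by (cases "i < p") (use ck_continuous[OF \<phi>] in auto)
    qed (auto simp: Rn_def)
  next
    fix x i assume x: "x \<in> V" "i < n"
    have "((\<lambda>t. F (\<lambda>j. if j < p then \<phi> j (x(i := t)) else 0)) has_real_derivative
      (\<Sum>j<p. partial_deriv i (\<phi> j) x * partial_deriv j F (\<lambda>j. if j < p then \<phi> j (x(i := x i)) else 0))) (at (x i))"
    proof (rule chain_rule_curve[OF Suc.prems, where c="\<lambda>t j. if j < p then \<phi> j (x(i := t)) else 0"])
      fix j assume "j < p"
      then show "((\<lambda>t. if j < p then \<phi> j (x(i := t)) else 0) has_real_derivative partial_deriv i (\<phi> j) x) (at (x i))"
        using ck_deriv[OF \<phi> x] by simp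
    qed (auto simp: Rn_def)
    then show "((\<lambda>t. F (\<lambda>j. if j < p then \<phi> j (x(i := t)) else 0)) has_real_derivative
      (\<Sum>j<p. partial_deriv i (\<phi> j) x * partial_deriv j F (\<lambda>j. if j < p then \<phi> j x else 0))) (at (x i))"
      by (simp only: fun_upd_triv)
  next
    fix i assume i: "i < n"
    show "ck n V m (\<lambda>x. \<Sum>j<p. partial_deriv i (\<phi> j) x * partial_deriv j F (\<lambda>j. if j < p then \<phi> j x else 0))"
    proof (intro ck_sum ck_mult V)
      fix j assume "j \<in> {..<p}"
      then have j: "j < p" by simp
      show "ck n V m (partial_deriv i (\<phi> j))"
        by (rule ck_partial[OF \<phi>[OF j] i])
      show "ck n V m (\<lambda>x. partial_deriv j F (\<lambda>j. if j < p then \<phi> j x else 0))"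
        by (rule Suc.IH) (rule ck_partial[OF Suc.prems j])
    qed
  qed
qed

text \<open>A class \<open>G\<close> of real functions closed under differentiation stands in for
  smoothness in one variable. It is instantiated by the functions \<open>flat_fun P\<close>, where
  differentiation changes \<open>P\<close>.\<close>

lemma ck_compose_real:
  assumes V: "open_Rn n V" and \<psi>: "\<And>m. ck n V m \<psi>"
    and fam: "\<And>g. g \<in> G \<Longrightarrow> \<exists>g'\<in>G. \<forall>t. (g has_real_derivative g' t) (at t)" and "g \<in> G"
  shows "ck n V m (\<lambda>x. g (\<psi> x))"
  using \<open>g \<in> G\<close>
proof (induction m arbitrary: g)
  have cont: "continuous_on V (\<lambda>x. g (\<psi> x))" if "g \<in> G" for g
  proof -
    have "continuous_on UNIV g"
      using fam[OF that] by (metis DERIV_isCont continuous_at_imp_continuous_on)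
    then show ?thesis
      using ck_continuous[OF \<psi>] continuous_on_compose2 by blast
  qed
  {
    case 0
    then show ?case using cont by simp
  next
    case (Suc m)
    obtain g' where g': "g' \<in> G" "\<And>t. (g has_real_derivative g' t) (at t)"
      using fam[OF Suc.prems] by blast
    show ?case
    proof (intro ck_SucI[where D="\<lambda>i x. g' (\<psi> x) * partial_deriv i \<psi> x"] V cont[OF Suc.prems])
      fix x i assume x: "x \<in> V" "i < n"
      have "(g has_real_derivative g' (\<psi> (x(i := x i)))) (at (\<psi> (x(i := x i))))"
        by (rule g')
      from DERIV_chain2[OF this ck_deriv[OF \<psi> x]]
      show "((\<lambda>t. g (\<psi> (x(i := t)))) has_real_derivative g' (\<psi> x) * partial_deriv i \<psi> x) (at (x i))"
        by (simp only: fun_upd_triv)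
    next
      fix i assume "i < n"
      then show "ck n V m (\<lambda>x. g' (\<psi> x) * partial_deriv i \<psi> x)"
        by (intro ck_mult V Suc.IH g' ck_partial[OF \<psi>])
    qed
  }
qed

section \<open>Parameter integrals and mixed partial derivatives\<close>

lemma partial_integral:
  assumes H: "ck (Suc n) (Rn (Suc n)) (Suc m) H" and x: "x \<in> Rn n" "i < n"
  shows "((\<lambda>t. integral {0..1} (\<lambda>s. H ((x(i := t))(n := s)))) has_real_derivative
    integral {0..1} (\<lambda>s. partial_deriv i H (x(n := s)))) (at (x i))"
proof -
  have pt: "(x(i := r))(n := s) \<in> Rn (Suc n)" for r s
    using x by (auto simp: Rn_def)
  have cont: "continuous_on (UNIV \<times> cbox 0 1) (\<lambda>z::real\<times>real. K ((x(i := fst z))(n := snd z)))"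
    if "continuous_on (Rn (Suc n)) K" for K :: "(nat \<Rightarrow> real) \<Rightarrow> real"
  proof (rule continuous_on_Rn_compose[OF that _ pt])
    fix k
    show "continuous_on (UNIV \<times> cbox 0 1) (\<lambda>z::real\<times>real. ((x(i := fst z))(n := snd z)) k)"
      by (cases "k = n"; cases "k = i") (auto intro!: continuous_intros)
  qed
  have "((\<lambda>t. integral (cbox 0 1) (\<lambda>s. H ((x(i := t))(n := s)))) has_real_derivative
    integral (cbox 0 1) (\<lambda>s. partial_deriv i H ((x(i := x i))(n := s)))) (at (x i))"
  proof (rule leibniz_rule_field_derivative[where U=UNIV])
    fix r s :: real
    have "((\<lambda>t. H (((x(i := r))(n := s))(i := t))) has_real_derivative partial_deriv i H ((x(i := r))(n := s)))
      (at (((x(i := r))(n := s)) i))"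
      by (rule ck_deriv[OF H pt]) (use x in auto)
    moreover have "((x(i := r))(n := s))(i := t) = (x(i := t))(n := s)" for t
      using x by auto
    moreover have "((x(i := r))(n := s)) i = r" using x by simp
    ultimately show "((\<lambda>t. H ((x(i := t))(n := s))) has_real_derivative partial_deriv i H ((x(i := r))(n := s))) (at r)"
      by simp
  next
    fix r :: real
    have "continuous_on (cbox 0 1) (\<lambda>s. H ((x(i := r))(n := s)))"
    proof (rule continuous_on_Rn_compose[OF ck_continuous[OF H] _ pt])
      fix k show "continuous_on (cbox 0 1) (\<lambda>s. ((x(i := r))(n := s)) k)"
        by (cases "k = n") auto
    qed
    then show "(\<lambda>s. H ((x(i := r))(n := s))) integrable_on cbox 0 1"
      by (rule integrable_continuous)
  next
    show "continuous_on (UNIV \<times> cbox 0 1) (\<lambda>(r, s). partial_deriv i H ((x(i := r))(n := s)))"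
      using cont[OF ck_continuous[OF ck_partial[OF H, of i]]] x by (simp add: case_prod_beta)
  qed auto
  then show ?thesis by (simp only: fun_upd_triv cbox_interval)
qed

text \<open>The integration variable is coordinate \<open>n\<close> of a function of
  \<open>n + 1\<close> coordinates. Joint smoothness is then a single \<open>ck\<close> statement,
  and differentiation under the integral keeps its form.\<close>

lemma ck_integral:
  assumes "ck (Suc n) (Rn (Suc n)) m H"
  shows "ck n (Rn n) m (\<lambda>x. integral {0..1} (\<lambda>s. H (x(n := s))))"
  using assms
proof (induction m arbitrary: H)
  have cont: "continuous_on (Rn n) (\<lambda>x. integral {0..1} (\<lambda>s. H (x(n := s))))"
    if "continuous_on (Rn (Suc n)) H" for H :: "(nat \<Rightarrow> real) \<Rightarrow> real"
  proof -
    have "continuous_on (Rn n \<times> cbox 0 1) (\<lambda>z. H ((fst z)(n := snd z)))"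
    proof (rule continuous_on_Rn_compose[OF that])
      fix k
      show "continuous_on (Rn n \<times> cbox 0 1) (\<lambda>z. ((fst z)(n := snd z :: real)) k)"
      proof (cases "k = n")
        case False
        have "continuous_on (Rn n \<times> cbox 0 (1::real)) (\<lambda>z. fst z k)"
          by (rule continuous_on_product_then_coordinatewise) (intro continuous_intros)
        with False show ?thesis by simp
      qed (auto intro!: continuous_intros)
    qed (auto simp: Rn_def)
    then have "continuous_on (Rn n) (\<lambda>x. integral (cbox 0 1) (\<lambda>s. H (x(n := s))))"
      by (intro integral_continuous_on_param) (simp add: case_prod_beta)
    then show ?thesis by simp
  qed
  {
    case 0
    show ?case using cont[OF ck_continuous[OF 0]] unfolding ck.simps .
  next
    case (Suc m)
    show ?case
    proof (rule ck_SucI[OF open_Rn_Rn cont[OF ck_continuous[OF Suc.prems]] partial_integral[OF Suc.prems]])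
      fix i assume "i < n"
      then show "ck n (Rn n) m (\<lambda>x. integral {0..1} (\<lambda>s. partial_deriv i H (x(n := s))))"
        by (intro Suc.IH ck_partial[OF Suc.prems]) simp
    qed
  }
qed

lemma continuous_on_upd2:
  fixes K :: "(nat \<Rightarrow> real) \<Rightarrow> real" and f g :: "'a::topological_space \<Rightarrow> real"
  assumes "continuous_on (Rn n) K" "x \<in> Rn n" "i < n" "j < n" "continuous_on S f" "continuous_on S g"
  shows "continuous_on S (\<lambda>z. K (x(i := f z, j := g z)))"
proof (rule continuous_on_Rn_compose[OF assms(1), where a="\<lambda>z. x(i := f z, j := g z)"])
  fix k show "continuous_on S (\<lambda>z. (x(i := f z, j := g z)) k)"
    by (cases "k = j"; cases "k = i") (use assms in auto)
qed (use assms in \<open>auto simp: Rn_def\<close>)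

text \<open>The increment of \<open>F\<close> in direction \<open>i\<close> is the integral of its
  partial derivative. Differentiating under the integral in direction \<open>j\<close>, and then
  with respect to the upper limit, gives one mixed derivative as the other.\<close>

lemma partial_deriv_commute:
  assumes F: "ck n (Rn n) (Suc (Suc m)) F" and x: "x \<in> Rn n" and ij: "i < n" "j < n"
  shows "partial_deriv i (partial_deriv j F) x = partial_deriv j (partial_deriv i F) x"
proof (cases "i = j")
  case False
  let ?pt = "\<lambda>u b. x(i := u, j := b)"
  \<comment> \<open>Limits strictly on both sides of \<open>x i\<close>, so that the derivative with
    respect to the upper limit is two-sided there.\<close>
  let ?a = "x i - 1" let ?b = "x i + 1"
  have pt: "?pt u b \<in> Rn n" for u b
    using Rn_upd x ij by simp
  have Fi: "ck n (Rn n) (Suc m) (partial_deriv i F)" and Fj: "ck n (Rn n) (Suc m) (partial_deriv j F)"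
    and Fij: "ck n (Rn n) m (partial_deriv j (partial_deriv i F))"
    using F ij by auto
  have di: "((\<lambda>u. K (?pt u b)) has_real_derivative partial_deriv i K (?pt u b)) (at u)"
    if "ck n (Rn n) (Suc m) K" for K u b
  proof -
    have "((\<lambda>t. K ((?pt u b)(i := t))) has_real_derivative partial_deriv i K (?pt u b)) (at ((?pt u b) i))"
      by (rule ck_deriv[OF that pt ij(1)])
    moreover have "(?pt u b)(i := t) = ?pt t b" for t using False by auto
    moreover have "(?pt u b) i = u" using False by simp
    ultimately show ?thesis by simp
  qed
  have dj: "((\<lambda>b. K (?pt u b)) has_real_derivative partial_deriv j K (?pt u b)) (at b)"
    if "ck n (Rn n) (Suc m) K" for K u b
    using ck_deriv[OF that pt[of u b] ij(2)] by simp
  have diff: "partial_deriv j F (?pt a (x j)) - partial_deriv j F (?pt ?a (x j)) =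
      integral {?a..a} (\<lambda>u. partial_deriv j (partial_deriv i F) (?pt u (x j)))" if "?a \<le> a" for a
  proof -
    have "((\<lambda>b. integral (cbox ?a a) (\<lambda>u. partial_deriv i F (?pt u b))) has_real_derivative
      integral (cbox ?a a) (\<lambda>u. partial_deriv j (partial_deriv i F) (?pt u (x j)))) (at (x j))"
    proof (rule leibniz_rule_field_derivative[where U=UNIV])
      show "((\<lambda>b. partial_deriv i F (?pt u b)) has_real_derivative
          partial_deriv j (partial_deriv i F) (?pt u b)) (at b)" for b u
        by (rule dj[OF Fi])
      show "(\<lambda>u. partial_deriv i F (?pt u b)) integrable_on cbox ?a a" for b
        by (rule integrable_continuous, rule continuous_on_upd2[where f="\<lambda>u. u" and g="\<lambda>_. b", OF ck_continuous[OF Fi] x ij])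
          (intro continuous_intros)+
      show "continuous_on (UNIV \<times> cbox ?a a) (\<lambda>(b, u). partial_deriv j (partial_deriv i F) (?pt u b))"
        unfolding case_prod_beta
        by (rule continuous_on_upd2[where f=snd and g=fst, OF ck_continuous[OF Fij] x ij]) (intro continuous_intros)+
    qed auto
    moreover have "integral (cbox ?a a) (\<lambda>u. partial_deriv i F (?pt u b)) = F (?pt a b) - F (?pt ?a b)" for b
    proof (rule integral_unique, simp only: cbox_interval, rule fundamental_theorem_of_calculus[OF that])
      fix u
      have "((\<lambda>u. F (?pt u b)) has_real_derivative partial_deriv i F (?pt u b)) (at u)"
        by (rule di[OF ck_Suc[OF F]])
      then show "((\<lambda>u. F (?pt u b)) has_vector_derivative partial_deriv i F (?pt u b)) (at u within {?a..a})"
        by (rule has_vector_derivative_at_within[OF has_real_derivative_iff_has_vector_derivative[THEN iffD1]])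
    qed
    ultimately have d1: "((\<lambda>b. F (?pt a b) - F (?pt ?a b)) has_real_derivative
      integral (cbox ?a a) (\<lambda>u. partial_deriv j (partial_deriv i F) (?pt u (x j)))) (at (x j))"
      by simp
    have d2: "((\<lambda>b. F (?pt a b) - F (?pt ?a b)) has_real_derivative
      partial_deriv j F (?pt a (x j)) - partial_deriv j F (?pt ?a (x j))) (at (x j))"
      by (intro DERIV_diff dj[OF ck_Suc[OF F]])
    show ?thesis
      using DERIV_unique[OF d2 d1] by simp
  qed
  have eq: "partial_deriv j F (?pt a (x j)) = integral {?a..a} (\<lambda>u. partial_deriv j (partial_deriv i F) (?pt u (x j)))
      + partial_deriv j F (?pt ?a (x j))" if "?a \<le> a" for a
    using diff[OF that] by linarith
  have "((\<lambda>a. integral {?a..a} (\<lambda>u. partial_deriv j (partial_deriv i F) (?pt u (x j)))) has_real_derivative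
      partial_deriv j (partial_deriv i F) (?pt (x i) (x j))) (at (x i) within {?a..?b})"
  proof (rule integral_has_real_derivative)
    show "continuous_on {?a..?b} (\<lambda>u. partial_deriv j (partial_deriv i F) (?pt u (x j)))"
      by (rule continuous_on_upd2[where f="\<lambda>u. u" and g="\<lambda>_. x j", OF ck_continuous[OF Fij] x ij]) (intro continuous_intros)+
  qed auto
  then have "((\<lambda>a. integral {?a..a} (\<lambda>u. partial_deriv j (partial_deriv i F) (?pt u (x j))) + partial_deriv j F (?pt ?a (x j)))
      has_real_derivative partial_deriv j (partial_deriv i F) (?pt (x i) (x j))) (at (x i) within {?a..?b})"
    by (rule DERIV_cong[OF DERIV_add[OF _ DERIV_const]]) simp
  moreover have "at (x i) within {?a..?b} = at (x i)"
    by (rule at_within_interior) auto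
  ultimately have d1: "((\<lambda>a. integral {?a..a} (\<lambda>u. partial_deriv j (partial_deriv i F) (?pt u (x j))) + partial_deriv j F (?pt ?a (x j)))
      has_real_derivative partial_deriv j (partial_deriv i F) (?pt (x i) (x j))) (at (x i))"
    by (simp only:)
  have "\<forall>\<^sub>F a in nhds (x i). a \<in> {?a<..}"
    by (rule eventually_nhds_in_open) auto
  then have ev: "\<forall>\<^sub>F a in nhds (x i). integral {?a..a} (\<lambda>u. partial_deriv j (partial_deriv i F) (?pt u (x j)))
      + partial_deriv j F (?pt ?a (x j)) = partial_deriv j F (?pt a (x j))"
    by eventually_elim (rule eq[symmetric], simp)
  have d2: "((\<lambda>a. partial_deriv j F (?pt a (x j))) has_real_derivative
      partial_deriv j (partial_deriv i F) (?pt (x i) (x j))) (at (x i))"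
    by (rule iffD1[OF DERIV_cong_ev[OF refl ev refl] d1])
  have "partial_deriv i (partial_deriv j F) (?pt (x i) (x j)) =
     partial_deriv j (partial_deriv i F) (?pt (x i) (x j))"
    by (rule DERIV_unique[OF di[OF Fj] d2])
  then show ?thesis by simp
qed simp

section \<open>Smooth functions on the whole model space\<close>

definition smooth_Rn :: "nat \<Rightarrow> ((nat \<Rightarrow> real) \<Rightarrow> real) \<Rightarrow> bool" where
  "smooth_Rn n F \<longleftrightarrow> (\<forall>m. ck n (Rn n) m F)"

named_theorems smooth_intros

lemma smooth_Rn_ck: "smooth_Rn n F \<Longrightarrow> ck n (Rn n) m F"
  by (simp add: smooth_Rn_def)

lemma smooth_Rn_const [smooth_intros]: "smooth_Rn n (\<lambda>x. c)"
  by (simp add: smooth_Rn_def ck_const)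

lemma smooth_Rn_coord [smooth_intros]: "smooth_Rn n (\<lambda>x. x i)"
  by (simp add: smooth_Rn_def ck_coord)

lemma smooth_Rn_add [smooth_intros]: "smooth_Rn n F \<Longrightarrow> smooth_Rn n G \<Longrightarrow> smooth_Rn n (\<lambda>x. F x + G x)"
  by (simp add: smooth_Rn_def ck_add)

lemma smooth_Rn_diff [smooth_intros]: "smooth_Rn n F \<Longrightarrow> smooth_Rn n G \<Longrightarrow> smooth_Rn n (\<lambda>x. F x - G x)"
  by (simp add: smooth_Rn_def ck_diff)

lemma smooth_Rn_mult [smooth_intros]: "smooth_Rn n F \<Longrightarrow> smooth_Rn n G \<Longrightarrow> smooth_Rn n (\<lambda>x. F x * G x)"
  by (simp add: smooth_Rn_def ck_mult)

lemma smooth_Rn_sum [smooth_intros]: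
  "(\<And>i. i \<in> I \<Longrightarrow> smooth_Rn n (F i)) \<Longrightarrow> smooth_Rn n (\<lambda>x. \<Sum>i\<in>I. F i x)"
  by (simp add: smooth_Rn_def ck_sum)

lemma smooth_Rn_prod [smooth_intros]:
  "(\<And>i. i \<in> I \<Longrightarrow> smooth_Rn n (F i)) \<Longrightarrow> smooth_Rn n (\<lambda>x. \<Prod>i\<in>I. F i x)"
  by (simp add: smooth_Rn_def ck_prod)

lemma smooth_Rn_power [smooth_intros]: "smooth_Rn n F \<Longrightarrow> smooth_Rn n (\<lambda>x. F x ^ k)"
  by (induction k) (auto intro: smooth_intros)

lemma smooth_Rn_partial [smooth_intros]: "smooth_Rn n F \<Longrightarrow> i < n \<Longrightarrow> smooth_Rn n (partial_deriv i F)"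
  unfolding smooth_Rn_def using ck_partial by blast

lemma smooth_Rn_compose:
  assumes "smooth_Rn p F" "\<And>j. j < p \<Longrightarrow> smooth_Rn n (\<phi> j)"
  shows "smooth_Rn n (\<lambda>x. F (\<lambda>j. if j < p then \<phi> j x else 0))"
  unfolding smooth_Rn_def
proof
  show "ck n (Rn n) m (\<lambda>x. F (\<lambda>j. if j < p then \<phi> j x else 0))" for m
    by (rule ck_compose) (use assms in \<open>auto simp: smooth_Rn_def\<close>)
qed

lemma smooth_Rn_integral:
  "smooth_Rn (Suc n) H \<Longrightarrow> smooth_Rn n (\<lambda>x. integral {0..1} (\<lambda>s. H (x(n := s))))"
  by (simp add: smooth_Rn_def ck_integral)

lemma smooth_Rn_cong:
  assumes "smooth_Rn n F" "\<And>x. x \<in> Rn n \<Longrightarrow> F x = G x"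
  shows "smooth_Rn n G"
  using assms ck_cong[OF open_Rn_Rn, of n F G] unfolding smooth_Rn_def by blast

lemma smooth_Rn_continuous: "smooth_Rn n F \<Longrightarrow> continuous_on (Rn n) F"
  using smooth_Rn_ck[of n F 0] by simp

lemma smooth_Rn_deriv:
  "smooth_Rn n F \<Longrightarrow> x \<in> Rn n \<Longrightarrow> i < n \<Longrightarrow>
    ((\<lambda>t. F (x(i := t))) has_real_derivative partial_deriv i F x) (at (x i))"
  by (rule ck_deriv[OF smooth_Rn_ck])

lemma partial_derivI:
  "((\<lambda>t. F (x(i := t))) has_real_derivative D) (at (x i)) \<Longrightarrow> partial_deriv i F x = D"
  unfolding partial_deriv_def by (rule DERIV_imp_deriv)

lemma partial_deriv_const [simp]: "partial_deriv i (\<lambda>x. c) x = 0"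
  by (rule partial_derivI) simp

lemma partial_deriv_coord [simp]: "partial_deriv i (\<lambda>x. x j) x = (if i = j then 1 else 0)"
  by (rule partial_derivI) (auto intro!: derivative_eq_intros)

context
  fixes n i x
  assumes x: "x \<in> Rn n" "i < n"
begin

lemma partial_deriv_add:
  "smooth_Rn n F \<Longrightarrow> smooth_Rn n G \<Longrightarrow> partial_deriv i (\<lambda>x. F x + G x) x = partial_deriv i F x + partial_deriv i G x"
  by (intro partial_derivI DERIV_add smooth_Rn_deriv[OF _ x])

lemma partial_deriv_diff:
  "smooth_Rn n F \<Longrightarrow> smooth_Rn n G \<Longrightarrow> partial_deriv i (\<lambda>x. F x - G x) x = partial_deriv i F x - partial_deriv i G x"
  by (intro partial_derivI DERIV_diff smooth_Rn_deriv[OF _ x])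

lemma partial_deriv_mult:
  assumes "smooth_Rn n F" "smooth_Rn n G"
  shows "partial_deriv i (\<lambda>x. F x * G x) x = partial_deriv i F x * G x + F x * partial_deriv i G x"
proof (rule partial_derivI)
  show "((\<lambda>t. F (x(i := t)) * G (x(i := t))) has_real_derivative
     partial_deriv i F x * G x + F x * partial_deriv i G x) (at (x i))"
    by (rule DERIV_cong[OF DERIV_mult[OF smooth_Rn_deriv[OF assms(1) x] smooth_Rn_deriv[OF assms(2) x]]]) simp
qed

lemma partial_deriv_sum:
  assumes "\<And>k. k \<in> I \<Longrightarrow> smooth_Rn n (F k)"
  shows "partial_deriv i (\<lambda>x. \<Sum>k\<in>I. F k x) x = (\<Sum>k\<in>I. partial_deriv i (F k) x)"
  by (intro partial_derivI DERIV_sum smooth_Rn_deriv[OF _ x] assms)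

lemma partial_deriv_compose:
  assumes F: "smooth_Rn p F" and \<phi>: "\<And>j. j < p \<Longrightarrow> smooth_Rn n (\<phi> j)"
  shows "partial_deriv i (\<lambda>x. F (\<lambda>j. if j < p then \<phi> j x else 0)) x =
    (\<Sum>j<p. partial_deriv i (\<phi> j) x * partial_deriv j F (\<lambda>j. if j < p then \<phi> j x else 0))"
proof -
  have "((\<lambda>t. F (\<lambda>j. if j < p then \<phi> j (x(i := t)) else 0)) has_real_derivative
      (\<Sum>j<p. partial_deriv i (\<phi> j) x * partial_deriv j F (\<lambda>j. if j < p then \<phi> j (x(i := x i)) else 0))) (at (x i))"
  proof (rule chain_rule_curve[OF smooth_Rn_ck[OF F], where c="\<lambda>t j. if j < p then \<phi> j (x(i := t)) else 0"])
    fix j assume "j < p"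
    then show "((\<lambda>t. if j < p then \<phi> j (x(i := t)) else 0) has_real_derivative partial_deriv i (\<phi> j) x) (at (x i))"
      using smooth_Rn_deriv[OF \<phi> x] by simp
  qed (auto simp: Rn_def)
  then show ?thesis
    by (intro partial_derivI) (simp only: fun_upd_triv)
qed

end

section \<open>Hadamard's lemma and the Poincare lemma\<close>

lemma chain_rule_ray:
  assumes F: "smooth_Rn n F" and a: "a \<in> Rn n" "v \<in> Rn n"
  shows "((\<lambda>s. F (\<lambda>j. if j < n then a j + s * v j else 0)) has_real_derivative
    (\<Sum>j<n. v j * partial_deriv j F (\<lambda>j. if j < n then a j + s * v j else 0))) (at s)"
proof (rule chain_rule_curve[OF smooth_Rn_ck[OF F], where c="\<lambda>s j. if j < n then a j + s * v j else 0"])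
  fix j assume "j < n"
  then show "((\<lambda>s. if j < n then a j + s * v j else 0) has_real_derivative v j) (at s)"
    by (auto intro!: derivative_eq_intros)
qed (auto simp: Rn_def)

text \<open>\<open>g i\<close> is the integral of the \<open>i\<close>-th partial derivative along
  the segment from \<open>a\<close> to \<open>x\<close>. This is what turns an abstract derivation
  into a first-order differential operator.\<close>

lemma Hadamard:
  assumes F: "smooth_Rn n F" and a: "a \<in> Rn n"
  obtains g where "\<And>i. i < n \<Longrightarrow> smooth_Rn n (g i)"
    and "\<And>x. x \<in> Rn n \<Longrightarrow> F x = F a + (\<Sum>i<n. (x i - a i) * g i x)"
    and "\<And>i. i < n \<Longrightarrow> g i a = partial_deriv i F a"
proof
  define H where "H = (\<lambda>i y. partial_deriv i F (\<lambda>j. if j < n then a j + y n * (y j - a j) else 0))"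
  define g where "g = (\<lambda>i x. integral {0..1} (\<lambda>s. H i (x(n := s))))"
  have H: "smooth_Rn (Suc n) (H i)" if "i < n" for i
    unfolding H_def
    by (rule smooth_Rn_compose[where \<phi>="\<lambda>j y. a j + y n * (y j - a j)"]) (intro smooth_intros F that)+
  show "smooth_Rn n (g i)" if "i < n" for i
    unfolding g_def by (rule smooth_Rn_integral[OF H[OF that]])
  have Hs: "H i (x(n := s)) = partial_deriv i F (\<lambda>j. if j < n then a j + s * (x j - a j) else 0)" for i x s
    unfolding H_def by (rule arg_cong[where f="partial_deriv i F"]) auto
  show "F x = F a + (\<Sum>i<n. (x i - a i) * g i x)" if x: "x \<in> Rn n" for x
  proof -
    let ?c = "\<lambda>s j. if j < n then a j + s * (x j - a j) else 0"
    have v: "(\<lambda>j. x j - a j) \<in> Rn n" using x a by (auto simp: Rn_def)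
    have 1: "((\<lambda>s. \<Sum>i<n. (x i - a i) * partial_deriv i F (?c s)) has_integral (F (?c 1) - F (?c 0))) {0..1}"
    proof (rule fundamental_theorem_of_calculus)
      fix s :: real
      show "((\<lambda>s. F (?c s)) has_vector_derivative (\<Sum>i<n. (x i - a i) * partial_deriv i F (?c s))) (at s within {0..1})"
        by (rule has_vector_derivative_at_within[OF has_real_derivative_iff_has_vector_derivative[THEN iffD1, OF chain_rule_ray[OF F a v]]])
    qed simp
    have 2: "?c 1 = x" "?c 0 = a" using x a by (auto simp: Rn_def fun_eq_iff)
    have 3: "((\<lambda>s. \<Sum>i<n. (x i - a i) * partial_deriv i F (?c s)) has_integral (\<Sum>i<n. (x i - a i) * g i x)) {0..1}"
    proof (rule has_integral_sum)
      fix i assume "i \<in> {..<n}"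
      then have i: "i < n" by simp
      have "continuous_on {0..1} (\<lambda>s. partial_deriv i F (?c s))"
      proof (rule continuous_on_Rn_compose[OF smooth_Rn_continuous[OF smooth_Rn_partial[OF F i]], where a="?c"])
        show "continuous_on {0..1} (\<lambda>s. ?c s k)" for k
          by (cases "k < n") (auto intro!: continuous_intros)
      qed (simp add: Rn_def)
      then have "(\<lambda>s. partial_deriv i F (?c s)) integrable_on {0..1}"
        by (rule integrable_continuous_real)
      then show "((\<lambda>s. (x i - a i) * partial_deriv i F (?c s)) has_integral (x i - a i) * g i x) {0..1}"
        unfolding g_def Hs by (intro has_integral_mult_right integrable_integral)
    qed simp
    have "F x - F a = (\<Sum>i<n. (x i - a i) * g i x)"
      using has_integral_unique[OF 1 3] unfolding 2 .
    then show ?thesis by simp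
  qed
  show "g i a = partial_deriv i F a" if "i < n" for i
  proof -
    have "(\<lambda>j. if j < n then a j + s * (a j - a j) else 0) = a" for s
      using a by (auto simp: Rn_def fun_eq_iff)
    then show ?thesis unfolding g_def Hs by simp
  qed
qed

text \<open>\<open>G\<close> integrates the form along the ray from the origin. By closedness, the
  \<open>k\<close>-th partial derivative of the integrand at \<open>s\<close> is the derivative of
  \<open>s * P k (s x)\<close> in \<open>s\<close>.\<close>

lemma Poincare:
  assumes P: "\<And>i. i < n \<Longrightarrow> smooth_Rn n (P i)"
    and closed: "\<And>x i j. x \<in> Rn n \<Longrightarrow> i < n \<Longrightarrow> j < n \<Longrightarrow> partial_deriv i (P j) x = partial_deriv j (P i) x"
  obtains G where "smooth_Rn n G" "\<And>x i. x \<in> Rn n \<Longrightarrow> i < n \<Longrightarrow> partial_deriv i G x = P i x"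
proof
  let ?ray = "\<lambda>y j. if j < n then y n * y j else (0::real)"
  define H where "H = (\<lambda>y. \<Sum>i<n. y i * P i (?ray y))"
  define G where "G = (\<lambda>x. integral {0..1} (\<lambda>s. H (x(n := s))))"
  have PH: "smooth_Rn (Suc n) (\<lambda>y. P i (?ray y))" if "i < n" for i
    by (rule smooth_Rn_compose[where \<phi>="\<lambda>j y. y n * y j"]) (intro smooth_intros P that)+
  have H: "smooth_Rn (Suc n) H"
    unfolding H_def by (intro smooth_intros PH) auto
  show "smooth_Rn n G"
    unfolding G_def by (rule smooth_Rn_integral[OF H])
  show "partial_deriv k G x = P k x" if x: "x \<in> Rn n" and k: "k < n" for x k
  proof -
    let ?c = "\<lambda>s j. if j < n then s * x j else 0"
    have c0: "?c s \<in> Rn n" for s by (auto simp: Rn_def)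
    have z: "(\<lambda>_. 0) \<in> Rn n" by (simp add: Rn_def)
    have ray: "?ray (x(n := s)) = ?c s" for s by auto
    have dH: "partial_deriv k H (x(n := s)) = P k (?c s) + s * (\<Sum>i<n. x i * partial_deriv i (P k) (?c s))" for s
    proof -
      have xs: "x(n := s) \<in> Rn (Suc n)" and k': "k < Suc n" using x k by (auto simp: Rn_def)
      have "partial_deriv k (\<lambda>y. y i * P i (?ray y)) (x(n := s)) =
        (if k = i then P i (?c s) else 0) + x i * (s * partial_deriv i (P k) (?c s))" if i: "i < n" for i
      proof -
        have "partial_deriv k (\<lambda>y. P i (?ray y)) (x(n := s)) =
          (\<Sum>j<n. partial_deriv k (\<lambda>y. y n * y j) (x(n := s)) * partial_deriv j (P i) (?ray (x(n := s))))"
          by (rule partial_deriv_compose[OF xs k' P[OF i], where \<phi>="\<lambda>j y. y n * y j"]) (intro smooth_intros)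
        also have "\<dots> = (\<Sum>j<n. (if k = j then s * partial_deriv j (P i) (?c s) else 0))"
        proof (rule sum.cong[OF refl])
          fix j assume "j \<in> {..<n}"
          then show "partial_deriv k (\<lambda>y. y n * y j) (x(n := s)) * partial_deriv j (P i) (?ray (x(n := s))) =
            (if k = j then s * partial_deriv j (P i) (?c s) else 0)"
            unfolding ray using k by (subst partial_deriv_mult[OF xs k']) (auto intro: smooth_intros)
        qed
        also have "\<dots> = s * partial_deriv k (P i) (?c s)"
          using k by simp
        finally show ?thesis
          using i k by (subst partial_deriv_mult[OF xs k' smooth_Rn_coord PH[OF i]]) (auto simp: ray closed[OF c0 k i])
      qed
      then have "partial_deriv k H (x(n := s)) =
         (\<Sum>i<n. (if k = i then P i (?c s) else 0) + x i * (s * partial_deriv i (P k) (?c s)))"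
        unfolding H_def by (subst partial_deriv_sum[OF xs k']) (auto intro: smooth_intros PH)
      then show ?thesis
        using k by (simp add: sum.distrib sum_distrib_left mult.left_commute)
    qed
    have dP: "((\<lambda>s. s * P k (?c s)) has_real_derivative
       (P k (?c s) + s * (\<Sum>i<n. x i * partial_deriv i (P k) (?c s)))) (at s)" for s
    proof -
      have "((\<lambda>s. P k (?c s)) has_real_derivative (\<Sum>i<n. x i * partial_deriv i (P k) (?c s))) (at s)"
        using chain_rule_ray[OF P[OF k] z x, of s] by (simp only: add_0_left)
      from DERIV_mult[OF DERIV_ident this] show ?thesis
        by (rule DERIV_cong) (simp add: algebra_simps)
    qed
    have "((\<lambda>s. partial_deriv k H (x(n := s))) has_integral 1 * P k (?c 1) - 0 * P k (?c 0)) {0..1}"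
      unfolding dH
      by (rule fundamental_theorem_of_calculus)
        (simp, rule has_vector_derivative_at_within[OF has_real_derivative_iff_has_vector_derivative[THEN iffD1, OF dP]])
    moreover have "?c 1 = x" using x by (auto simp: Rn_def)
    ultimately have "integral {0..1} (\<lambda>s. partial_deriv k H (x(n := s))) = 1 * P k x - 0 * P k (?c 0)"
      by (simp only: integral_unique)
    moreover have "partial_deriv k G x = integral {0..1} (\<lambda>s. partial_deriv k H (x(n := s)))"
      unfolding G_def by (rule partial_derivI, rule partial_integral[OF smooth_Rn_ck[OF H] x k])
    ultimately show ?thesis by simp
  qed
qed

text \<open>The functions \<open>t \<mapsto> p(1/t) exp(-1/t)\<close>, extended by \<open>0\<close> to \<open>t \<le> 0\<close>, are closed under derivatives.\<close>

definition flat_fun :: "real poly \<Rightarrow> real \<Rightarrow> real" where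
  "flat_fun P t = (if t \<le> 0 then 0 else poly P (inverse t) * exp (- inverse t))"

lemma poly_exp_tendsto_0:
  fixes P :: "real poly"
  shows "((\<lambda>u. poly P u * exp (- u)) \<longlongrightarrow> 0) at_top"
proof -
  have "((\<lambda>u. \<Sum>i\<le>degree P. coeff P i * (u ^ i / exp u)) \<longlongrightarrow> (\<Sum>i\<le>degree P. coeff P i * 0)) at_top"
    by (intro tendsto_intros tendsto_power_div_exp_0)
  then show ?thesis
    by (simp add: poly_altdef sum_distrib_right sum_divide_distrib exp_minus field_simps)
qed

text \<open>With \<open>u = 1/t\<close> the new polynomial is \<open>u^2 (P - P')\<close>, by the
  chain rule. At 0 the right difference quotient is \<open>u P(u) exp (- u)\<close>, which tends to
  0.\<close>

lemma flat_fun_deriv: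
  "(flat_fun P has_real_derivative flat_fun ([:0, 0, 1:] * (P - pderiv P)) t) (at t)"
proof -
  consider "t < 0" | "t > 0" | "t = 0" by linarith
  then show ?thesis
  proof cases
    case 1
    have ev: "\<forall>\<^sub>F s in nhds t. (0::real) = flat_fun P s"
      using eventually_nhds_in_open[of "{..<0}" t] 1 by (auto elim!: eventually_mono simp: flat_fun_def)
    show ?thesis
      by (rule iffD1[OF DERIV_cong_ev[OF refl ev refl]]) (use 1 in \<open>simp add: flat_fun_def\<close>)
  next
    case 2
    have ev: "\<forall>\<^sub>F s in nhds t. poly P (inverse s) * exp (- inverse s) = flat_fun P s"
      using eventually_nhds_in_open[of "{0<..}" t] 2 by (auto elim!: eventually_mono simp: flat_fun_def)
    have "((\<lambda>s. poly P (inverse s) * exp (- inverse s)) has_real_derivative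
      flat_fun ([:0, 0, 1:] * (P - pderiv P)) t) (at t)"
      using 2 by (auto intro!: derivative_eq_intros DERIV_chain2[OF poly_DERIV]
        simp: flat_fun_def field_simps power2_eq_square)
    then show ?thesis
      by (rule iffD1[OF DERIV_cong_ev[OF refl ev refl]])
  next
    case 3
    have "((\<lambda>h. poly ([:0, 1:] * P) (inverse h) * exp (- inverse h)) \<longlongrightarrow> 0) (at_right 0)"
      by (rule filterlim_compose[OF poly_exp_tendsto_0 filterlim_inverse_at_top_right])
    then have "((\<lambda>h. (flat_fun P h - flat_fun P 0) / (h - 0)) \<longlongrightarrow> 0) (at_right 0)"
      by (rule Lim_transform_eventually)
        (auto simp: flat_fun_def eventually_at_filter field_simps)
    moreover have "((\<lambda>h. (flat_fun P h - flat_fun P 0) / (h - 0)) \<longlongrightarrow> 0) (at_left 0)"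
      by (rule Lim_transform_eventually[OF tendsto_const]) (auto simp: flat_fun_def eventually_at_filter)
    ultimately have "(flat_fun P has_real_derivative 0) (at 0)"
      unfolding has_field_derivative_iff by (rule filterlim_split_at_real[rotated])
    then show ?thesis using 3 by (simp add: flat_fun_def)
  qed
qed

lemma smooth_flat_fun: "smooth_Rn n \<psi> \<Longrightarrow> smooth_Rn n (\<lambda>x. flat_fun P (\<psi> x))"
  unfolding smooth_Rn_def
  using ck_compose_real[OF open_Rn_Rn, of n \<psi> "range flat_fun" "flat_fun P"] flat_fun_deriv by blast

text \<open>A product over the coordinates instead of a function of the distance: it is nonzero
  exactly on an open cube, the shape of the charts used below.\<close>

definition bump :: "nat \<Rightarrow> (nat \<Rightarrow> real) \<Rightarrow> real \<Rightarrow> (nat \<Rightarrow> real) \<Rightarrow> real" where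
  "bump n a \<epsilon> x = (\<Prod>i<n. flat_fun 1 (\<epsilon>\<^sup>2 - (x i - a i)\<^sup>2))"

lemma smooth_bump: "smooth_Rn n (bump n a \<epsilon>)"
  unfolding bump_def[abs_def] by (intro smooth_intros smooth_flat_fun)

lemma bump_nonzero_iff:
  assumes "0 < \<epsilon>"
  shows "bump n a \<epsilon> x \<noteq> 0 \<longleftrightarrow> (\<forall>i<n. \<bar>x i - a i\<bar> < \<epsilon>)"
proof -
  have "\<epsilon>\<^sup>2 - y\<^sup>2 \<le> 0 \<longleftrightarrow> \<not> \<bar>y\<bar> < \<epsilon>" for y
    using abs_le_square_iff[of \<epsilon> y] assms by auto
  then show ?thesis
    by (auto simp: bump_def flat_fun_def)
qed

lemma sum_triangle_swap:
  fixes g :: "nat \<Rightarrow> nat \<Rightarrow> 'a::comm_monoid_add"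
  shows "(\<Sum>l=a..b. \<Sum>p=a..l. g l p) = (\<Sum>p=a..b. \<Sum>l=p..b. g l p)"
proof -
  have "(\<Sum>l=a..b. \<Sum>p=a..l. g l p) = (\<Sum>l=a..b. \<Sum>p\<in>{p \<in> {a..b}. p \<le> l}. g l p)"
    by (intro sum.cong refl) auto
  also have "\<dots> = (\<Sum>p=a..b. \<Sum>l\<in>{l \<in> {a..b}. p \<le> l}. g l p)"
    by (rule sum.swap_restrict) auto
  also have "\<dots> = (\<Sum>p=a..b. \<Sum>l=p..b. g l p)"
    by (intro sum.cong refl) auto
  finally show ?thesis .
qed

section \<open>The filiform nilmanifold\<close>

text \<open>The entries of \<open>exp (s N)\<close> for a nilpotent shift \<open>N\<close>;
  \<open>pw_add\<close> is the law of this one-parameter group.\<close>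

definition pw :: "real \<Rightarrow> nat \<Rightarrow> real" where
  "pw s k = s ^ k / fact k"

lemma pw_0 [simp]: "pw s 0 = 1" and pw_zero: "pw 0 k = (if k = 0 then 1 else 0)" and pw_1: "pw s (Suc 0) = s"
  by (auto simp: pw_def)

lemma pw_add:
  assumes "p \<le> i"
  shows "(\<Sum>l=p..i. pw s (i - l) * pw r (l - p)) = pw (s + r) (i - p)"
proof -
  have "pw (s + r) (i - p) = (\<Sum>k\<le>i - p. pw s (i - p - k) * pw r k)"
    using exp_series_add_commuting[of r s "i - p"]
    by (simp add: pw_def divide_inverse add.commute mult.commute)
  also have "\<dots> = (\<Sum>l=p..i. pw s (i - l) * pw r (l - p))"
    by (rule sum.reindex_bij_witness[of _ "\<lambda>l. l - p" "\<lambda>k. k + p"]) (use assms in \<open>auto simp: add.commute\<close>)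
  finally show ?thesis ..
qed

text \<open>The action of \<open>exp (s N)\<close> on the coordinates with positive index, where
  \<open>N\<close> sends the \<open>l\<close>-th unit vector to the next one. Coordinate 0 is left
  out: it is the time of the mapping torus.\<close>

definition flow :: "real \<Rightarrow> (nat \<Rightarrow> real) \<Rightarrow> nat \<Rightarrow> real" where
  "flow s x i = (\<Sum>l=1..i. pw s (i - l) * x l)"

lemma flow_flow: "flow s (flow r x) i = flow (s + r) x i"
proof -
  have "flow s (flow r x) i = (\<Sum>l=1..i. \<Sum>p=1..l. pw s (i - l) * pw r (l - p) * x p)"
    by (simp add: flow_def sum_distrib_left mult.assoc)
  also have "\<dots> = (\<Sum>p=1..i. \<Sum>l=p..i. pw s (i - l) * pw r (l - p) * x p)"
    by (rule sum_triangle_swap)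
  also have "\<dots> = (\<Sum>p=1..i. pw (s + r) (i - p) * x p)"
    by (intro sum.cong refl) (simp add: pw_add flip: sum_distrib_right)
  finally show ?thesis by (simp add: flow_def)
qed

lemma flow_0: "1 \<le> i \<Longrightarrow> flow 0 x i = x i"
  by (simp add: flow_def pw_zero if_distrib if_distribR cong: if_cong)
    (subst sum.mono_neutral_right[of _ "{i}"], auto)

lemma flow_diff: "flow s (\<lambda>l. x l - y l) i = flow s x i - flow s y i"
  by (simp add: flow_def algebra_simps sum_subtractf)

lemma flow_cong: "(\<And>l. 1 \<le> l \<Longrightarrow> l \<le> i \<Longrightarrow> x l = y l) \<Longrightarrow> flow s x i = flow s y i"
  by (simp add: flow_def)

section \<open>The lattice and its deck transformations\<close>

locale filiform =
  fixes n :: nat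
  assumes two_le_n: "2 \<le> n"
begin

text \<open>The period of the first coordinate makes the matrices \<open>exp (per N)\<close> integral.\<close>

definition per :: real where "per = fact n"

definition lat :: "real \<Rightarrow> bool" where "lat s \<longleftrightarrow> s / per \<in> \<int>"

lemma per_pos: "0 < per" and per_ge_1: "1 \<le> per"
  by (simp_all add: per_def)

lemma lat_0 [simp]: "lat 0" and lat_add: "lat s \<Longrightarrow> lat r \<Longrightarrow> lat (s + r)"
  and lat_minus: "lat s \<Longrightarrow> lat (- s)"
  by (simp_all add: lat_def add_divide_distrib)

lemma lat_per: "lat per"
  using per_pos by (simp add: lat_def)

text \<open>For \<open>s = m * n!\<close> and \<open>k\<close> positive, \<open>k!\<close> divides
  \<open>n!\<close> and hence \<open>(n!)^k\<close>.\<close>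

lemma pw_Ints:
  assumes "lat s" "k \<le> n"
  shows "pw s k \<in> \<int>"
proof (cases "k = 0")
  case False
  obtain m :: int where m: "s = of_int m * per"
    using assms(1) per_pos unfolding lat_def by (auto elim!: Ints_cases simp: field_simps)
  have "(fact k :: nat) dvd fact n ^ k"
    using fact_dvd[OF assms(2)] False dvd_power[of k] dvd_trans by blast
  then obtain c where "(fact n :: nat) ^ k = fact k * c" by (auto simp: dvd_def)
  then have "real (fact n ^ k) = real (fact k * c)" by simp
  then have "per ^ k = fact k * real c" by (simp add: per_def)
  then have "pw s k = of_int (m ^ k * int c)"
    by (simp add: pw_def m power_mult_distrib)
  then show ?thesis by (metis Ints_of_int)
qed simp

lemma flow_Ints:
  assumes "lat s" "i < n" "\<And>l. 1 \<le> l \<Longrightarrow> l < n \<Longrightarrow> w l \<in> \<int>"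
  shows "flow s w i \<in> \<int>"
  unfolding flow_def by (intro Ints_sum Ints_mult pw_Ints assms) (use assms in auto)

text \<open>A deck transformation if \<open>s\<close> is a multiple of \<open>per\<close> and
  \<open>w\<close> is integral: shift the time by \<open>s\<close>, flow the fibre coordinates for
  time \<open>s\<close>, then translate them by \<open>w\<close>. All values are kept in
  \<open>Rn n\<close>.\<close>

definition act :: "real \<Rightarrow> (nat \<Rightarrow> real) \<Rightarrow> (nat \<Rightarrow> real) \<Rightarrow> nat \<Rightarrow> real" where
  "act s w x = (\<lambda>i. if i < n then (if i = 0 then x 0 + s else flow s x i + w i) else 0)"

lemma act_Rn [simp]: "act s w x \<in> Rn n"
  by (simp add: act_def Rn_def)

lemma act_0: "act s w x 0 = x 0 + s"
  using two_le_n by (simp add: act_def)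

text \<open>The orbit relation with the deck transformation solved for: the shift must be
  \<open>y 0 - x 0\<close>, and the remaining difference must be integral. The group need not be
  built; symmetry and transitivity come from \<open>flow_flow\<close> and the integrality of the
  flow.\<close>

definition rel :: "(nat \<Rightarrow> real) \<Rightarrow> (nat \<Rightarrow> real) \<Rightarrow> bool" where
  "rel x y \<longleftrightarrow> x \<in> Rn n \<and> y \<in> Rn n \<and> lat (y 0 - x 0) \<and> (\<forall>i\<in>{1..<n}. y i - flow (y 0 - x 0) x i \<in> \<int>)"

lemma rel_act:
  assumes "x \<in> Rn n" "lat s" "\<And>i. 1 \<le> i \<Longrightarrow> i < n \<Longrightarrow> w i \<in> \<int>"
  shows "rel x (act s w x)"
  using assms by (auto simp: rel_def act_0) (auto simp: act_def)

lemma relE: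
  assumes "rel x y"
  obtains s w where "lat s" "\<And>i. w i \<in> \<int>" "y = act s w x"
proof
  let ?s = "y 0 - x 0"
  let ?w = "\<lambda>i. if i \<in> {1..<n} then y i - flow ?s x i else 0"
  show "lat ?s" "?w i \<in> \<int>" for i
    using assms by (auto simp: rel_def)
  show "y = act ?s ?w x"
    using assms by (auto simp: rel_def act_def Rn_def)
qed

lemma rel_refl: "x \<in> Rn n \<Longrightarrow> rel x x"
  by (auto simp: rel_def flow_0)

lemma rel_sym:
  assumes "rel x y"
  shows "rel y x"
proof -
  let ?s = "y 0 - x 0"
  have s: "lat (x 0 - y 0)"
    using assms lat_minus[of ?s] by (simp add: rel_def)
  have "x i - flow (x 0 - y 0) y i \<in> \<int>" if i: "i \<in> {1..<n}" for i
  proof -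
    have "flow (x 0 - y 0) (\<lambda>l. y l - flow ?s x l) i \<in> \<int>"
      by (rule flow_Ints[OF s]) (use i assms in \<open>auto simp: rel_def\<close>)
    also have "flow (x 0 - y 0) (\<lambda>l. y l - flow ?s x l) i = flow (x 0 - y 0) y i - x i"
      using i by (simp add: flow_diff flow_flow flow_0)
    finally show ?thesis
      using Ints_minus by fastforce
  qed
  with s assms show ?thesis by (auto simp: rel_def)
qed

lemma rel_trans:
  assumes "rel x y" "rel y z"
  shows "rel x z"
proof -
  let ?s = "y 0 - x 0" and ?r = "z 0 - y 0"
  have s: "lat ?r" "lat (z 0 - x 0)"
    using assms lat_add[of ?s ?r] by (auto simp: rel_def)
  have "z i - flow (z 0 - x 0) x i \<in> \<int>" if i: "i \<in> {1..<n}" for i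
  proof -
    have "flow ?r (\<lambda>l. y l - flow ?s x l) i \<in> \<int>"
      by (rule flow_Ints[OF s(1)]) (use i assms in \<open>auto simp: rel_def\<close>)
    moreover have "z i - flow ?r y i \<in> \<int>"
      using assms(2) i by (auto simp: rel_def)
    ultimately have "z i - flow ?r y i + flow ?r (\<lambda>l. y l - flow ?s x l) i \<in> \<int>"
      by (rule Ints_add[rotated])
    then show ?thesis
      by (simp add: flow_diff flow_flow)
  qed
  with s assms show ?thesis by (auto simp: rel_def)
qed

section \<open>The quotient space\<close>

definition pt :: "(nat \<Rightarrow> real) \<Rightarrow> point" where
  "pt x = {y. rel x y}"

lemma pt_eq_iff: "x \<in> Rn n \<Longrightarrow> pt x = pt y \<longleftrightarrow> rel x y"
  unfolding pt_def using rel_refl rel_sym rel_trans by blast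

lemma rel_Rn: "rel x y \<Longrightarrow> x \<in> Rn n" "rel x y \<Longrightarrow> y \<in> Rn n"
  by (auto simp: rel_def)

lemma pt_act:
  assumes "x \<in> Rn n" "lat s" "\<And>i. w i \<in> \<int>"
  shows "pt (act s w x) = pt x"
  using rel_act[OF assms(1,2), of w] assms(1,3) pt_eq_iff by metis

definition qtop :: "point topology" where
  "qtop = topology (\<lambda>U. U \<subseteq> pt ` Rn n \<and> open_Rn n {x \<in> Rn n. pt x \<in> U})"

lemma openin_qtop: "openin qtop U \<longleftrightarrow> U \<subseteq> pt ` Rn n \<and> open_Rn n {x \<in> Rn n. pt x \<in> U}"
proof -
  have "istopology (\<lambda>U. U \<subseteq> pt ` Rn n \<and> open_Rn n {x \<in> Rn n. pt x \<in> U})"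
    unfolding istopology_def
  proof (intro conjI allI impI; (elim conjE)?)
    fix S T assume "open_Rn n {x \<in> Rn n. pt x \<in> S}" "open_Rn n {x \<in> Rn n. pt x \<in> T}"
    from openin_Int[OF this] show "open_Rn n {x \<in> Rn n. pt x \<in> S \<inter> T}"
      by (rule back_subst) auto
  next
    fix \<K> assume "\<forall>K\<in>\<K>. K \<subseteq> pt ` Rn n \<and> open_Rn n {x \<in> Rn n. pt x \<in> K}"
    then have "open_Rn n (\<Union>K\<in>\<K>. {x \<in> Rn n. pt x \<in> K})" by (intro openin_Union) auto
    then show "open_Rn n {x \<in> Rn n. pt x \<in> \<Union> \<K>}"
      by (rule back_subst) auto
  qed auto
  then show ?thesis by (simp add: qtop_def)
qed

lemma topspace_qtop: "topspace qtop = pt ` Rn n"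
proof
  show "topspace qtop \<subseteq> pt ` Rn n"
    using openin_qtop openin_topspace by blast
  have "{x \<in> Rn n. pt x \<in> pt ` Rn n} = Rn n" by auto
  then have "openin qtop (pt ` Rn n)" by (simp add: openin_qtop)
  then show "pt ` Rn n \<subseteq> topspace qtop" by (rule openin_subset)
qed

lemma continuous_on_flow [continuous_intros]:
  fixes f :: "'a::topological_space \<Rightarrow> real"
  assumes "continuous_on S f" "\<And>l. continuous_on S (\<lambda>z. g z l)"
  shows "continuous_on S (\<lambda>z. flow (f z) (g z) i)"
  unfolding flow_def pw_def by (intro continuous_intros assms) auto

lemma continuous_on_act: "continuous_on S (act s w)"
proof (rule continuous_on_coordinatewise_then_product)
  fix i
  show "continuous_on S (\<lambda>x. act s w x i)"
    by (cases "i < n"; cases "i = 0") (use two_le_n in \<open>auto simp: act_def intro!: continuous_intros\<close>)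
qed

lemma open_act_vimage:
  assumes "open_Rn n W"
  shows "open_Rn n {x \<in> Rn n. act s w x \<in> W}"
proof -
  have "open_Rn n (Rn n \<inter> act s w -` W)"
    by (rule continuous_openin_preimage[OF continuous_on_act _ assms]) auto
  then show ?thesis by (rule back_subst) auto
qed

text \<open>The saturation is the union of the preimages of \<open>W\<close> under all deck
  transformations. This makes \<open>pt\<close> an open map.\<close>

lemma open_saturation:
  assumes "open_Rn n W"
  shows "open_Rn n {x \<in> Rn n. pt x \<in> pt ` W}"
proof -
  have W: "W \<subseteq> Rn n" by (rule open_Rn_subset[OF assms])
  have "{x \<in> Rn n. pt x \<in> pt ` W} = (\<Union>(s, w)\<in>{(s, w). lat s \<and> (\<forall>i. w i \<in> \<int>)}. {x \<in> Rn n. act s w x \<in> W})"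
  proof (intro equalityI subsetI)
    fix x assume "x \<in> {x \<in> Rn n. pt x \<in> pt ` W}"
    then obtain y where y: "x \<in> Rn n" "y \<in> W" "rel x y"
      using pt_eq_iff by auto
    obtain s w where "lat s" "\<And>i. w i \<in> \<int>" "y = act s w x"
      using relE[OF y(3)] by metis
    with y show "x \<in> (\<Union>(s, w)\<in>{(s, w). lat s \<and> (\<forall>i. w i \<in> \<int>)}. {x \<in> Rn n. act s w x \<in> W})"
      by auto
  next
    fix x assume "x \<in> (\<Union>(s, w)\<in>{(s, w). lat s \<and> (\<forall>i. w i \<in> \<int>)}. {x \<in> Rn n. act s w x \<in> W})"
    then obtain s w where "lat s" "\<forall>i. w i \<in> \<int>" "x \<in> Rn n" "act s w x \<in> W" by auto
    then show "x \<in> {x \<in> Rn n. pt x \<in> pt ` W}"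
      using pt_act[of x s w] by (auto intro: rev_image_eqI)
  qed
  moreover have "open_Rn n (\<Union>(s, w)\<in>{(s, w). lat s \<and> (\<forall>i. w i \<in> \<int>)}. {x \<in> Rn n. act s w x \<in> W})"
    by (intro openin_Union) (use open_act_vimage[OF assms] in auto)
  ultimately show ?thesis by simp
qed

lemma open_map_pt: "open_map (Euclidean_space n) qtop pt"
  unfolding open_map_def Euclidean_space_eq
proof (intro allI impI)
  fix U assume U: "open_Rn n U"
  then have "pt ` U \<subseteq> pt ` Rn n" by (intro image_mono open_Rn_subset)
  with open_saturation[OF U] show "openin qtop (pt ` U)" by (simp add: openin_qtop)
qed

lemma continuous_map_pt: "continuous_map (Euclidean_space n) qtop pt"
  unfolding continuous_map Euclidean_space_eq by (auto simp: openin_qtop topspace_qtop)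

lemma second_countable_qtop: "second_countable qtop"
proof (rule second_countable_open_map_image[OF continuous_map_pt open_map_pt])
  show "pt ` topspace (Euclidean_space n) = topspace qtop"
    by (simp add: topspace_qtop topspace_Euclidean)
  obtain B :: "(nat \<Rightarrow> real) set set" where B: "countable B" "\<And>c. c \<in> B \<Longrightarrow> open c"
    "\<And>S. open S \<Longrightarrow> \<exists>U. U \<subseteq> B \<and> S = \<Union>U"
    by (rule univ_second_countable) blast
  have "\<exists>V\<in>B. x \<in> V \<and> V \<subseteq> U" if "open U" "x \<in> U" for U x
  proof -
    from B(3)[OF that(1)] obtain U' where "U' \<subseteq> B" "U = \<Union>U'" by blast
    with that show ?thesis by blast
  qed
  with B(1,2) have "second_countable (euclidean :: (nat \<Rightarrow> real) topology)"
    unfolding second_countable_def open_openin[symmetric] by (intro exI[of _ B]) simp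
  then show "second_countable (Euclidean_space n)"
    unfolding Euclidean_space_eq by (rule second_countable_subtopology)
qed

lemma compact_qtop: "compact_space qtop"
proof -
  define B where "B = (\<Pi>\<^sub>E i\<in>UNIV. if i = 0 then {0..per} else if i < n then {0..1} else {0::real})"
  have BRn: "B \<subseteq> Rn n"
    using two_le_n by (auto simp: B_def Rn_def PiE_iff split: if_splits)
  have "compactin (powertop_real UNIV) B"
    unfolding B_def compactin_PiE by auto
  then have "compactin (Euclidean_space n) B"
    unfolding Euclidean_space_def compactin_subtopology using BRn by (auto simp: Rn_def)
  then have "compactin qtop (pt ` B)"
    by (rule image_compactin[OF _ continuous_map_pt])
  moreover have "pt ` B = topspace qtop"
  proof
    show "pt ` B \<subseteq> topspace qtop" using BRn by (auto simp: topspace_qtop)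
    show "topspace qtop \<subseteq> pt ` B"
    proof
      fix q assume "q \<in> topspace qtop"
      then obtain x where x: "x \<in> Rn n" "q = pt x" by (auto simp: topspace_qtop)
      \<comment> \<open>The shift of coordinate 0 is chosen before \<open>w\<close>, because the
        flow for time \<open>s\<close> changes the other coordinates.\<close>
      define s where "s = - (of_int \<lfloor>x 0 / per\<rfloor> * per)"
      define w where "w = (\<lambda>i. - of_int \<lfloor>flow s x i\<rfloor> :: real)"
      have "lat s" using per_pos by (simp add: lat_def s_def)
      moreover have "w i \<in> \<int>" for i by (simp add: w_def)
      ultimately have "q = pt (act s w x)" using x pt_act by simp
      moreover have "act s w x \<in> B"
      proof -
        have "x 0 / per - of_int \<lfloor>x 0 / per\<rfloor> \<in> {0..1}"
          by (simp add: of_int_floor_le) linarith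
        then have "x 0 + s \<in> {0..per}"
          using per_pos by (auto simp: s_def field_simps)
        moreover have "flow s x i + w i \<in> {0..1}" for i
          unfolding w_def by (simp add: of_int_floor_le) linarith
        ultimately show ?thesis
          using two_le_n by (auto simp: B_def act_def PiE_iff)
      qed
      ultimately show "q \<in> pt ` B" by blast
    qed
  qed
  ultimately show ?thesis by (simp add: compact_space_def)
qed

text \<open>The quotient by a closed relation is Hausdorff when the projection is open. Closedness
  holds because every condition asks a continuous function to have integer values.\<close>

lemma closed_rel: "closed {(x, y). lat (y 0 - x 0) \<and> (\<forall>i\<in>{1..<n}. y i - flow (y 0 - x 0) x i \<in> \<int>)}"
proof -
  have fst: "continuous_on UNIV (\<lambda>z :: (nat \<Rightarrow> real) \<times> (nat \<Rightarrow> real). fst z i)"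
    and snd: "continuous_on UNIV (\<lambda>z :: (nat \<Rightarrow> real) \<times> (nat \<Rightarrow> real). snd z i)" for i
    by (rule continuous_on_product_then_coordinatewise; intro continuous_intros)+
  have "closed ((\<lambda>z :: (nat \<Rightarrow> real) \<times> (nat \<Rightarrow> real). (snd z 0 - fst z 0) / per) -` \<int>)"
    by (intro closed_vimage closed_Ints continuous_intros fst snd) (use per_pos in auto)
  moreover have "closed ((\<lambda>z :: (nat \<Rightarrow> real) \<times> (nat \<Rightarrow> real). snd z i - flow (snd z 0 - fst z 0) (fst z) i) -` \<int>)" for i
    by (intro closed_vimage closed_Ints continuous_intros fst snd)
  ultimately have "closed ((\<lambda>z :: (nat \<Rightarrow> real) \<times> (nat \<Rightarrow> real). (snd z 0 - fst z 0) / per) -` \<int> \<inter>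
      (\<Inter>i\<in>{1..<n}. (\<lambda>z. snd z i - flow (snd z 0 - fst z 0) (fst z) i) -` \<int>))"
    by (intro closed_Int closed_INT) auto
  then show ?thesis
    by (rule back_subst) (auto simp: lat_def)
qed

lemma Hausdorff_qtop: "Hausdorff_space qtop"
  unfolding Hausdorff_space_def
proof (intro allI impI, elim conjE)
  fix p q assume "p \<in> topspace qtop" "q \<in> topspace qtop" "p \<noteq> q"
  then obtain x y where xy: "x \<in> Rn n" "y \<in> Rn n" "p = pt x" "q = pt y" "\<not> rel x y"
    unfolding topspace_qtop using pt_eq_iff by (metis imageE)
  let ?R = "{(x, y). lat (y 0 - x 0) \<and> (\<forall>i\<in>{1..<n}. y i - flow (y 0 - x 0) x i \<in> \<int>)}"
  have "(x, y) \<in> - ?R" using xy by (auto simp: rel_def)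
  then obtain A B where AB: "open A" "open B" "(x, y) \<in> A \<times> B" "A \<times> B \<subseteq> - ?R"
    using closed_rel by (elim open_prod_elim[OF open_Compl])
  have "openin qtop (pt ` (Rn n \<inter> A))" "openin qtop (pt ` (Rn n \<inter> B))"
    using open_map_pt AB unfolding open_map_def Euclidean_space_eq by (auto simp: openin_open_Int)
  moreover have "disjnt (pt ` (Rn n \<inter> A)) (pt ` (Rn n \<inter> B))"
  proof (rule ccontr)
    assume "\<not> disjnt (pt ` (Rn n \<inter> A)) (pt ` (Rn n \<inter> B))"
    then obtain a b where "a \<in> Rn n" "a \<in> A" "b \<in> Rn n" "b \<in> B" "pt a = pt b"
      by (auto simp: disjnt_def)
    then have "(a, b) \<in> A \<times> B" "(a, b) \<in> ?R"
      using pt_eq_iff by (auto simp: rel_def)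
    with AB show False by blast
  qed
  ultimately show "\<exists>U V. openin qtop U \<and> openin qtop V \<and> p \<in> U \<and> q \<in> V \<and> disjnt U V"
    using xy AB by blast
qed

section \<open>Charts on cubes of side 1\<close>

definition box :: "(nat \<Rightarrow> real) \<Rightarrow> (nat \<Rightarrow> real) set" where
  "box a = {x \<in> Rn n. \<forall>i<n. \<bar>x i - a i\<bar> < 1/2}"

lemma open_box: "open_Rn n (box a)"
proof -
  have "open (\<Inter>i\<in>{..<n}. {x. \<bar>x i - a i\<bar> < 1/2})"
    by (intro open_INT) (auto intro!: open_Collect_less continuous_intros)
  then have "open_Rn n (Rn n \<inter> (\<Inter>i\<in>{..<n}. {x. \<bar>x i - a i\<bar> < 1/2}))"
    by (auto simp: openin_open)
  then show ?thesis by (rule back_subst) (auto simp: box_def)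
qed

lemma box_Rn: "box a \<subseteq> Rn n" and mem_box: "a \<in> Rn n \<Longrightarrow> a \<in> box a"
  by (auto simp: box_def)

lemma Ints_abs_less_1: "x \<in> \<int> \<Longrightarrow> \<bar>x\<bar> < 1 \<Longrightarrow> x = (0::real)"
  by (auto elim!: Ints_cases)

text \<open>Two points of the cube differ by less than \<open>1 \<le> per\<close> in coordinate 0,
  so a deck transformation between them has \<open>s = 0\<close>. It is then a translation by an
  integral vector with entries of absolute value below 1.\<close>

lemma inj_on_box: "inj_on pt (box a)"
proof (rule inj_onI)
  fix x y assume xy: "x \<in> box a" "y \<in> box a" "pt x = pt y"
  then have r: "rel x y" using pt_eq_iff box_Rn by blast
  have d: "\<bar>y i - x i\<bar> < 1" if "i < n" for i
  proof -
    have "\<bar>x i - a i\<bar> < 1/2" "\<bar>y i - a i\<bar> < 1/2" using xy that by (auto simp: box_def)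
    then show ?thesis by linarith
  qed
  have "\<bar>(y 0 - x 0) / per\<bar> < 1"
    using d[of 0] two_le_n per_ge_1 by (auto simp: abs_divide divide_simps)
  then have "y 0 - x 0 = 0"
    using Ints_abs_less_1[of "(y 0 - x 0) / per"] r per_pos by (auto simp: rel_def lat_def)
  moreover have "y i - x i = 0" if "i \<in> {1..<n}" for i
  proof -
    have "y i - flow (y 0 - x 0) x i \<in> \<int>"
      using r that by (auto simp: rel_def)
    then have "y i - x i \<in> \<int>"
      using that by (simp add: \<open>y 0 - x 0 = 0\<close> flow_0)
    then show ?thesis using Ints_abs_less_1[of "y i - x i"] d[of i] that by auto
  qed
  ultimately have "x i = y i" for i
    using r by (cases "i = 0"; cases "i < n") (auto simp: rel_def Rn_def)
  then show "x = y" by auto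
qed

definition man :: "point manifold" where
  "man = \<lparr>mtop = qtop, mdim = n, atlas = (\<lambda>a. (pt ` box a, inv_into (box a) pt)) ` Rn n\<rparr>"

lemma man_simps [simp]: "mtop man = qtop" "mdim man = n"
  by (simp_all add: man_def)

lemma atlas_man: "atlas man = (\<lambda>a. (pt ` box a, inv_into (box a) pt)) ` Rn n"
  by (simp add: man_def)

abbreviation chart :: "(nat \<Rightarrow> real) \<Rightarrow> point \<Rightarrow> nat \<Rightarrow> real" where
  "chart a \<equiv> inv_into (box a) pt"

lemma chart_pt: "x \<in> box a \<Longrightarrow> chart a (pt x) = x"
  by (rule inv_into_f_f[OF inj_on_box])

lemma chart_mem: "q \<in> pt ` box a \<Longrightarrow> chart a q \<in> box a" and pt_chart: "q \<in> pt ` box a \<Longrightarrow> pt (chart a q) = q"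
  by (auto simp: chart_pt)

lemma chart_image: "chart a ` pt ` box a = box a"
  by (auto simp: chart_pt image_image)

lemma inv_chart:
  assumes "x \<in> box a"
  shows "inv_into (pt ` box a) (chart a) x = pt x"
  by (rule inv_into_f_eq) (use assms in \<open>auto simp: chart_pt inj_on_def\<close>)

lemma openin_pt_box: "openin qtop (pt ` box a)"
  using open_map_pt open_box unfolding open_map_def Euclidean_space_eq by blast

lemma is_chart_box: "is_chart qtop n (pt ` box a, chart a)"
proof -
  let ?X = "subtopology (Euclidean_space n) (box a)" and ?Y = "subtopology qtop (pt ` box a)"
  have tX: "topspace ?X = box a" using box_Rn by (auto simp: topspace_Euclidean)
  have tY: "topspace ?Y = pt ` box a" using box_Rn by (auto simp: topspace_qtop)
  have "homeomorphic_map ?X ?Y pt"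
  proof (rule bijective_open_imp_homeomorphic_map)
    show "continuous_map ?X ?Y pt"
      using tX by (auto simp: continuous_map_in_subtopology intro: continuous_map_from_subtopology[OF continuous_map_pt])
    show "open_map ?X ?Y pt"
      unfolding open_map_def
    proof (intro allI impI)
      fix U assume "openin ?X U"
      then have "open_Rn n U" "U \<subseteq> box a"
        using openin_open_subtopology[of "Euclidean_space n" "box a"] open_box unfolding Euclidean_space_eq by blast+
      then have "openin qtop (pt ` U)" "pt ` U \<subseteq> pt ` box a"
        using open_map_pt unfolding open_map_def Euclidean_space_eq by blast+
      then show "openin ?Y (pt ` U)"
        by (simp add: openin_open_subtopology[OF openin_pt_box])
    qed
    show "pt ` topspace ?X = topspace ?Y" by (simp only: tX tY)
    show "inj_on pt (topspace ?X)" unfolding tX by (rule inj_on_box)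
  qed
  then obtain g where g: "homeomorphic_maps ?X ?Y pt g"
    using homeomorphic_map_maps by blast
  then have hg: "homeomorphic_map ?Y ?X g" and gp: "\<And>x. x \<in> box a \<Longrightarrow> g (pt x) = x"
    unfolding homeomorphic_maps_map tX by blast+
  have "homeomorphic_map ?Y ?X (chart a)"
    by (rule homeomorphic_map_eq[OF hg]) (unfold tY, auto simp: chart_pt gp)
  then show ?thesis
    unfolding is_chart_def using openin_pt_box open_box
    by (simp add: chart_image Euclidean_space_eq)
qed

lemma smooth_Rn_act:
  assumes "j < n"
  shows "smooth_Rn n (\<lambda>x. act s w x j)"
proof (cases "j = 0")
  case True
  then show ?thesis using assms by (simp add: act_def smooth_intros)
next
  case False
  have "smooth_Rn n (\<lambda>x. (\<Sum>l=1..j. pw s (j - l) * x l) + w j)"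
    by (intro smooth_intros)
  with False assms show ?thesis by (simp add: act_def flow_def)
qed

lemma smooth_Rn_compose_act:
  assumes "smooth_Rn n F"
  shows "smooth_Rn n (\<lambda>x. F (act s w x))"
proof -
  have "smooth_Rn n (\<lambda>x. F (\<lambda>j. if j < n then act s w x j else 0))"
    by (rule smooth_Rn_compose[OF assms smooth_Rn_act])
  moreover have "(\<lambda>j. if j < n then act s w x j else 0) = act s w x" for x
    by (auto simp: act_def)
  ultimately show ?thesis by simp
qed

text \<open>Near any point over its domain, a chart read on the lift is an affine deck
  transformation. Smoothness of anything defined by charts is reduced to that of
  \<open>act\<close>.\<close>

lemma chart_locally_act:
  assumes "x \<in> Rn n" "pt x \<in> pt ` box a"
  obtains s w where "open_Rn n {z \<in> Rn n. act s w z \<in> box a}" "act s w x \<in> box a"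
    "\<forall>z\<in>Rn n. act s w z \<in> box a \<longrightarrow> pt z \<in> pt ` box a \<and> chart a (pt z) = act s w z"
proof -
  obtain y where y: "y \<in> box a" "rel x y"
    using assms pt_eq_iff by auto
  obtain s w where sw: "lat s" "\<And>i. w i \<in> \<int>" "y = act s w x"
    using relE[OF y(2)] by metis
  show ?thesis
  proof (rule that[OF open_act_vimage[OF open_box]])
    show "act s w x \<in> box a" using y sw by simp
    have "pt z \<in> pt ` box a \<and> chart a (pt z) = act s w z" if "z \<in> Rn n" "act s w z \<in> box a" for z
      using chart_pt[OF that(2)] imageI[OF that(2), of pt] unfolding pt_act[OF that(1) sw(1,2)] by simp
    then show "\<forall>z\<in>Rn n. act s w z \<in> box a \<longrightarrow> pt z \<in> pt ` box a \<and> chart a (pt z) = act s w z"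
      by blast
  qed
qed

lemma smooth_manifold_man: "smooth_manifold man"
proof -
  have "smooth_on n (chart a ` (pt ` box a \<inter> pt ` box b)) (\<lambda>x. chart b (inv_into (pt ` box a) (chart a) x) i)"
    if i: "i < n" for a b i
  proof -
    let ?V = "chart a ` (pt ` box a \<inter> pt ` box b)"
    have V: "?V = {x \<in> box a. pt x \<in> pt ` box b}"
    proof (intro equalityI subsetI)
      fix x assume "x \<in> ?V"
      then obtain q where "q \<in> pt ` box a" "q \<in> pt ` box b" "x = chart a q" by blast
      with chart_mem[of q a] pt_chart[of q a] show "x \<in> {x \<in> box a. pt x \<in> pt ` box b}" by simp
    next
      fix x assume "x \<in> {x \<in> box a. pt x \<in> pt ` box b}"
      then show "x \<in> ?V" using chart_pt by (auto intro!: rev_image_eqI[of "pt x"])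
    qed
    then have VR: "?V \<subseteq> Rn n" using box_Rn by blast
    show ?thesis
      unfolding smooth_on_iff_ck[OF VR]
    proof (intro allI ck_local[OF VR])
      fix m x assume "x \<in> ?V"
      then have x: "x \<in> box a" "pt x \<in> pt ` box b" using V by auto
      then have xR: "x \<in> Rn n" using box_Rn by auto
      obtain s w where sw: "open_Rn n {z \<in> Rn n. act s w z \<in> box b}" "act s w x \<in> box b"
        "\<forall>z\<in>Rn n. act s w z \<in> box b \<longrightarrow> pt z \<in> pt ` box b \<and> chart b (pt z) = act s w z"
        by (rule chart_locally_act[OF xR x(2)])
      let ?W = "box a \<inter> {z \<in> Rn n. act s w z \<in> box b}"
      have W: "open_Rn n ?W" by (rule openin_Int[OF open_box sw(1)])
      have "ck n ?W m (\<lambda>x. act s w x i)"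
        by (rule ck_subset[OF open_Rn_subset[OF W] smooth_Rn_ck[OF smooth_Rn_act[OF i]]])
      then have "ck n ?W m (\<lambda>x. chart b (inv_into (pt ` box a) (chart a) x) i)"
        by (rule ck_cong[OF W, rotated]) (use sw(3) in \<open>auto simp: inv_chart\<close>)
      with W x sw(2) xR show "\<exists>W. open_Rn n W \<and> x \<in> W \<and> ck n W m (\<lambda>x. chart b (inv_into (pt ` box a) (chart a) x) i)"
        by (intro exI[of _ ?W]) auto
    qed
  qed
  moreover have "\<Union> (fst ` atlas man) = topspace qtop"
    using box_Rn mem_box by (auto simp: atlas_man topspace_qtop)
  ultimately show ?thesis
    unfolding smooth_manifold_def atlas_man
    by (auto simp: Hausdorff_qtop second_countable_qtop is_chart_box)
qed

lemma closed_manifold_man: "closed_manifold man"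
  by (simp add: closed_manifold_def smooth_manifold_man compact_qtop)

section \<open>Smooth functions on the quotient\<close>

abbreviation C :: "(point \<Rightarrow> real) set" where
  "C \<equiv> smooth_functions man"

text \<open>The inverse of every chart is a restriction of \<open>pt\<close>, so smoothness on the
  quotient is smoothness of the lift. Most later arguments work with lifts instead of
  charts.\<close>

lemma smooth_functions_iff:
  "f \<in> C \<longleftrightarrow> (\<forall>q. q \<notin> pt ` Rn n \<longrightarrow> f q = 0) \<and> smooth_Rn n (\<lambda>x. f (pt x))"
proof -
  have *: "smooth_on n (chart a ` pt ` box a) (\<lambda>x. f (inv_into (pt ` box a) (chart a) x)) \<longleftrightarrow>
    (\<forall>m. ck n (box a) m (\<lambda>x. f (pt x)))" if "a \<in> Rn n" for a
  proof -
    have "ck n (box a) m (\<lambda>x. f (inv_into (pt ` box a) (chart a) x)) \<longleftrightarrow> ck n (box a) m (\<lambda>x. f (pt x))" for m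
    proof
      show "ck n (box a) m (\<lambda>x. f (pt x))" if "ck n (box a) m (\<lambda>x. f (inv_into (pt ` box a) (chart a) x))"
        by (rule ck_cong[OF open_box _ that]) (simp only: inv_chart)
      show "ck n (box a) m (\<lambda>x. f (inv_into (pt ` box a) (chart a) x))" if "ck n (box a) m (\<lambda>x. f (pt x))"
        by (rule ck_cong[OF open_box _ that]) (simp only: inv_chart)
    qed
    then show ?thesis
      unfolding chart_image smooth_on_iff_ck[OF box_Rn] by simp
  qed
  have "(\<forall>a\<in>Rn n. \<forall>m. ck n (box a) m (\<lambda>x. f (pt x))) \<longleftrightarrow> smooth_Rn n (\<lambda>x. f (pt x))"
    unfolding smooth_Rn_def
  proof (intro iffI allI ballI)
    fix m assume "\<forall>a\<in>Rn n. \<forall>m. ck n (box a) m (\<lambda>x. f (pt x))"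
    then show "ck n (Rn n) m (\<lambda>x. f (pt x))"
      by (intro ck_local) (use open_box mem_box in blast)+
  next
    fix a m assume "\<forall>m. ck n (Rn n) m (\<lambda>x. f (pt x))"
    then show "ck n (box a) m (\<lambda>x. f (pt x))"
      using ck_subset[OF box_Rn] by blast
  qed
  then show ?thesis
    unfolding smooth_functions_def atlas_man by (simp add: topspace_qtop *)
qed

lemma smooth_functions_off: "f \<in> C \<Longrightarrow> q \<notin> pt ` Rn n \<Longrightarrow> f q = 0"
  and smooth_functions_lift: "f \<in> C \<Longrightarrow> smooth_Rn n (\<lambda>x. f (pt x))"
  by (auto simp: smooth_functions_iff)

lemma smooth_functions_eqI:
  assumes "f \<in> C" "g \<in> C" "\<And>x. x \<in> Rn n \<Longrightarrow> f (pt x) = g (pt x)"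
  shows "f = g"
proof
  fix q show "f q = g q"
    using assms smooth_functions_off[of f q] smooth_functions_off[of g q] by (cases "q \<in> pt ` Rn n") auto
qed

lemma C_add: "f \<in> C \<Longrightarrow> g \<in> C \<Longrightarrow> f + g \<in> C"
  and C_mult: "f \<in> C \<Longrightarrow> g \<in> C \<Longrightarrow> f * g \<in> C"
  and C_diff: "f \<in> C \<Longrightarrow> g \<in> C \<Longrightarrow> f - g \<in> C"
  and C_scale: "f \<in> C \<Longrightarrow> c *\<^sub>R f \<in> C"
  and C_0: "0 \<in> C"
  by (auto simp: smooth_functions_iff scaleR_fun_def intro!: smooth_intros)

lemma C_sum: "(\<And>i. i \<in> I \<Longrightarrow> f i \<in> C) \<Longrightarrow> (\<Sum>i\<in>I. f i) \<in> C"
  by (induction I rule: infinite_finite_induct) (auto intro: C_add C_0)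

definition invariant :: "((nat \<Rightarrow> real) \<Rightarrow> real) \<Rightarrow> bool" where
  "invariant F \<longleftrightarrow> (\<forall>x y. rel x y \<longrightarrow> F x = F y)"

lemma invariantI:
  assumes "\<And>x s w. x \<in> Rn n \<Longrightarrow> lat s \<Longrightarrow> (\<And>i. w i \<in> \<int>) \<Longrightarrow> F (act s w x) = F x"
  shows "invariant F"
  unfolding invariant_def
proof (intro allI impI)
  fix x y assume r: "rel x y"
  obtain s w where "lat s" "\<And>i. w i \<in> \<int>" "y = act s w x"
    using relE[OF r] by metis
  with assms[OF rel_Rn(1)[OF r]] show "F x = F y" by simp
qed

lemma invariant_lift: "invariant (\<lambda>x. f (pt x))"
  unfolding invariant_def
proof (intro allI impI)
  fix x y assume "rel x y"
  then have "pt x = pt y" using pt_eq_iff[OF rel_Rn(1)] by blast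
  then show "f (pt x) = f (pt y)" by simp
qed

definition descend :: "((nat \<Rightarrow> real) \<Rightarrow> real) \<Rightarrow> point \<Rightarrow> real" where
  "descend F q = (if q \<in> pt ` Rn n then F (inv_into (Rn n) pt q) else 0)"

lemma descend_pt:
  assumes "invariant F" "x \<in> Rn n"
  shows "descend F (pt x) = F x"
proof -
  let ?y = "inv_into (Rn n) pt (pt x)"
  have "?y \<in> Rn n" "pt ?y = pt x"
    using assms(2) inv_into_into[of "pt x" pt "Rn n"] f_inv_into_f[of "pt x" pt "Rn n"] by blast+
  then have "rel ?y x" using pt_eq_iff by simp
  with assms show ?thesis by (simp add: descend_def invariant_def)
qed

lemma descend_smooth:
  assumes "invariant F" "smooth_Rn n F"
  shows "descend F \<in> C"
  unfolding smooth_functions_iff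
  using smooth_Rn_cong[OF assms(2), of "\<lambda>x. descend F (pt x)"] descend_pt[OF assms(1)] by (simp add: descend_def)

definition loc :: "(nat \<Rightarrow> real) \<Rightarrow> ((nat \<Rightarrow> real) \<Rightarrow> real) \<Rightarrow> point \<Rightarrow> real" where
  "loc a h q = (if q \<in> pt ` box a then h (chart a q) else 0)"

lemma loc_pt: "x \<in> box a \<Longrightarrow> loc a h (pt x) = h x"
  by (simp add: loc_def chart_pt)

text \<open>The support lies over the compact cube \<open>K\<close> inside the chart. Its image is
  closed in the Hausdorff quotient, so the chart domain and the complement of that image form an
  open cover; on the latter the function is 0.\<close>

lemma loc_smooth:
  assumes h: "smooth_Rn n h" and supp: "\<And>x i. x \<in> Rn n \<Longrightarrow> h x \<noteq> 0 \<Longrightarrow> i < n \<Longrightarrow> \<bar>x i - a i\<bar> < 1/4"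
  shows "loc a h \<in> C"
proof -
  define K where "K = (\<Pi>\<^sub>E i\<in>UNIV. if i < n then {a i - 1/4..a i + 1/4} else {0::real})"
  have KRn: "K \<subseteq> Rn n"
    by (auto simp: K_def Rn_def PiE_iff split: if_splits)
  have K_iff: "x \<in> K \<longleftrightarrow> (\<forall>i<n. \<bar>x i - a i\<bar> \<le> 1/4)" if "x \<in> Rn n" for x
  proof -
    have "x \<in> K \<longleftrightarrow> (\<forall>i. x i \<in> (if i < n then {a i - 1/4..a i + 1/4} else {0}))"
      by (simp only: K_def PiE_UNIV_domain mem_Collect_eq Pi_iff UNIV_I simp_thms ball_UNIV)
    also have "\<dots> \<longleftrightarrow> (\<forall>i. i < n \<longrightarrow> \<bar>x i - a i\<bar> \<le> 1/4)"
    proof (rule iff_allI)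
      fix i
      show "x i \<in> (if i < n then {a i - 1/4..a i + 1/4} else {0}) \<longleftrightarrow> (i < n \<longrightarrow> \<bar>x i - a i\<bar> \<le> 1/4)"
      proof (cases "i < n")
        case True
        have "x i \<in> {a i - 1/4..a i + 1/4} \<longleftrightarrow> \<bar>x i - a i\<bar> \<le> 1/4"
          unfolding atLeastAtMost_iff abs_le_iff by linarith
        with True show ?thesis by simp
      qed (use that in \<open>simp add: Rn_def\<close>)
    qed
    finally show ?thesis .
  qed
  have K_box: "K \<subseteq> box a"
  proof
    fix x assume x: "x \<in> K"
    then have xR: "x \<in> Rn n" using KRn by auto
    with K_iff x have le: "\<forall>i<n. \<bar>x i - a i\<bar> \<le> 1/4" by blast
    have "\<bar>x i - a i\<bar> < 1/2" if "i < n" for i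
      by (rule le_less_trans[OF le[rule_format, OF that]]) simp
    then show "x \<in> box a" using xR by (simp add: box_def)
  qed
  have "compactin (powertop_real UNIV) K"
    unfolding K_def compactin_PiE by auto
  then have "compactin (Euclidean_space n) K"
    unfolding Euclidean_space_def compactin_subtopology using KRn by (auto simp: Rn_def)
  then have "closedin qtop (pt ` K)"
    using compactin_imp_closedin[OF Hausdorff_qtop] image_compactin[OF _ continuous_map_pt] by blast
  then have "openin qtop (topspace qtop - pt ` K)"
    by (rule openin_diff[OF openin_topspace])
  then have "open_Rn n {x \<in> Rn n. pt x \<in> topspace qtop - pt ` K}"
    by (simp add: openin_qtop)
  then have oK: "open_Rn n {x \<in> Rn n. pt x \<notin> pt ` K}"
    by (rule back_subst) (auto simp: topspace_qtop)
  have "smooth_Rn n (\<lambda>x. loc a h (pt x))"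
    unfolding smooth_Rn_def
  proof (intro allI ck_local subset_refl)
    fix m x assume x: "x \<in> Rn n"
    show "\<exists>W. open_Rn n W \<and> x \<in> W \<and> ck n W m (\<lambda>x. loc a h (pt x))"
    proof (cases "pt x \<in> pt ` box a")
      case True
      obtain s w where sw: "open_Rn n {z \<in> Rn n. act s w z \<in> box a}" "act s w x \<in> box a"
        "\<forall>z\<in>Rn n. act s w z \<in> box a \<longrightarrow> pt z \<in> pt ` box a \<and> chart a (pt z) = act s w z"
        by (rule chart_locally_act[OF x True])
      have "ck n {z \<in> Rn n. act s w z \<in> box a} m (\<lambda>x. h (act s w x))"
        by (rule ck_subset[OF _ smooth_Rn_ck[OF smooth_Rn_compose_act[OF h]]]) auto
      then have "ck n {z \<in> Rn n. act s w z \<in> box a} m (\<lambda>x. loc a h (pt x))"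
        by (rule ck_cong[OF sw(1), rotated]) (use sw(3) in \<open>auto simp: loc_def\<close>)
      with sw x show ?thesis by (intro exI[of _ "{z \<in> Rn n. act s w z \<in> box a}"]) auto
    next
      case False
      have "loc a h (pt z) = 0" if "z \<in> Rn n" "pt z \<notin> pt ` K" for z
      proof (cases "pt z \<in> pt ` box a")
        case True
        let ?y = "chart a (pt z)"
        have y: "?y \<in> box a" "pt ?y = pt z" using chart_mem[OF True] pt_chart[OF True] .
        then have "?y \<notin> K" using that(2) by (metis imageI)
        moreover have "?y \<in> Rn n" using y box_Rn by auto
        ultimately have "\<exists>i<n. \<not> \<bar>?y i - a i\<bar> < 1/4"
          using K_iff[of ?y] by force
        then have "h ?y = 0" using supp \<open>?y \<in> Rn n\<close> by blast
        then show ?thesis by (simp add: loc_def)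
      qed (simp add: loc_def)
      then have "ck n {x \<in> Rn n. pt x \<notin> pt ` K} m (\<lambda>x. loc a h (pt x))"
        by (intro ck_cong[OF oK _ ck_const[OF oK, of m 0]]) simp
      moreover have "pt x \<notin> pt ` K" using False K_box by auto
      ultimately show ?thesis using oK x by (intro exI[of _ "{x \<in> Rn n. pt x \<notin> pt ` K}"]) simp
    qed
  qed
  then show ?thesis
    unfolding smooth_functions_iff using box_Rn by (auto simp: loc_def)
qed

end

section \<open>The global frame and its brackets\<close>

lemma sum_fun_apply: "(\<Sum>i\<in>I. f i) x = (\<Sum>i\<in>I. f i x)" for f :: "_ \<Rightarrow> _ \<Rightarrow> _::comm_monoid_add"
  by (induction I rule: infinite_finite_induct) auto

context filiform
begin

text \<open>The coordinate fields on the slice \<open>x 0 = 0\<close>, carried along by the flow for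
  time \<open>x 0\<close>. Their coefficients are chosen to make the operators commute with all maps
  \<open>act s w\<close>.\<close>

definition fr :: "nat \<Rightarrow> ((nat \<Rightarrow> real) \<Rightarrow> real) \<Rightarrow> (nat \<Rightarrow> real) \<Rightarrow> real" where
  "fr i F x = (if i = 0 then partial_deriv 0 F x else \<Sum>j=i..n-1. pw (x 0) (j - i) * partial_deriv j F x)"

text \<open>Takes the frame coefficients of a tangent vector at a point with first coordinate
  \<open>s\<close> to its coordinate coefficients; \<open>tr (- s)\<close> is the inverse.\<close>

definition tr :: "real \<Rightarrow> (nat \<Rightarrow> real) \<Rightarrow> nat \<Rightarrow> real" where
  "tr s a j = (if j = 0 then a 0 else flow s a j)"

lemma tr_tr: "tr s (tr r a) j = tr (s + r) a j"
proof (cases "j = 0")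
  case False
  have "flow s (tr r a) j = flow s (flow r a) j"
    by (rule flow_cong) (simp add: tr_def)
  with False show ?thesis by (simp add: tr_def flow_flow)
qed (simp add: tr_def)

lemma tr_0: "tr 0 a j = a j"
  by (simp add: tr_def flow_0)

lemma tr_cong: "(\<And>i. i \<le> j \<Longrightarrow> a i = b i) \<Longrightarrow> tr s a j = tr s b j"
  unfolding tr_def using flow_cong[of j a b] by auto

lemma sum_split_0: "(\<Sum>i<n. g i) = g 0 + (\<Sum>i=1..n-1. g i)" for g :: "nat \<Rightarrow> real"
proof -
  have "{..<n} = insert 0 {1..n-1}" using two_le_n by auto
  then show ?thesis by simp
qed

lemma fr_sum: "(\<Sum>i<n. a i * fr i F x) = (\<Sum>j<n. tr (x 0) a j * partial_deriv j F x)"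
proof -
  have "(\<Sum>i=1..n-1. a i * fr i F x) = (\<Sum>i=1..n-1. \<Sum>j=i..n-1. a i * pw (x 0) (j - i) * partial_deriv j F x)"
    by (intro sum.cong refl) (simp add: fr_def sum_distrib_left mult.assoc)
  also have "\<dots> = (\<Sum>j=1..n-1. \<Sum>i=1..j. a i * pw (x 0) (j - i) * partial_deriv j F x)"
    by (rule sum_triangle_swap[symmetric])
  also have "\<dots> = (\<Sum>j=1..n-1. tr (x 0) a j * partial_deriv j F x)"
    by (intro sum.cong refl) (simp add: tr_def flow_def sum_distrib_left mult_ac)
  finally show ?thesis
    unfolding sum_split_0 by (simp add: fr_def tr_def)
qed

lemma smooth_fr [smooth_intros]: "smooth_Rn n F \<Longrightarrow> i < n \<Longrightarrow> smooth_Rn n (fr i F)"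
  using two_le_n unfolding fr_def[abs_def] pw_def divide_inverse
  by (cases "i = 0") (auto intro!: smooth_intros)

lemma smooth_tr:
  assumes "smooth_Rn n F" "\<And>j. j < n \<Longrightarrow> smooth_Rn n (a j)" "i < n"
  shows "smooth_Rn n (\<lambda>x. tr (F x) (\<lambda>j. a j x) i)"
proof (cases "i = 0")
  case False
  have "smooth_Rn n (\<lambda>x. \<Sum>l=1..i. F x ^ (i - l) * inverse (fact (i - l)) * a l x)"
    by (intro smooth_intros assms) (use assms in auto)
  with False show ?thesis by (simp add: tr_def flow_def pw_def divide_inverse)
qed (use assms in \<open>simp add: tr_def\<close>)

lemma fr_cong:
  assumes "open_Rn n V" "\<And>z. z \<in> V \<Longrightarrow> F z = G z" "x \<in> V" "i < n"
  shows "fr i F x = fr i G x"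
proof -
  have "partial_deriv j F x = partial_deriv j G x" if "j < n" for j
    by (rule partial_deriv_cong[OF assms(1-3) that])
  then show ?thesis
    unfolding fr_def using assms(4) by (auto intro!: sum.cong)
qed

lemma fr_partials:
  assumes "\<And>j. j < n \<Longrightarrow> partial_deriv j F x = D j" "i < n"
  shows "fr i F x = (if i = 0 then D 0 else \<Sum>j=i..n-1. pw (x 0) (j - i) * D j)"
  unfolding fr_def using assms by (auto intro!: sum.cong)

context
  fixes i x
  assumes ix: "i < n" "x \<in> Rn n"
begin

lemma fr_add:
  assumes "smooth_Rn n F" "smooth_Rn n G"
  shows "fr i (\<lambda>x. F x + G x) x = fr i F x + fr i G x"
  using fr_partials[where F="\<lambda>x. F x + G x" and D="\<lambda>j. partial_deriv j F x + partial_deriv j G x", OF partial_deriv_add[OF ix(2) _ assms] ix(1)]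
  by (simp add: fr_def sum.distrib algebra_simps)

lemma fr_diff:
  assumes "smooth_Rn n F" "smooth_Rn n G"
  shows "fr i (\<lambda>x. F x - G x) x = fr i F x - fr i G x"
  using fr_partials[where F="\<lambda>x. F x - G x" and D="\<lambda>j. partial_deriv j F x - partial_deriv j G x", OF partial_deriv_diff[OF ix(2) _ assms] ix(1)]
  by (simp add: fr_def sum_subtractf algebra_simps)

lemma fr_mult:
  assumes "smooth_Rn n F" "smooth_Rn n G"
  shows "fr i (\<lambda>x. F x * G x) x = fr i F x * G x + F x * fr i G x"
  using fr_partials[where F="\<lambda>x. F x * G x" and D="\<lambda>j. partial_deriv j F x * G x + F x * partial_deriv j G x", OF partial_deriv_mult[OF ix(2) _ assms] ix(1)]
  by (simp add: fr_def sum.distrib sum_distrib_left algebra_simps)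

lemma fr_const: "fr i (\<lambda>x. c) x = 0"
  by (simp add: fr_def)

lemma fr_sum_fun:
  assumes "\<And>k. k \<in> I \<Longrightarrow> smooth_Rn n (F k)"
  shows "fr i (\<lambda>x. \<Sum>k\<in>I. F k x) x = (\<Sum>k\<in>I. fr i (F k) x)"
  using fr_partials[where F="\<lambda>x. \<Sum>k\<in>I. F k x" and D="\<lambda>j. \<Sum>k\<in>I. partial_deriv j (F k) x", OF partial_deriv_sum[OF ix(2) _ assms] ix(1)]
  by (simp add: fr_def sum_distrib_left sum.swap[of _ I])

end

lemma partial_act:
  assumes F: "smooth_Rn n F" and x: "x \<in> Rn n" "i < n"
  shows "partial_deriv i (\<lambda>x. F (act s w x)) x =
    (if i = 0 then partial_deriv 0 F (act s w x) else \<Sum>j=i..n-1. pw s (j - i) * partial_deriv j F (act s w x))"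
proof -
  have eq: "(\<lambda>j. if j < n then act s w x j else 0) = act s w x" for x
    by (auto simp: act_def)
  have d: "partial_deriv i (\<lambda>x. act s w x j) x = (if j = 0 then (if i = 0 then 1 else 0) else if 1 \<le> i \<and> i \<le> j then pw s (j - i) else 0)"
    if j: "j < n" for j
  proof (cases "j = 0")
    case True
    then show ?thesis
      using x two_le_n by (simp add: act_def partial_deriv_add[OF x] smooth_intros)
  next
    case False
    have "partial_deriv i (\<lambda>x. (\<Sum>l=1..j. pw s (j - l) * x l) + w j) x =
        (\<Sum>l=1..j. partial_deriv i (\<lambda>x. pw s (j - l) * x l) x) + partial_deriv i (\<lambda>x. w j) x"
      by (subst partial_deriv_add[OF x], (intro smooth_intros)+, subst partial_deriv_sum[OF x], (intro smooth_intros)+)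
        (rule refl)
    also have "\<dots> = (\<Sum>l=1..j. if i = l then pw s (j - i) else 0)"
      by (simp only: partial_deriv_const add_0_right, intro sum.cong refl)
        (auto simp: partial_deriv_mult[OF x smooth_Rn_const smooth_Rn_coord])
    also have "\<dots> = (if 1 \<le> i \<and> i \<le> j then pw s (j - i) else 0)"
      by (subst sum.delta') auto
    finally have "partial_deriv i (\<lambda>x. (\<Sum>l=1..j. pw s (j - l) * x l) + w j) x =
        (if 1 \<le> i \<and> i \<le> j then pw s (j - i) else 0)" .
    moreover have "(\<lambda>x. act s w x j) = (\<lambda>x. (\<Sum>l=1..j. pw s (j - l) * x l) + w j)"
      using False j by (simp add: act_def flow_def)
    ultimately show ?thesis using False by (simp only: if_False)
  qed
  have "partial_deriv i (\<lambda>x. F (act s w x)) x =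
    (\<Sum>j<n. partial_deriv i (\<lambda>x. act s w x j) x * partial_deriv j F (act s w x))"
    using partial_deriv_compose[OF x F, where \<phi>="\<lambda>j x. act s w x j"] smooth_Rn_act unfolding eq by simp
  also have "\<dots> = (if i = 0 then partial_deriv 0 F (act s w x) else 0) +
      (\<Sum>j=1..n-1. if 1 \<le> i \<and> i \<le> j then pw s (j - i) * partial_deriv j F (act s w x) else 0)"
    unfolding sum_split_0 using two_le_n
    by (intro arg_cong2[where f="(+)"] sum.cong refl) (auto simp: d)
  also have "(\<Sum>j=1..n-1. if 1 \<le> i \<and> i \<le> j then pw s (j - i) * partial_deriv j F (act s w x) else 0) =
      (if i = 0 then 0 else \<Sum>j=i..n-1. pw s (j - i) * partial_deriv j F (act s w x))"
    by (auto simp: sum.If_cases intro!: sum.cong)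
  finally show ?thesis by auto
qed

text \<open>The flow for \<open>s\<close>, from differentiating \<open>act\<close>, and the flow for
  \<open>x 0\<close>, in the frame, compose to the flow for \<open>x 0 + s\<close>, which is the
  first coordinate of the image point.\<close>

lemma fr_act:
  assumes F: "smooth_Rn n F" and x: "x \<in> Rn n" "i < n"
  shows "fr i (\<lambda>x. F (act s w x)) x = fr i F (act s w x)"
proof (cases "i = 0")
  case False
  have "fr i (\<lambda>x. F (act s w x)) x =
      (\<Sum>l=i..n-1. \<Sum>j=l..n-1. pw (x 0) (l - i) * (pw s (j - l) * partial_deriv j F (act s w x)))"
    using fr_partials[OF partial_act[OF F x(1)] x(2)] False
    by (auto simp: sum_distrib_left intro!: sum.cong)
  also have "\<dots> = (\<Sum>j=i..n-1. \<Sum>l=i..j. pw (x 0) (l - i) * (pw s (j - l) * partial_deriv j F (act s w x)))"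
    by (rule sum_triangle_swap[symmetric])
  also have "\<dots> = (\<Sum>j=i..n-1. pw (s + x 0) (j - i) * partial_deriv j F (act s w x))"
    by (intro sum.cong refl) (simp add: sum_distrib_left mult_ac flip: pw_add)
  finally show ?thesis
    using False by (simp add: fr_def act_0 add.commute)
qed (use x partial_act[OF F x(1), of 0] in \<open>simp add: fr_def\<close>)

lemma fr_invariant:
  assumes F: "smooth_Rn n F" "invariant F" and i: "i < n"
  shows "invariant (fr i F)"
proof (rule invariantI)
  fix x s and w :: "nat \<Rightarrow> real" assume x: "x \<in> Rn n" and sw: "lat s" "\<And>i. w i \<in> \<int>"
  have "F (act s w z) = F z" if "z \<in> Rn n" for z
    using F(2) rel_act[OF that sw(1), of w] sw(2) unfolding invariant_def by metis
  then have "fr i (\<lambda>x. F (act s w x)) x = fr i F x"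
    by (rule fr_cong[OF open_Rn_Rn _ x i])
  then show "fr i F (act s w x) = fr i F x"
    using fr_act[OF F(1) x i] by simp
qed

definition fld :: "nat \<Rightarrow> point vfield" where
  "fld i f = (if f \<in> C then descend (fr i (\<lambda>x. f (pt x))) else 0)"

lemma fld_pt:
  assumes "f \<in> C" "x \<in> Rn n" "i < n"
  shows "fld i f (pt x) = fr i (\<lambda>x. f (pt x)) x"
  using descend_pt[OF fr_invariant[OF smooth_functions_lift[OF assms(1)] invariant_lift assms(3)] assms(2)] assms(1)
  by (simp add: fld_def)

lemma fld_C:
  assumes "f \<in> C" "i < n"
  shows "fld i f \<in> C"
  using descend_smooth[OF fr_invariant[OF smooth_functions_lift[OF assms(1)] invariant_lift assms(2)]
      smooth_fr[OF smooth_functions_lift[OF assms(1)] assms(2)]] assms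
  by (simp add: fld_def)

section \<open>Derivations and their expansion in the frame\<close>

abbreviation VF :: "point vfield set" where
  "VF \<equiv> vector_fields man"

lemma vector_fieldsI:
  assumes "\<And>f. f \<notin> C \<Longrightarrow> X f = 0" "\<And>f. f \<in> C \<Longrightarrow> X f \<in> C"
    and "\<And>f g. f \<in> C \<Longrightarrow> g \<in> C \<Longrightarrow> X (f + g) = X f + X g"
    and "\<And>f c. f \<in> C \<Longrightarrow> X (c *\<^sub>R f) = c *\<^sub>R X f"
    and "\<And>f g. f \<in> C \<Longrightarrow> g \<in> C \<Longrightarrow> X (f * g) = f * X g + g * X f"
  shows "X \<in> VF"
  unfolding vector_fields_def using assms by (auto simp: C_scale)

lemma VF_off: "X \<in> VF \<Longrightarrow> f \<notin> C \<Longrightarrow> X f = 0"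
  and VF_C: "X \<in> VF \<Longrightarrow> f \<in> C \<Longrightarrow> X f \<in> C"
  and VF_mult: "X \<in> VF \<Longrightarrow> f \<in> C \<Longrightarrow> g \<in> C \<Longrightarrow> X (f * g) = f * X g + g * X f"
  and VF_lin: "X \<in> VF \<Longrightarrow> f \<in> C \<Longrightarrow> g \<in> C \<Longrightarrow> X (a *\<^sub>R f + b *\<^sub>R g) = a *\<^sub>R X f + b *\<^sub>R X g"
  by (auto simp: vector_fields_def)

lemma VF_add: "X \<in> VF \<Longrightarrow> f \<in> C \<Longrightarrow> g \<in> C \<Longrightarrow> X (f + g) = X f + X g"
  using VF_lin[of X f g 1 1] by simp

lemma VF_diff: "X \<in> VF \<Longrightarrow> f \<in> C \<Longrightarrow> g \<in> C \<Longrightarrow> X (f - g) = X f - X g"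
  using VF_lin[of X f g 1 "-1"] by simp

lemma VF_scale: "X \<in> VF \<Longrightarrow> f \<in> C \<Longrightarrow> X (c *\<^sub>R f) = c *\<^sub>R X f"
  using VF_lin[of X f f c 0] by simp

lemma VF_0: "X \<in> VF \<Longrightarrow> X 0 = 0"
  using VF_scale[of X 0 0] C_0 by simp

lemma VF_sum: "X \<in> VF \<Longrightarrow> (\<And>i. i \<in> I \<Longrightarrow> f i \<in> C) \<Longrightarrow> X (\<Sum>i\<in>I. f i) = (\<Sum>i\<in>I. X (f i))"
  by (induction I rule: infinite_finite_induct) (auto simp: VF_0 VF_add C_sum)

lemma fld_VF:
  assumes "i < n"
  shows "fld i \<in> VF"
proof (rule vector_fieldsI)
  show "fld i f \<in> C" if "f \<in> C" for f by (rule fld_C[OF that assms])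
next
  fix f g assume fg: "f \<in> C" "g \<in> C"
  show "fld i (f + g) = fld i f + fld i g"
    by (rule smooth_functions_eqI)
      (use fg assms in \<open>simp_all add: C_add fld_C fld_pt fr_add smooth_functions_lift\<close>)
  show "fld i (f * g) = f * fld i g + g * fld i f"
    by (rule smooth_functions_eqI)
      (use fg assms in \<open>simp_all add: C_add C_mult fld_C fld_pt fr_mult smooth_functions_lift\<close>)
next
  fix f c assume f: "f \<in> C"
  show "fld i (c *\<^sub>R f) = c *\<^sub>R fld i f"
  proof (rule smooth_functions_eqI)
    fix x assume x: "x \<in> Rn n"
    show "fld i (c *\<^sub>R f) (pt x) = (c *\<^sub>R fld i f) (pt x)"
      using fr_mult[OF assms x smooth_Rn_const smooth_functions_lift[OF f], of c]
        fld_pt[OF C_scale[OF f, of c] x assms]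
      by (simp add: fld_pt[OF f x assms] scaleR_fun_def fr_const[OF assms x])
  qed (use f assms in \<open>simp_all add: C_scale fld_C\<close>)
qed (simp add: fld_def)

definition one :: "point \<Rightarrow> real" where
  "one = descend (\<lambda>x. 1)"

lemma one_pt [simp]: "x \<in> Rn n \<Longrightarrow> one (pt x) = 1"
  by (simp add: one_def descend_pt invariant_def)

lemma one_C: "one \<in> C"
  unfolding one_def by (rule descend_smooth) (simp_all add: invariant_def smooth_intros)

lemma mult_one: "f \<in> C \<Longrightarrow> f * one = f" "f \<in> C \<Longrightarrow> one * f = f"
  by (rule smooth_functions_eqI; simp add: C_mult one_C)+

lemma VF_one: "X \<in> VF \<Longrightarrow> X one = 0"
  using VF_mult[of X one one] by (simp add: one_C mult_one VF_C)

text \<open>With \<open>lcoord\<close>, a global substitute for the constant 1 and for the local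
  coordinates at \<open>a\<close>: a derivation can only be applied to functions on the whole
  manifold.\<close>

definition lbump :: "(nat \<Rightarrow> real) \<Rightarrow> point \<Rightarrow> real" where
  "lbump a = loc a (bump n a (1/4))"

definition lcoord :: "(nat \<Rightarrow> real) \<Rightarrow> nat \<Rightarrow> point \<Rightarrow> real" where
  "lcoord a j = loc a (\<lambda>x. bump n a (1/4) x * (x j - a j))"

lemma loc_bump_C: "smooth_Rn n g \<Longrightarrow> loc a (\<lambda>x. bump n a (1/4) x * g x) \<in> C"
  using bump_nonzero_iff[of "1/4" n a] by (intro loc_smooth smooth_intros smooth_bump) auto

lemma lbump_C: "lbump a \<in> C"
  using loc_bump_C[OF smooth_Rn_const, of a 1] by (simp add: lbump_def)

lemma lcoord_C: "lcoord a j \<in> C"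
  unfolding lcoord_def by (intro loc_bump_C smooth_intros)

lemma bump_center: "bump n a (1/4) a \<noteq> 0"
  using bump_nonzero_iff[of "1/4" n a a] by simp

text \<open>By Hadamard's lemma \<open>f\<close> minus its value at the point is a sum of local
  coordinates times smooth functions. After multiplication by bumps both sides are global, and the
  Leibniz rule at the centre leaves only the derivatives of the coordinates.\<close>

lemma vector_field_at:
  assumes X: "X \<in> VF" and f: "f \<in> C" and a: "a \<in> Rn n"
  shows "X f (pt a) = (\<Sum>i<n. X (lcoord a i) (pt a) / bump n a (1/4) a * partial_deriv i (\<lambda>x. f (pt x)) a)"
proof -
  let ?F = "\<lambda>x. f (pt x)" and ?\<chi> = "bump n a (1/4)" and ?p = "pt a"
  obtain g where g: "\<And>i. i < n \<Longrightarrow> smooth_Rn n (g i)"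
    "\<And>x. x \<in> Rn n \<Longrightarrow> ?F x = ?F a + (\<Sum>i<n. (x i - a i) * g i x)"
    "\<And>i. i < n \<Longrightarrow> g i a = partial_deriv i ?F a"
    using Hadamard[OF smooth_functions_lift[OF f] a] by metis
  define G where "G = (\<lambda>i. loc a (\<lambda>x. ?\<chi> x * g i x))"
  have GC: "G i \<in> C" if "i < n" for i
    unfolding G_def by (rule loc_bump_C[OF g(1)[OF that]])
  have Gp: "G i ?p = ?\<chi> a * g i a" for i
    unfolding G_def by (rule loc_pt[OF mem_box[OF a]])
  have lc: "lcoord a i ?p = 0" and lb: "lbump a ?p = ?\<chi> a" for i
    by (simp_all add: lcoord_def lbump_def loc_pt[OF mem_box[OF a]])
  let ?h = "f - f ?p *\<^sub>R one"
  have hC: "?h \<in> C" by (intro C_diff C_scale f one_C)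
  \<comment> \<open>Two bump factors, one absorbed by each of \<open>lcoord a i\<close> and
    \<open>G i\<close>; off the box both sides are 0.\<close>
  have eq: "lbump a * lbump a * ?h = (\<Sum>i<n. lcoord a i * G i)"
  proof
    fix q
    show "(lbump a * lbump a * ?h) q = (\<Sum>i<n. lcoord a i * G i) q"
    proof (cases "q \<in> pt ` box a")
      case True
      then obtain x where x: "x \<in> box a" "q = pt x" by blast
      then have xR: "x \<in> Rn n" using box_Rn by auto
      have "(lbump a * lbump a * ?h) q = ?\<chi> x * ?\<chi> x * (\<Sum>i<n. (x i - a i) * g i x)"
        using g(2)[OF xR] x xR by (simp add: lbump_def loc_pt scaleR_fun_def)
      then show ?thesis
        using x by (simp add: lcoord_def G_def loc_pt sum_distrib_left mult_ac sum_fun_apply)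
    next
      case False
      then show ?thesis by (simp add: lbump_def lcoord_def loc_def sum_fun_apply)
    qed
  qed
  have "X (lbump a * lbump a * ?h) ?p = ?\<chi> a * ?\<chi> a * X f ?p"
  proof -
    have "X (lbump a * lbump a * ?h) = lbump a * lbump a * X ?h + ?h * X (lbump a * lbump a)"
      by (rule VF_mult[OF X C_mult[OF lbump_C lbump_C] hC])
    moreover have "X ?h = X f"
      using VF_diff[OF X f C_scale[OF one_C]] VF_scale[OF X one_C] VF_one[OF X] by simp
    moreover have "?h ?p = 0" using a by (simp add: scaleR_fun_def)
    ultimately show ?thesis by (simp add: lb)
  qed
  moreover have "X (\<Sum>i<n. lcoord a i * G i) ?p = (\<Sum>i<n. ?\<chi> a * g i a * X (lcoord a i) ?p)"
  proof -
    have "X (\<Sum>i<n. lcoord a i * G i) = (\<Sum>i<n. lcoord a i * X (G i) + G i * X (lcoord a i))"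
      using VF_sum[OF X, of "{..<n}" "\<lambda>i. lcoord a i * G i"] VF_mult[OF X lcoord_C GC]
      by (simp add: C_mult lcoord_C GC)
    then show ?thesis by (simp add: sum_fun_apply lc Gp)
  qed
  ultimately have "?\<chi> a * (?\<chi> a * X f ?p) = ?\<chi> a * (\<Sum>i<n. g i a * X (lcoord a i) ?p)"
    unfolding eq by (simp add: sum_distrib_left mult_ac)
  then have "?\<chi> a * X f ?p = (\<Sum>i<n. g i a * X (lcoord a i) ?p)"
    using bump_center by simp
  then have "X f ?p = (\<Sum>i<n. g i a * X (lcoord a i) ?p) / ?\<chi> a"
    using bump_center by (simp add: field_simps)
  then show ?thesis
    using g(3) by (simp add: sum_divide_distrib mult_ac)
qed

lemma partial_lcoord:
  assumes x: "x \<in> box a" and i: "i < n"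
  shows "partial_deriv i (\<lambda>z. lcoord a j (pt z)) x =
    partial_deriv i (\<lambda>z. lbump a (pt z)) x * (x j - a j) + (if i = j then bump n a (1/4) x else 0)"
proof -
  have xR: "x \<in> Rn n" using x box_Rn by auto
  have "partial_deriv i (\<lambda>z. lcoord a j (pt z)) x = partial_deriv i (\<lambda>z. bump n a (1/4) z * (z j - a j)) x"
    by (rule partial_deriv_cong[OF open_box _ x i]) (simp add: lcoord_def loc_pt)
  also have "\<dots> = partial_deriv i (bump n a (1/4)) x * (x j - a j) + bump n a (1/4) x * partial_deriv i (\<lambda>z. z j - a j) x"
    by (rule partial_deriv_mult[OF xR i smooth_bump]) (intro smooth_intros)
  also have "partial_deriv i (bump n a (1/4)) x = partial_deriv i (\<lambda>z. lbump a (pt z)) x"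
    by (rule partial_deriv_cong[OF open_box _ x i]) (simp add: lbump_def loc_pt)
  also have "partial_deriv i (\<lambda>z. z j - a j) x = (if i = j then 1 else 0)"
    using partial_deriv_diff[OF xR i smooth_Rn_coord smooth_Rn_const, of j "a j"] by simp
  finally show ?thesis by simp
qed

lemma partial_lcoord_center:
  assumes "a \<in> Rn n" "i < n"
  shows "partial_deriv i (\<lambda>z. lcoord a j (pt z)) a = (if i = j then bump n a (1/4) a else 0)"
  using partial_lcoord[OF mem_box[OF assms(1)] assms(2), of j] by simp

text \<open>The coefficients at \<open>x\<close> are read off with functions centred at
  \<open>x\<close>, which hides their smoothness. Near a fixed \<open>a\<close> they are recomputed
  from the functions centred at \<open>a\<close>, dividing by the bump where it is nonzero.\<close>

lemma coordinate_coefficients: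
  assumes X: "X \<in> VF"
  obtains c where "\<And>j. j < n \<Longrightarrow> smooth_Rn n (c j)"
    and "\<And>f x. f \<in> C \<Longrightarrow> x \<in> Rn n \<Longrightarrow> X f (pt x) = (\<Sum>j<n. c j x * partial_deriv j (\<lambda>x. f (pt x)) x)"
proof
  define c where "c = (\<lambda>j x. X (lcoord x j) (pt x) / bump n x (1/4) x)"
  show X_c: "X f (pt x) = (\<Sum>j<n. c j x * partial_deriv j (\<lambda>x. f (pt x)) x)" if "f \<in> C" "x \<in> Rn n" for f x
    unfolding c_def by (rule vector_field_at[OF X that])
  fix j assume j: "j < n"
  show "smooth_Rn n (c j)"
    unfolding smooth_Rn_def
  proof (intro allI ck_local subset_refl)
    fix m a assume a: "a \<in> Rn n"
    define W where "W = {x \<in> Rn n. bump n a (1/4) x \<noteq> 0}"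
    have oW: "open_Rn n W"
    proof -
      have "open_Rn n (Rn n \<inter> bump n a (1/4) -` (- {0}))"
        by (rule continuous_openin_preimage_gen[OF smooth_Rn_continuous[OF smooth_bump]])
          (auto intro: open_Compl)
      then show ?thesis by (rule back_subst) (auto simp: W_def)
    qed
    have W_box: "x \<in> box a" if "x \<in> W" for x
    proof -
      have "\<bar>x i - a i\<bar> < 1/2" if "i < n" for i
        using \<open>x \<in> W\<close> bump_nonzero_iff[of "1/4" n a x] that unfolding W_def by fastforce
      then show ?thesis using that by (simp add: box_def W_def)
    qed
    have eq: "(X (lcoord a j) (pt x) - (x j - a j) * X (lbump a) (pt x)) * inverse (bump n a (1/4) x) = c j x"
      if x: "x \<in> W" for x
    proof -
      have xR: "x \<in> Rn n" and nz: "bump n a (1/4) x \<noteq> 0" using x by (auto simp: W_def)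
      have "X (lcoord a j) (pt x) = (\<Sum>i<n. c i x * (partial_deriv i (\<lambda>z. lbump a (pt z)) x * (x j - a j) +
          (if i = j then bump n a (1/4) x else 0)))"
        using X_c[OF lcoord_C xR, of a j] partial_lcoord[OF W_box[OF x]] by simp
      also have "\<dots> = (\<Sum>i<n. (x j - a j) * (c i x * partial_deriv i (\<lambda>z. lbump a (pt z)) x)) +
          (\<Sum>i<n. if i = j then c i x * bump n a (1/4) x else 0)"
        unfolding sum.distrib[symmetric] by (intro sum.cong) (auto simp: algebra_simps)
      also have "\<dots> = (x j - a j) * X (lbump a) (pt x) + c j x * bump n a (1/4) x"
        using j X_c[OF lbump_C xR, of a] by (simp flip: sum_distrib_left)
      finally show ?thesis using nz by simp
    qed
    have "ck n W m (\<lambda>x. (X (lcoord a j) (pt x) - (x j - a j) * X (lbump a) (pt x)) * inverse (bump n a (1/4) x))"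
    proof (rule ck_mult[OF oW])
      have "smooth_Rn n (\<lambda>x. X (lcoord a j) (pt x) - (x j - a j) * X (lbump a) (pt x))"
        by (intro smooth_intros smooth_functions_lift VF_C[OF X] lcoord_C lbump_C)
      then show "ck n W m (\<lambda>x. X (lcoord a j) (pt x) - (x j - a j) * X (lbump a) (pt x))"
        using ck_subset[OF open_Rn_subset[OF oW]] smooth_Rn_ck by blast
      show "ck n W m (\<lambda>x. inverse (bump n a (1/4) x))"
        by (rule ck_inverse[OF oW _ ck_subset[OF open_Rn_subset[OF oW] smooth_Rn_ck[OF smooth_bump]]])
          (simp add: W_def)
    qed
    then have "ck n W m (c j)"
      using ck_cong[OF oW, of "\<lambda>x. (X (lcoord a j) (pt x) - (x j - a j) * X (lbump a) (pt x)) * inverse (bump n a (1/4) x)" "c j" m] eq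
      by blast
    then show "\<exists>W. open_Rn n W \<and> a \<in> W \<and> ck n W m (c j)"
      using oW a bump_center by (intro exI[of _ W]) (simp add: W_def)
  qed
qed

text \<open>Testing on the cut-off coordinates centred at \<open>x\<close> shows that the coordinate
  coefficients vanish, and \<open>tr\<close> is invertible.\<close>

lemma fr_independent:
  assumes x: "x \<in> Rn n" and d: "\<And>f. f \<in> C \<Longrightarrow> (\<Sum>i<n. d i * fr i (\<lambda>x. f (pt x)) x) = 0" and i: "i < n"
  shows "d i = 0"
proof -
  have *: "tr (x 0) d j = 0" if "j < n" for j
  proof -
    have "(\<Sum>l<n. tr (x 0) d l * partial_deriv l (\<lambda>z. lcoord x j (pt z)) x) = 0"
      using d[OF lcoord_C[of x j]] by (simp add: fr_sum)
    also have "(\<Sum>l<n. tr (x 0) d l * partial_deriv l (\<lambda>z. lcoord x j (pt z)) x) =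
        (\<Sum>l<n. if l = j then tr (x 0) d j * bump n x (1/4) x else 0)"
      by (intro sum.cong) (auto simp: partial_lcoord_center[OF x])
    finally show ?thesis using bump_center that by simp
  qed
  have "d i = tr (- x 0) (tr (x 0) d) i"
    by (simp add: tr_tr tr_0)
  also have "\<dots> = tr (- x 0) (\<lambda>j. 0) i"
    by (rule tr_cong) (use i * in simp)
  also have "\<dots> = 0"
    by (simp add: tr_def flow_def)
  finally show ?thesis .
qed

text \<open>Coordinate coefficients are not invariant under deck transformations, but frame
  coefficients are, by invariance and independence of the frame; so they descend to the
  quotient.\<close>

lemma frame_expansion:
  assumes X: "X \<in> VF"
  obtains b where "\<And>i. i < n \<Longrightarrow> b i \<in> C" "\<And>f. f \<in> C \<Longrightarrow> X f = (\<Sum>i<n. b i * fld i f)"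
proof -
  obtain c where c: "\<And>j. j < n \<Longrightarrow> smooth_Rn n (c j)"
    "\<And>f x. f \<in> C \<Longrightarrow> x \<in> Rn n \<Longrightarrow> X f (pt x) = (\<Sum>j<n. c j x * partial_deriv j (\<lambda>x. f (pt x)) x)"
    using coordinate_coefficients[OF X] by blast
  define a where "a = (\<lambda>i x. tr (- x 0) (\<lambda>j. c j x) i)"
  have a_expand: "X f (pt x) = (\<Sum>i<n. a i x * fr i (\<lambda>x. f (pt x)) x)" if "f \<in> C" "x \<in> Rn n" for f x
    unfolding fr_sum c(2)[OF that] a_def by (simp add: tr_tr tr_0)
  have a_smooth: "smooth_Rn n (a i)" if "i < n" for i
    unfolding a_def
    using smooth_tr[where F="\<lambda>x. 0 - x 0" and a=c, OF smooth_Rn_diff[OF smooth_Rn_const smooth_Rn_coord] c(1) that]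
    by simp
  have a_inv: "invariant (a i)" if i: "i < n" for i
  proof (rule invariantI)
    fix x s and w :: "nat \<Rightarrow> real" assume x: "x \<in> Rn n" and sw: "lat s" "\<And>i. w i \<in> \<int>"
    have "a i x - a i (act s w x) = 0"
    proof (rule fr_independent[OF x _ i])
      fix f assume f: "f \<in> C"
      have "fr i (\<lambda>x. f (pt x)) (act s w x) = fr i (\<lambda>x. f (pt x)) x" if "i < n" for i
        using fr_invariant[OF smooth_functions_lift[OF f] invariant_lift that] rel_act[OF x sw(1), of w] sw(2)
        unfolding invariant_def by metis
      moreover have "X f (pt (act s w x)) = X f (pt x)"
        using pt_act[OF x sw] by simp
      ultimately have "(\<Sum>i<n. a i x * fr i (\<lambda>x. f (pt x)) x) = (\<Sum>i<n. a i (act s w x) * fr i (\<lambda>x. f (pt x)) x)"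
        using a_expand[OF f x] a_expand[OF f act_Rn, of s w x] by simp
      then show "(\<Sum>i<n. (a i x - a i (act s w x)) * fr i (\<lambda>x. f (pt x)) x) = 0"
        by (simp add: left_diff_distrib sum_subtractf)
    qed
    then show "a i (act s w x) = a i x" by simp
  qed
  have bC: "descend (a i) \<in> C" if "i < n" for i
    by (rule descend_smooth[OF a_inv[OF that] a_smooth[OF that]])
  have b_expand: "X f = (\<Sum>i<n. descend (a i) * fld i f)" if f: "f \<in> C" for f
  proof (rule smooth_functions_eqI)
    show "X f \<in> C" by (rule VF_C[OF X f])
    show "(\<Sum>i<n. descend (a i) * fld i f) \<in> C" by (intro C_sum C_mult bC fld_C f) auto
    show "X f (pt x) = (\<Sum>i<n. descend (a i) * fld i f) (pt x)" if x: "x \<in> Rn n" for x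
      unfolding sum_fun_apply a_expand[OF f x]
      by (intro sum.cong refl) (simp add: descend_pt[OF a_inv x] fld_pt[OF f x])
  qed
  show ?thesis
    by (rule that[of "\<lambda>i. descend (a i)"]) (use bC b_expand in blast)+
qed

text \<open>Values at indices from \<open>n\<close> on are arbitrary, whence the guards
  \<open>i < n\<close> in what follows.\<close>

definition cf :: "point vfield \<Rightarrow> nat \<Rightarrow> point \<Rightarrow> real" where
  "cf X = (SOME b. (\<forall>i<n. b i \<in> C) \<and> (\<forall>f\<in>C. X f = (\<Sum>i<n. b i * fld i f)))"

lemma cf:
  assumes "X \<in> VF"
  shows cf_C: "\<And>i. i < n \<Longrightarrow> cf X i \<in> C" and cf_expand: "\<And>f. f \<in> C \<Longrightarrow> X f = (\<Sum>i<n. cf X i * fld i f)"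
proof -
  have "\<exists>b. (\<forall>i<n. b i \<in> C) \<and> (\<forall>f\<in>C. X f = (\<Sum>i<n. b i * fld i f))"
    using frame_expansion[OF assms] by metis
  then have "(\<forall>i<n. cf X i \<in> C) \<and> (\<forall>f\<in>C. X f = (\<Sum>i<n. cf X i * fld i f))"
    unfolding cf_def by (rule someI_ex)
  then show "\<And>i. i < n \<Longrightarrow> cf X i \<in> C" "\<And>f. f \<in> C \<Longrightarrow> X f = (\<Sum>i<n. cf X i * fld i f)"
    by blast+
qed

lemma cf_unique:
  assumes X: "X \<in> VF" and b: "\<And>i. i < n \<Longrightarrow> b i \<in> C" "\<And>f. f \<in> C \<Longrightarrow> X f = (\<Sum>i<n. b i * fld i f)" and i: "i < n"
  shows "cf X i = b i"
proof (rule smooth_functions_eqI[OF cf_C[OF X i] b(1)[OF i]])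
  fix x assume x: "x \<in> Rn n"
  have "cf X i (pt x) - b i (pt x) = 0"
  proof (rule fr_independent[OF x _ i])
    fix f assume f: "f \<in> C"
    have "(\<Sum>i<n. cf X i * fld i f) (pt x) = (\<Sum>i<n. b i * fld i f) (pt x)"
      using cf_expand[OF X f] b(2)[OF f] by simp
    then show "(\<Sum>i<n. (cf X i (pt x) - b i (pt x)) * fr i (\<lambda>x. f (pt x)) x) = 0"
      using f x by (simp add: sum_fun_apply fld_pt left_diff_distrib sum_subtractf)
  qed
  then show "cf X i (pt x) = b i (pt x)" by simp
qed

lemma VF_combination:
  assumes X: "X \<in> VF" and Y: "Y \<in> VF" and fg: "f \<in> C" "g \<in> C"
  shows "(\<lambda>h. f * X h + g * Y h) \<in> VF"
proof (rule vector_fieldsI)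
  show "f * X h + g * Y h = 0" if "h \<notin> C" for h
    using VF_off[OF X that] VF_off[OF Y that] by simp
  show "f * X h + g * Y h \<in> C" if "h \<in> C" for h
    by (intro C_add C_mult VF_C[OF X] VF_C[OF Y] fg that)
  show "f * X (h + h') + g * Y (h + h') = f * X h + g * Y h + (f * X h' + g * Y h')" if "h \<in> C" "h' \<in> C" for h h'
    unfolding VF_add[OF X that] VF_add[OF Y that] by (simp add: algebra_simps)
  show "f * X (c *\<^sub>R h) + g * Y (c *\<^sub>R h) = c *\<^sub>R (f * X h + g * Y h)" if "h \<in> C" for c h
    unfolding VF_scale[OF X that] VF_scale[OF Y that] by (simp add: fun_eq_iff scaleR_fun_def algebra_simps)
  show "f * X (h * h') + g * Y (h * h') = h * (f * X h' + g * Y h') + h' * (f * X h + g * Y h)"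
    if "h \<in> C" "h' \<in> C" for h h'
    unfolding VF_mult[OF X that] VF_mult[OF Y that] by (simp add: algebra_simps)
qed

lemma cf_combination:
  assumes X: "X \<in> VF" and Y: "Y \<in> VF" and fg: "f \<in> C" "g \<in> C" and i: "i < n"
  shows "cf (\<lambda>h. f * X h + g * Y h) i = f * cf X i + g * cf Y i"
proof (rule cf_unique[OF VF_combination[OF X Y fg] _ _ i])
  show "f * cf X i + g * cf Y i \<in> C" if "i < n" for i
    by (intro C_add C_mult fg cf_C[OF X] cf_C[OF Y] that)
  show "f * X h + g * Y h = (\<Sum>i<n. (f * cf X i + g * cf Y i) * fld i h)" if "h \<in> C" for h
    unfolding cf_expand[OF X that] cf_expand[OF Y that]
    by (simp add: distrib_right sum.distrib sum_distrib_left mult.assoc)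
qed

lemma cf_fld:
  assumes "j < n" "i < n"
  shows "cf (fld j) i = (if i = j then one else 0)"
proof (rule cf_unique[OF fld_VF[OF assms(1)] _ _ assms(2)])
  show "(if i = j then one else 0) \<in> C" for i
    by (simp add: one_C C_0)
  show "fld j f = (\<Sum>i<n. (if i = j then one else 0) * fld i f)" if "f \<in> C" for f
  proof -
    have "(\<Sum>i<n. (if i = j then one else 0) * fld i f) = (\<Sum>i<n. if i = j then fld j f else 0)"
      by (intro sum.cong) (auto simp: mult_one fld_C that)
    then show ?thesis using assms(1) by simp
  qed
qed

end

text \<open>The only nonzero structure constants of the frame are those of \<open>[fld 0, fld i] = fld (i + 1)\<close>, \<open>i \<ge> 1\<close>.\<close>

definition kap :: "(nat \<Rightarrow> 'r::comm_ring_1) \<Rightarrow> (nat \<Rightarrow> 'r) \<Rightarrow> nat \<Rightarrow> 'r" where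
  "kap a b i = (if 2 \<le> i then a 0 * b (i - 1) - b 0 * a (i - 1) else 0)"

context filiform
begin

section \<open>Brackets of the frame fields\<close>

lemma smooth_pw [smooth_intros]: "smooth_Rn n (\<lambda>x. pw (x i) k)"
  unfolding pw_def divide_inverse by (intro smooth_intros)

lemma partial_pw:
  "partial_deriv l (\<lambda>x. pw (x 0) k) x = (if l = 0 \<and> 0 < k then pw (x 0) (k - 1) else 0)"
proof (cases "l = 0")
  case True
  have "((\<lambda>t. t ^ k / fact k) has_real_derivative real k * x 0 ^ (k - 1) / fact k) (at (x 0))"
    by (auto intro!: derivative_eq_intros)
  moreover have "real k * x 0 ^ (k - 1) / fact k = (if 0 < k then pw (x 0) (k - 1) else 0)"
    by (cases k) (simp_all add: pw_def del: of_nat_Suc)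
  ultimately show ?thesis
    using True by (intro partial_derivI) (simp add: pw_def)
next
  case False
  then show ?thesis
    by (intro partial_derivI) (simp add: pw_def)
qed

lemma partial_fr_expand:
  assumes F: "smooth_Rn n F" and x: "x \<in> Rn n" and l: "l < n" and i: "1 \<le> i" "i < n"
  shows "partial_deriv l (fr i F) x =
    (\<Sum>m=i..n-1. (if l = 0 \<and> i < m then pw (x 0) (m - Suc i) * partial_deriv m F x else 0) +
       pw (x 0) (m - i) * partial_deriv l (partial_deriv m F) x)"
proof -
  have "partial_deriv l (\<lambda>x. \<Sum>m=i..n-1. pw (x 0) (m - i) * partial_deriv m F x) x =
      (\<Sum>m=i..n-1. partial_deriv l (\<lambda>x. pw (x 0) (m - i) * partial_deriv m F x) x)"
    by (rule partial_deriv_sum[OF x l]) (use i in \<open>auto intro!: smooth_intros F\<close>)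
  also have "\<dots> = (\<Sum>m=i..n-1. (if l = 0 \<and> i < m then pw (x 0) (m - Suc i) * partial_deriv m F x else 0) +
       pw (x 0) (m - i) * partial_deriv l (partial_deriv m F) x)"
  proof (intro sum.cong refl)
    fix m assume "m \<in> {i..n-1}"
    then have m: "m < n" using i by auto
    show "partial_deriv l (\<lambda>x. pw (x 0) (m - i) * partial_deriv m F x) x =
      (if l = 0 \<and> i < m then pw (x 0) (m - Suc i) * partial_deriv m F x else 0) +
       pw (x 0) (m - i) * partial_deriv l (partial_deriv m F) x"
      unfolding partial_deriv_mult[OF x l smooth_pw smooth_Rn_partial[OF F m]] partial_pw by auto
  qed
  finally show ?thesis
    using i by (simp add: fr_def[abs_def])
qed

lemma fr_fr:
  assumes F: "smooth_Rn n F" and x: "x \<in> Rn n" and i: "1 \<le> i" "i < n" and j: "1 \<le> j" "j < n"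
  shows "fr i (fr j F) x = (\<Sum>l=i..n-1. \<Sum>m=j..n-1. pw (x 0) (l - i) * pw (x 0) (m - j) * partial_deriv l (partial_deriv m F) x)"
proof -
  have "fr i (fr j F) x = (\<Sum>l=i..n-1. pw (x 0) (l - i) * partial_deriv l (fr j F) x)"
    using i by (simp add: fr_def)
  also have "\<dots> = (\<Sum>l=i..n-1. \<Sum>m=j..n-1. pw (x 0) (l - i) * pw (x 0) (m - j) * partial_deriv l (partial_deriv m F) x)"
  proof (intro sum.cong refl)
    fix l assume "l \<in> {i..n-1}"
    then have l: "l < n" "l \<noteq> 0" using i by auto
    show "pw (x 0) (l - i) * partial_deriv l (fr j F) x =
        (\<Sum>m=j..n-1. pw (x 0) (l - i) * pw (x 0) (m - j) * partial_deriv l (partial_deriv m F) x)"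
      unfolding partial_fr_expand[OF F x l(1) j] using l by (simp add: sum_distrib_left mult.assoc)
  qed
  finally show ?thesis .
qed

lemma partial_commute:
  "smooth_Rn n F \<Longrightarrow> x \<in> Rn n \<Longrightarrow> i < n \<Longrightarrow> j < n \<Longrightarrow>
    partial_deriv i (partial_deriv j F) x = partial_deriv j (partial_deriv i F) x"
  by (rule partial_deriv_commute[OF smooth_Rn_ck])

lemma fr_commute:
  assumes F: "smooth_Rn n F" and x: "x \<in> Rn n" and i: "1 \<le> i" "i < n" and j: "1 \<le> j" "j < n"
  shows "fr i (fr j F) x = fr j (fr i F) x"
proof -
  have "fr j (fr i F) x = (\<Sum>l=i..n-1. \<Sum>m=j..n-1. pw (x 0) (m - j) * pw (x 0) (l - i) * partial_deriv m (partial_deriv l F) x)"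
    unfolding fr_fr[OF F x j i] by (rule sum.swap)
  also have "\<dots> = fr i (fr j F) x"
    unfolding fr_fr[OF F x i j]
  proof (intro sum.cong refl)
    fix l m assume "l \<in> {i..n-1}" "m \<in> {j..n-1}"
    then have "l < n" "m < n" using i j by auto
    then show "pw (x 0) (m - j) * pw (x 0) (l - i) * partial_deriv m (partial_deriv l F) x =
       pw (x 0) (l - i) * pw (x 0) (m - j) * partial_deriv l (partial_deriv m F) x"
      using partial_commute[OF F x] by simp
  qed
  finally show ?thesis by simp
qed

text \<open>Second derivatives cancel. What remains is the derivative of the coefficients
  \<open>pw (x 0) (m - i)\<close>, which lowers the exponent by one and so gives the coefficients of
  the next frame field.\<close>

lemma fr_commute_0:
  assumes F: "smooth_Rn n F" and x: "x \<in> Rn n" and i: "1 \<le> i" "i < n"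
  shows "fr 0 (fr i F) x - fr i (fr 0 F) x = (if Suc i < n then fr (Suc i) F x else 0)"
proof -
  have "fr 0 (fr i F) x = (\<Sum>m=i..n-1. if i < m then pw (x 0) (m - Suc i) * partial_deriv m F x else 0) +
      (\<Sum>m=i..n-1. pw (x 0) (m - i) * partial_deriv 0 (partial_deriv m F) x)"
    using partial_fr_expand[OF F x _ i, of 0] two_le_n by (simp add: fr_def[of 0] sum.distrib)
  also have "(\<Sum>m=i..n-1. pw (x 0) (m - i) * partial_deriv 0 (partial_deriv m F) x) = fr i (fr 0 F) x"
  proof -
    have "fr 0 F = partial_deriv 0 F" by (simp add: fr_def fun_eq_iff)
    then show ?thesis
      using i partial_commute[OF F x, of 0] by (auto simp: fr_def[of i] intro!: sum.cong)
  qed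
  also have "(\<Sum>m=i..n-1. if i < m then pw (x 0) (m - Suc i) * partial_deriv m F x else 0) =
      (\<Sum>m=Suc i..n-1. pw (x 0) (m - Suc i) * partial_deriv m F x)"
    by (rule sum.mono_neutral_cong_right) auto
  also have "\<dots> = (if Suc i < n then fr (Suc i) F x else 0)"
    by (auto simp: fr_def)
  finally show ?thesis by simp
qed

lemma fld_lift:
  assumes "f \<in> C" "x \<in> Rn n" "i < n" "j < n"
  shows "fld i (fld j f) (pt x) = fr i (fr j (\<lambda>x. f (pt x))) x"
  unfolding fld_pt[OF fld_C[OF assms(1,4)] assms(2,3)]
  by (rule fr_cong[OF open_Rn_Rn _ assms(2,3)]) (rule fld_pt[OF assms(1) _ assms(4)])

lemma fld_commute:
  assumes f: "f \<in> C" and ij: "1 \<le> i" "i < n" "1 \<le> j" "j < n"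
  shows "fld i (fld j f) = fld j (fld i f)"
  by (rule smooth_functions_eqI) (use assms in \<open>auto simp: fld_C fld_lift intro!: fr_commute smooth_functions_lift\<close>)

lemma fld_commute_0:
  assumes f: "f \<in> C" and i: "1 \<le> i" "i < n"
  shows "fld 0 (fld i f) - fld i (fld 0 f) = (if Suc i < n then fld (Suc i) f else 0)"
proof (rule smooth_functions_eqI)
  have n0: "0 < n" using i by simp
  show "fld 0 (fld i f) - fld i (fld 0 f) \<in> C"
    by (intro C_diff fld_C f i n0)
  show "(if Suc i < n then fld (Suc i) f else 0) \<in> C"
    by (simp add: fld_C f C_0)
  show "(fld 0 (fld i f) - fld i (fld 0 f)) (pt x) = (if Suc i < n then fld (Suc i) f else 0) (pt x)" if x: "x \<in> Rn n" for x
    using fr_commute_0[OF smooth_functions_lift[OF f] x i] by (simp add: fld_lift[OF f x] fld_pt[OF f x] i n0)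
qed

lemma lie_bracket_VF:
  assumes X: "X \<in> VF" and Y: "Y \<in> VF"
  shows "lie_bracket X Y \<in> VF"
  unfolding lie_bracket_def
proof (rule vector_fieldsI)
  show "X (Y f) - Y (X f) = 0" if "f \<notin> C" for f
    by (simp add: VF_off[OF X that] VF_off[OF Y that] VF_0 X Y)
  show "X (Y f) - Y (X f) \<in> C" if "f \<in> C" for f
    by (intro C_diff VF_C[OF X] VF_C[OF Y] that)
  show "X (Y (f + g)) - Y (X (f + g)) = X (Y f) - Y (X f) + (X (Y g) - Y (X g))" if "f \<in> C" "g \<in> C" for f g
    unfolding VF_add[OF X that] VF_add[OF Y that]
      VF_add[OF X VF_C[OF Y that(1)] VF_C[OF Y that(2)]] VF_add[OF Y VF_C[OF X that(1)] VF_C[OF X that(2)]]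
    by (simp add: algebra_simps)
  show "X (Y (c *\<^sub>R f)) - Y (X (c *\<^sub>R f)) = c *\<^sub>R (X (Y f) - Y (X f))" if "f \<in> C" for f c
    unfolding VF_scale[OF X that] VF_scale[OF Y that] VF_scale[OF X VF_C[OF Y that]] VF_scale[OF Y VF_C[OF X that]]
    by (simp add: scaleR_diff_right)
  show "X (Y (f * g)) - Y (X (f * g)) = f * (X (Y g) - Y (X g)) + g * (X (Y f) - Y (X f))"
    if f: "f \<in> C" and g: "g \<in> C" for f g
  proof -
    have *: "X' (f * Y' g + g * Y' f) = f * X' (Y' g) + Y' g * X' f + (g * X' (Y' f) + Y' f * X' g)"
      if X': "X' \<in> VF" and Y': "Y' \<in> VF" for X' Y'
      using VF_add[OF X' C_mult[OF f VF_C[OF Y' g]] C_mult[OF g VF_C[OF Y' f]]]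
        VF_mult[OF X' f VF_C[OF Y' g]] VF_mult[OF X' g VF_C[OF Y' f]] by simp
    show ?thesis
      unfolding VF_mult[OF X f g] VF_mult[OF Y f g] *[OF X Y] *[OF Y X] by (simp add: algebra_simps)
  qed
qed

lemma fld_bracket_sum:
  assumes f: "f \<in> C"
  shows "(\<Sum>i<n. \<Sum>j<n. a i * b j * (fld i (fld j f) - fld j (fld i f))) = (\<Sum>i<n. kap a b i * fld i f)"
proof -
  let ?D = "\<lambda>i j. fld i (fld j f) - fld j (fld i f)"
  have split: "(\<Sum>i<n. g i) = g 0 + (\<Sum>i=1..n-1. g i)" for g :: "nat \<Rightarrow> point \<Rightarrow> real"
  proof -
    have "{..<n} = insert 0 {1..n-1}" using two_le_n by auto
    then show ?thesis by simp
  qed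
  have "(\<Sum>i<n. \<Sum>j<n. a i * b j * ?D i j) = (\<Sum>j=1..n-1. a 0 * b j * ?D 0 j) +
      (\<Sum>i=1..n-1. a i * b 0 * ?D i 0) + (\<Sum>i=1..n-1. \<Sum>j=1..n-1. a i * b j * ?D i j)"
    unfolding split by (simp add: sum.distrib add_ac)
  also have "(\<Sum>i=1..n-1. \<Sum>j=1..n-1. a i * b j * ?D i j) = 0"
  proof (intro sum.neutral ballI)
    fix i j assume "i \<in> {1..n-1}" "j \<in> {1..n-1}"
    then have "fld i (fld j f) = fld j (fld i f)" by (intro fld_commute f) auto
    then show "a i * b j * ?D i j = 0" by simp
  qed
  also have "(\<Sum>j=1..n-1. a 0 * b j * ?D 0 j) + (\<Sum>i=1..n-1. a i * b 0 * ?D i 0) + 0 =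
      (\<Sum>j=1..n-1. (a 0 * b j - b 0 * a j) * (if Suc j < n then fld (Suc j) f else 0))"
    unfolding sum.distrib[symmetric] add_0_right
  proof (intro sum.cong refl)
    fix j assume "j \<in> {1..n-1}"
    then have "?D 0 j = (if Suc j < n then fld (Suc j) f else 0)" by (intro fld_commute_0 f) auto
    moreover have "?D j 0 = - ?D 0 j" by simp
    ultimately show "a 0 * b j * ?D 0 j + a j * b 0 * ?D j 0 =
        (a 0 * b j - b 0 * a j) * (if Suc j < n then fld (Suc j) f else 0)"
      by (simp only:) (simp add: algebra_simps)
  qed
  also have "\<dots> = (\<Sum>j=1..<n-1. (a 0 * b j - b 0 * a j) * fld (Suc j) f)"
    by (rule sum.mono_neutral_cong_right) auto
  also have "\<dots> = (\<Sum>i=2..<n. kap a b i * fld i f)"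
    by (rule sum.reindex_bij_witness[of _ "\<lambda>i. i - 1" Suc]) (auto simp: kap_def)
  also have "\<dots> = (\<Sum>i<n. kap a b i * fld i f)"
    by (rule sum.mono_neutral_left) (auto simp: kap_def)
  finally show ?thesis .
qed

text \<open>Expanded in the frame, the second-order terms of \<open>X (Y f) - Y (X f)\<close>
  combine to commutators of frame fields, which \<open>kap\<close> collects.\<close>

lemma cf_lie_bracket:
  assumes X: "X \<in> VF" and Y: "Y \<in> VF" and i: "i < n"
  shows "cf (lie_bracket X Y) i = X (cf Y i) - Y (cf X i) + kap (cf X) (cf Y) i"
proof (rule cf_unique[OF lie_bracket_VF[OF X Y] _ _ i])
  show "X (cf Y i) - Y (cf X i) + kap (cf X) (cf Y) i \<in> C" if "i < n" for i
    using that by (auto simp: kap_def intro!: C_add C_diff C_mult C_0 VF_C[OF X] VF_C[OF Y] cf_C[OF X] cf_C[OF Y])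
  fix f assume f: "f \<in> C"
  have *: "X' (Y' f) = (\<Sum>j<n. X' (cf Y' j) * fld j f) + (\<Sum>j<n. \<Sum>i<n. cf X' i * cf Y' j * fld i (fld j f))"
    if X': "X' \<in> VF" and Y': "Y' \<in> VF" for X' Y'
  proof -
    have "X' (Y' f) = (\<Sum>j<n. X' (cf Y' j * fld j f))"
      unfolding cf_expand[OF Y' f] by (rule VF_sum[OF X']) (auto intro!: C_mult cf_C[OF Y'] fld_C f)
    also have "\<dots> = (\<Sum>j<n. X' (cf Y' j) * fld j f + (\<Sum>i<n. cf X' i * cf Y' j * fld i (fld j f)))"
    proof (intro sum.cong refl)
      fix j assume "j \<in> {..<n}"
      then have j: "j < n" by simp
      have "X' (fld j f) = (\<Sum>i<n. cf X' i * fld i (fld j f))"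
        by (rule cf_expand[OF X' fld_C[OF f j]])
      then show "X' (cf Y' j * fld j f) = X' (cf Y' j) * fld j f + (\<Sum>i<n. cf X' i * cf Y' j * fld i (fld j f))"
        unfolding VF_mult[OF X' cf_C[OF Y' j] fld_C[OF f j]] by (simp add: sum_distrib_left mult_ac)
    qed
    finally show ?thesis by (simp add: sum.distrib)
  qed
  have "(\<Sum>i<n. \<Sum>j<n. cf X i * cf Y j * (fld i (fld j f) - fld j (fld i f))) =
      (\<Sum>j<n. \<Sum>i<n. cf X i * cf Y j * fld i (fld j f)) - (\<Sum>j<n. \<Sum>i<n. cf Y i * cf X j * fld i (fld j f))"
    unfolding right_diff_distrib sum_subtractf
    by (subst (1) sum.swap) (simp add: mult.commute)
  then show "lie_bracket X Y f = (\<Sum>i<n. (X (cf Y i) - Y (cf X i) + kap (cf X) (cf Y) i) * fld i f)"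
    unfolding lie_bracket_def *[OF X Y] *[OF Y X] fld_bracket_sum[OF f]
    by (simp add: algebra_simps sum.distrib sum_subtractf)
qed

end

section \<open>The dual coframe and the symplectic form\<close>

lemma Pow_lessThan_2: "Pow {..<2::nat} = {{}, {0}, {1}, {0, 1}}"
proof -
  have "{..<2::nat} = {0, 1}" by auto
  then show ?thesis by (auto simp: Pow_insert)
qed

lemma wedge_pair:
  "wedge \<alpha> \<beta> [X, Y] = \<alpha> [] * \<beta> [X, Y] + \<alpha> [X] * \<beta> [Y] - \<alpha> [Y] * \<beta> [X] + \<alpha> [X, Y] * \<beta> []"
proof -
  have *: "{(i, j). i < j \<and> j \<in> {} \<and> i \<notin> ({}::nat set)} = {}"
    "{(i, j). i < j \<and> j \<in> {0::nat} \<and> i \<notin> {0::nat}} = {}"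
    "{(i, j). i < j \<and> j \<in> {1::nat} \<and> i \<notin> {1::nat}} = {(0, 1)}"
    "{(i, j). i < j \<and> j \<in> {0, 1::nat} \<and> i \<notin> {0, 1::nat}} = {}"
    by auto
  have len: "length [X, Y] = 2" by simp
  show ?thesis
    unfolding wedge_def len Pow_lessThan_2
    by (subst sum.insert, simp, simp, subst sum.insert, simp, simp, subst sum.insert, simp, simp)
      (simp only: * sum.insert sum.empty finite.emptyI empty_iff not_False_eq_True card.empty, simp add: nths_Cons)
qed

text \<open>Equality of forms is equality on all lists, so products must be known to vanish on lists
  of the wrong length or with entries that are not vector fields.\<close>

lemma wedge_forms_1:
  assumes "\<alpha> \<in> forms M 1" "\<beta> \<in> forms M 1" "\<not> (length xs = 2 \<and> set xs \<subseteq> vector_fields M)"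
  shows "wedge \<alpha> \<beta> xs = 0"
  unfolding wedge_def
proof (intro sum.neutral ballI)
  fix S assume "S \<in> Pow {..<length xs}"
  have "\<alpha> (nths xs S) = 0 \<or> \<beta> (nths xs (- S)) = 0"
  proof (rule ccontr)
    assume "\<not> ?thesis"
    then have l: "length (nths xs S) = 1" "length (nths xs (- S)) = 1"
      and s: "set (nths xs S) \<subseteq> vector_fields M" "set (nths xs (- S)) \<subseteq> vector_fields M"
      using assms(1,2) by (auto simp: forms_def)
    have "card {i. i < length xs \<and> i \<in> S} + card {i. i < length xs \<and> i \<in> - S} = card {..<length xs}"
    proof -
      have "{i. i < length xs \<and> i \<in> S} \<union> {i. i < length xs \<and> i \<in> - S} = {..<length xs}" by auto
      then show ?thesis
        by (subst card_Un_disjoint[symmetric]) auto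
    qed
    then have "length xs = 2" using l by (simp add: length_nths)
    moreover have "set xs \<subseteq> vector_fields M"
    proof
      fix X assume "X \<in> set xs"
      then obtain i where "i < length xs" "X = xs ! i" by (auto simp: in_set_conv_nth)
      then have "X \<in> set (nths xs S) \<or> X \<in> set (nths xs (- S))" by (auto simp: set_nths)
      with s show "X \<in> vector_fields M" by blast
    qed
    ultimately show False using assms(3) by blast
  qed
  then show "(- 1) ^ card {(i, j). i < j \<and> j \<in> S \<and> i \<notin> S} *\<^sub>R (\<alpha> (nths xs S) * \<beta> (nths xs (- S))) = 0"
    by auto
qed

lemma ext_deriv_pair:
  assumes "X \<in> vector_fields M" "Y \<in> vector_fields M"
  shows "ext_deriv M \<omega> [X, Y] = X (\<omega> [Y]) - Y (\<omega> [X]) - \<omega> [lie_bracket X Y]"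
  using assms by (simp add: ext_deriv_def lessThan_Suc numeral_2_eq_2 nths_Cons)

lemma ext_deriv_triple:
  assumes "X \<in> vector_fields M" "Y \<in> vector_fields M" "Z \<in> vector_fields M"
  shows "ext_deriv M \<omega> [X, Y, Z] = X (\<omega> [Y, Z]) - Y (\<omega> [X, Z]) + Z (\<omega> [X, Y])
    - \<omega> [lie_bracket X Y, Z] + \<omega> [lie_bracket X Z, Y] - \<omega> [lie_bracket Y Z, X]"
  using assms by (simp add: ext_deriv_def lessThan_Suc numeral_3_eq_3 numeral_2_eq_2 nths_Cons)

lemma ext_deriv_off: "\<not> set xs \<subseteq> vector_fields M \<Longrightarrow> ext_deriv M \<omega> xs = 0"
  by (simp add: ext_deriv_def)

context filiform
begin

lemma ext_deriv_length:
  assumes \<omega>: "\<omega> \<in> forms man p" and "length xs \<noteq> Suc p"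
  shows "ext_deriv man \<omega> xs = 0"
proof (cases "set xs \<subseteq> VF")
  case True
  have \<omega>0: "\<omega> ys = 0" if "length ys \<noteq> p" for ys
    using \<omega> that by (auto simp: forms_def)
  have "(- 1) ^ i *\<^sub>R (xs ! i) (\<omega> (nths xs (- {i}))) = 0" if i: "i < length xs" for i
  proof -
    have "{k. k < length xs \<and> k \<in> - {i}} = {..<length xs} - {i}" by auto
    then have "length (nths xs (- {i})) = length xs - 1"
      using i by (simp add: length_nths)
    then have h: "\<omega> (nths xs (- {i})) = 0" using \<omega>0 assms(2) i by auto
    have "xs ! i \<in> VF" using True i by auto
    then show ?thesis by (simp only: h VF_0 scaleR_zero_right)
  qed
  moreover have "\<omega> (lie_bracket (xs ! i) (xs ! j) # nths xs (- {i, j})) = 0" if ij: "j < length xs" "i < j" for i j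
  proof -
    have "{k. k < length xs \<and> k \<in> - {i, j}} = {..<length xs} - {i, j}" by auto
    moreover have "card ({..<length xs} - {i, j}) = length xs - 2"
      using ij by (subst card_Diff_subset) auto
    ultimately have "length (nths xs (- {i, j})) = length xs - 2"
      by (simp add: length_nths)
    then show ?thesis using \<omega>0 assms(2) ij by auto
  qed
  ultimately show ?thesis
    by (simp add: ext_deriv_def)
qed (rule ext_deriv_off)

definition cofr :: "nat \<Rightarrow> point dform" where
  "cofr i xs = (if length xs = 1 \<and> set xs \<subseteq> VF then cf (hd xs) i else 0)"

lemma cofr_single: "X \<in> VF \<Longrightarrow> cofr i [X] = cf X i"
  by (simp add: cofr_def)

lemma cofr_forms:
  assumes "i < n"
  shows "cofr i \<in> forms man 1"
proof -
  have "cofr i xs \<in> C \<and>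
        (\<forall>k<1. \<forall>X \<in> VF. \<forall>Y \<in> VF. \<forall>f \<in> C. \<forall>g \<in> C.
             cofr i (xs[k := (\<lambda>h. f * X h + g * Y h)]) = f * cofr i (xs[k := X]) + g * cofr i (xs[k := Y])) \<and>
        (\<forall>j<1. \<forall>k<j. xs ! k = xs ! j \<longrightarrow> cofr i xs = 0)" if "length xs = 1 \<and> set xs \<subseteq> VF" for xs
  proof -
    obtain X where "xs = [X]" "X \<in> VF"
      using \<open>length xs = 1 \<and> set xs \<subseteq> VF\<close> by (auto simp: length_Suc_conv)
    then show ?thesis
      using assms by (auto simp: cofr_single cf_C VF_combination cf_combination)
  qed
  then show ?thesis
    unfolding forms_def by (auto simp: cofr_def)
qed

lemma zero_forms: "0 \<in> forms M p" if "0 \<in> smooth_functions M"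
  using that by (auto simp: forms_def)

lemma uminus_forms_1: "- \<alpha> \<in> forms man 1" if "\<alpha> \<in> forms man 1"
proof -
  have "- f \<in> C" if "f \<in> C" for f using C_scale[OF that, of "-1"] by simp
  with that show ?thesis by (auto simp: forms_def algebra_simps)
qed

text \<open>The Maurer-Cartan equation, dual to the bracket of \<open>fld 0\<close> with
  \<open>fld (i - 1)\<close>. The sign is attached to the first factor, where \<open>bar\<close>
  puts it in a defining system.\<close>

lemma ext_deriv_cofr:
  assumes i: "i < n"
  shows "ext_deriv man (cofr i) = (if 2 \<le> i then wedge (- cofr 0) (cofr (i - 1)) else 0)" (is "_ = ?R")
proof
  fix xs
  have i1: "i - 1 < n" and n0: "0 < n" using i by auto
  show "ext_deriv man (cofr i) xs = ?R xs"
  proof (cases "length xs = 2 \<and> set xs \<subseteq> VF")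
    case True
    then obtain X Y where xs: "xs = [X, Y]" "X \<in> VF" "Y \<in> VF"
      by (auto simp: numeral_2_eq_2 length_Suc_conv)
    have cofr_Nil: "cofr i [] = 0" for i by (simp add: cofr_def)
    show ?thesis
      unfolding xs(1) ext_deriv_pair[OF xs(2,3)]
      using xs i by (simp add: cofr_single cofr_Nil wedge_pair lie_bracket_VF cf_lie_bracket kap_def algebra_simps)
  next
    case False
    then have "?R xs = 0"
      using wedge_forms_1[OF uminus_forms_1[OF cofr_forms[OF n0]] cofr_forms[OF i1]] by simp
    moreover have "ext_deriv man (cofr i) xs = 0"
      using False ext_deriv_length[OF cofr_forms[OF i], of xs] ext_deriv_off[of xs man "cofr i"]
      by (cases "set xs \<subseteq> VF") (auto simp: numeral_2_eq_2)
    ultimately show ?thesis by simp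
  qed
qed

lemma wedge_cofr_0: "wedge (- cofr 0) (cofr 0) = 0"
proof
  fix xs
  have n0: "0 < n" using two_le_n by simp
  show "wedge (- cofr 0) (cofr 0) xs = 0 xs"
  proof (cases "length xs = 2 \<and> set xs \<subseteq> VF")
    case True
    then obtain X Y where "xs = [X, Y]"
      by (auto simp: numeral_2_eq_2 length_Suc_conv)
    moreover have "cofr 0 [] = 0" by (simp add: cofr_def)
    ultimately show ?thesis by (simp add: wedge_pair mult.commute)
  next
    case False
    then show ?thesis
      using wedge_forms_1[OF uminus_forms_1[OF cofr_forms[OF n0]] cofr_forms[OF n0]] by simp
  qed
qed

end

text \<open>Alternating for even \<open>n\<close>, since \<open>i\<close> and \<open>n - 1 - i\<close> then have different parities.\<close>

definition alt :: "nat \<Rightarrow> (nat \<Rightarrow> 'r::comm_ring_1) \<Rightarrow> (nat \<Rightarrow> 'r) \<Rightarrow> 'r" where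
  "alt n a b = (\<Sum>i<n. (-1) ^ i * (a i * b (n - 1 - i)))"

lemma alt_antisym:
  assumes "even n"
  shows "alt n a b = - alt n b a"
proof -
  have "alt n a b = (\<Sum>i<n. (-1) ^ (n - 1 - i) * (a (n - 1 - i) * b (n - 1 - (n - 1 - i))))"
    unfolding alt_def by (rule sum.reindex_bij_witness[of _ "\<lambda>i. n - 1 - i" "\<lambda>i. n - 1 - i"]) auto
  also have "\<dots> = (\<Sum>i<n. - ((-1) ^ i * (b i * a (n - 1 - i))))"
  proof (intro sum.cong refl)
    fix i assume "i \<in> {..<n}"
    then have i: "i < n" "n - 1 - (n - 1 - i) = i" by auto
    have "(-1::'a) ^ (n - 1 - i) = - ((-1) ^ i)"
      using assms i by (cases "even i") (auto simp: even_diff_nat)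
    then show "(-1) ^ (n - 1 - i) * (a (n - 1 - i) * b (n - 1 - (n - 1 - i))) = - ((-1) ^ i * (b i * a (n - 1 - i)))"
      unfolding i(2) by (simp add: mult.commute)
  qed
  finally show ?thesis by (simp add: alt_def sum_negf)
qed

lemma alt_add: "alt n (\<lambda>i. a i + a' i) b = alt n a b + alt n a' b"
  "alt n a (\<lambda>i. b i + b' i) = alt n a b + alt n a b'"
  and alt_diff: "alt n (\<lambda>i. a i - a' i) b = alt n a b - alt n a' b"
  and alt_mult: "alt n (\<lambda>i. f * a i) b = f * alt n a b" "alt n a (\<lambda>i. f * b i) = f * alt n a b"
  by (simp_all add: alt_def algebra_simps sum.distrib sum_subtractf sum_distrib_left)

text \<open>Closedness of the symplectic form on the Lie algebra. Apart from one boundary term,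
  \<open>alt n (kap a b) c\<close> is built from the bilinear form \<open>Q\<close>, which is
  symmetric because \<open>i \<mapsto> n - i\<close> preserves parity for even \<open>n\<close>;
  then everything cancels in the alternating sum.\<close>

lemma alt_kap:
  assumes "even n"
  shows "alt n (kap a b) c - alt n (kap a c) b + alt n (kap b c) a = (0::'r::comm_ring_1)"
proof (cases "n = 0")
  case False
  with assms have n2: "2 \<le> n" by auto
  define Q :: "(nat \<Rightarrow> 'r) \<Rightarrow> (nat \<Rightarrow> 'r) \<Rightarrow> 'r" where
    "Q = (\<lambda>b c. \<Sum>i=2..<n-1. (-1) ^ i * (b (i - 1) * c (n - 1 - i)))"
  have Q_sym: "Q b c = Q c b" for b c
  proof -
    have "Q b c = (\<Sum>i=2..<n-1. (-1) ^ (n - i) * (b (n - i - 1) * c (n - 1 - (n - i))))"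
      unfolding Q_def by (rule sum.reindex_bij_witness[of _ "\<lambda>i. n - i" "\<lambda>i. n - i"]) auto
    also have "\<dots> = Q c b"
      unfolding Q_def
    proof (intro sum.cong refl)
      fix i assume "i \<in> {2..<n-1}"
      then have i: "i < n" "n - i - 1 = n - 1 - i" "n - 1 - (n - i) = i - 1" by auto
      have "(-1::'r) ^ (n - i) = (-1) ^ i"
        using assms i by (cases "even i") (auto simp: even_diff_nat)
      then show "(-1) ^ (n - i) * (b (n - i - 1) * c (n - 1 - (n - i))) = (-1) ^ i * (c (i - 1) * b (n - 1 - i))"
        unfolding i by (simp add: mult.commute)
    qed
    finally show ?thesis .
  qed
  have *: "alt n (kap a b) c = a 0 * Q b c - b 0 * Q a c - (if 4 \<le> n then (a 0 * b (n - 2) - b 0 * a (n - 2)) * c 0 else 0)"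
    for a b c :: "nat \<Rightarrow> 'r"
  \<comment> \<open>The summand for \<open>i = n - 1\<close> pairs with \<open>c 0\<close> and is
    split off; for \<open>n = 2\<close> it is 0, since \<open>kap\<close> vanishes below index
    2.\<close>
  proof (cases "4 \<le> n")
    case True
    have "alt n (kap a b) c = (\<Sum>i=2..<n. (-1) ^ i * (kap a b i * c (n - 1 - i)))"
      unfolding alt_def by (rule sum.mono_neutral_right) (auto simp: kap_def)
    also have "{2..<n} = insert (n - 1) {2..<n-1}"
      using True by auto
    also have "(\<Sum>i\<in>insert (n - 1) {2..<n-1}. (-1) ^ i * (kap a b i * c (n - 1 - i))) =
        (-1) ^ (n - 1) * (kap a b (n - 1) * c 0) + (\<Sum>i=2..<n-1. (-1) ^ i * (kap a b i * c (n - 1 - i)))"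
      by simp
    also have "(-1::'r) ^ (n - 1) = -1" using assms n2 by simp
    also have "(\<Sum>i=2..<n-1. (-1) ^ i * (kap a b i * c (n - 1 - i))) = a 0 * Q b c - b 0 * Q a c"
      unfolding Q_def sum_distrib_left sum_subtractf[symmetric]
      by (intro sum.cong refl) (simp add: kap_def algebra_simps)
    moreover have "kap a b (n - 1) = a 0 * b (n - 2) - b 0 * a (n - 2)"
      using True by (auto simp: kap_def numeral_2_eq_2)
    ultimately show ?thesis
      using True by simp
  next
    case False
    from assms obtain m where "n = 2 * m" by (rule evenE)
    with False n2 have "n = 2" by arith
    then show ?thesis by (simp add: alt_def kap_def Q_def lessThan_Suc numeral_2_eq_2)
  qed
  show ?thesis
    unfolding * Q_sym[of c b] Q_sym[of c a] Q_sym[of b a] by (simp add: algebra_simps)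
qed (simp add: alt_def)

lemma alt_cong: "(\<And>i. i < n \<Longrightarrow> a i = a' i) \<Longrightarrow> (\<And>i. i < n \<Longrightarrow> b i = b' i) \<Longrightarrow> alt n a b = alt n a' b'"
  unfolding alt_def by (intro sum.cong refl) auto

context filiform
begin

section \<open>The symplectic form\<close>

definition om :: "point dform" where
  "om xs = (if length xs = 2 \<and> set xs \<subseteq> VF then alt n (cf (xs ! 0)) (cf (xs ! 1)) else 0)"

lemma om_pair: "X \<in> VF \<Longrightarrow> Y \<in> VF \<Longrightarrow> om [X, Y] = alt n (cf X) (cf Y)"
  by (simp add: om_def)

lemma C_sign: "f \<in> C \<Longrightarrow> (-1) ^ i * f \<in> C"
  using C_scale[of f "-1"] by (cases "even i") auto

lemma alt_C:
  assumes "\<And>i. i < n \<Longrightarrow> a i \<in> C" "\<And>i. i < n \<Longrightarrow> b i \<in> C"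
  shows "alt n a b \<in> C"
  unfolding alt_def by (intro C_sum C_sign C_mult assms) auto

lemma VF_alt:
  assumes X: "X \<in> VF" and a: "\<And>i. i < n \<Longrightarrow> a i \<in> C" and b: "\<And>i. i < n \<Longrightarrow> b i \<in> C"
  shows "X (alt n a b) = alt n (\<lambda>i. X (a i)) b + alt n a (\<lambda>i. X (b i))"
proof -
  have sgn: "X ((-1) ^ i * f) = (-1) ^ i * X f" if "f \<in> C" for f i
    using VF_scale[OF X that, of "-1"] by (cases "even i") auto
  have "X (alt n a b) = (\<Sum>i<n. X ((-1) ^ i * (a i * b (n - 1 - i))))"
    unfolding alt_def by (intro VF_sum[OF X] C_sign C_mult a b) auto
  also have "\<dots> = (\<Sum>i<n. (-1) ^ i * (X (a i) * b (n - 1 - i)) + (-1) ^ i * (a i * X (b (n - 1 - i))))"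
  proof (intro sum.cong refl)
    fix i assume "i \<in> {..<n}"
    then have i: "i < n" "n - 1 - i < n" by auto
    show "X ((-1) ^ i * (a i * b (n - 1 - i))) =
        (-1) ^ i * (X (a i) * b (n - 1 - i)) + (-1) ^ i * (a i * X (b (n - 1 - i)))"
      unfolding sgn[OF C_mult[OF a[OF i(1)] b[OF i(2)]]] VF_mult[OF X a[OF i(1)] b[OF i(2)]]
      by (simp add: algebra_simps)
  qed
  finally show ?thesis by (simp add: alt_def sum.distrib)
qed

lemma alt_self:
  assumes "even n"
  shows "alt n a a = (0 :: point \<Rightarrow> real)"
proof
  fix q
  have "alt n a a q = - alt n a a q"
    using fun_cong[OF alt_antisym[OF assms, of a a], of q] by (simp only: uminus_apply)
  then show "alt n a a q = 0 q" by simp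
qed

lemma om_forms:
  assumes "even n"
  shows "om \<in> forms man 2"
proof -
  have comb: "alt n (cf (\<lambda>h. f * X h + g * Y h)) b = f * alt n (cf X) b + g * alt n (cf Y) b"
    "alt n b (cf (\<lambda>h. f * X h + g * Y h)) = f * alt n b (cf X) + g * alt n b (cf Y)"
    if XY: "X \<in> VF" "Y \<in> VF" and fg: "f \<in> C" "g \<in> C" for X Y f g b
  proof -
    have 1: "cf (\<lambda>h. f * X h + g * Y h) i = f * cf X i + g * cf Y i" if "i < n" for i
      by (rule cf_combination[OF XY fg that])
    show "alt n (cf (\<lambda>h. f * X h + g * Y h)) b = f * alt n (cf X) b + g * alt n (cf Y) b"
      using alt_cong[of n "cf (\<lambda>h. f * X h + g * Y h)" "\<lambda>i. f * cf X i + g * cf Y i" b b] 1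
      by (simp add: alt_add alt_mult)
    show "alt n b (cf (\<lambda>h. f * X h + g * Y h)) = f * alt n b (cf X) + g * alt n b (cf Y)"
      using alt_cong[of n b b "cf (\<lambda>h. f * X h + g * Y h)" "\<lambda>i. f * cf X i + g * cf Y i"] 1
      by (simp add: alt_add alt_mult)
  qed
  have "om xs \<in> C \<and>
        (\<forall>k<2. \<forall>X \<in> VF. \<forall>Y \<in> VF. \<forall>f \<in> C. \<forall>g \<in> C.
             om (xs[k := (\<lambda>h. f * X h + g * Y h)]) = f * om (xs[k := X]) + g * om (xs[k := Y])) \<and>
        (\<forall>j<2. \<forall>k<j. xs ! k = xs ! j \<longrightarrow> om xs = 0)" if "length xs = 2 \<and> set xs \<subseteq> VF" for xs
  proof -
    obtain A B where xs: "xs = [A, B]" and AB: "A \<in> VF" "B \<in> VF"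
      using \<open>length xs = 2 \<and> set xs \<subseteq> VF\<close> by (auto simp: numeral_2_eq_2 length_Suc_conv)
    have "om (xs[k := (\<lambda>h. f * X h + g * Y h)]) = f * om (xs[k := X]) + g * om (xs[k := Y])"
      if k: "k < 2" and XY: "X \<in> VF" "Y \<in> VF" and fg: "f \<in> C" "g \<in> C" for k X Y f g
    proof -
      consider "k = 0" | "k = 1" using k by linarith
      then show ?thesis
        by cases (simp_all add: xs om_pair AB XY VF_combination[OF XY fg] comb[OF XY fg])
    qed
    moreover have "om xs \<in> C"
      unfolding xs om_pair[OF AB] by (intro alt_C cf_C[OF AB(1)] cf_C[OF AB(2)])
    moreover have "om xs = 0" if "j < 2" "k < j" "xs ! k = xs ! j" for j k
    proof -
      have "A = B" using that by (auto simp: xs less_2_cases_iff)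
      then show ?thesis unfolding xs om_pair[OF AB] using alt_self[OF assms] by simp
    qed
    ultimately show ?thesis by blast
  qed
  then show ?thesis
    unfolding forms_def by (auto simp: om_def)
qed

text \<open>In the Koszul formula the terms with derivatives of coefficients cancel in pairs by
  antisymmetry, and the structure constants contribute \<open>alt_kap\<close>.\<close>

lemma om_closed:
  assumes "even n"
  shows "ext_deriv man om = 0"
proof
  fix xs
  show "ext_deriv man om xs = 0 xs"
  proof (cases "length xs = 3 \<and> set xs \<subseteq> VF")
    case True
    then obtain X Y Z where xs: "xs = [X, Y, Z]" and V: "X \<in> VF" "Y \<in> VF" "Z \<in> VF"
      by (auto simp: numeral_3_eq_3 length_Suc_conv)
    have lie: "om [lie_bracket U V, W] = alt n (\<lambda>i. U (cf V i)) (cf W) - alt n (\<lambda>i. V (cf U i)) (cf W)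
        + alt n (kap (cf U) (cf V)) (cf W)" if "U \<in> VF" "V \<in> VF" "W \<in> VF" for U V W
      unfolding om_pair[OF lie_bracket_VF[OF that(1,2)] that(3)] alt_diff[symmetric] alt_add[symmetric]
      by (rule alt_cong[OF cf_lie_bracket[OF that(1,2)] refl])
    have D: "U (om [V, W]) = alt n (\<lambda>i. U (cf V i)) (cf W) + alt n (cf V) (\<lambda>i. U (cf W i))"
      if "U \<in> VF" "V \<in> VF" "W \<in> VF" for U V W
      unfolding om_pair[OF that(2,3)] by (rule VF_alt[OF that(1) cf_C[OF that(2)] cf_C[OF that(3)]])
    have "ext_deriv man om [X, Y, Z] =
        (alt n (cf Y) (\<lambda>i. X (cf Z i)) + alt n (\<lambda>i. X (cf Z i)) (cf Y))
        - (alt n (cf X) (\<lambda>i. Y (cf Z i)) + alt n (\<lambda>i. Y (cf Z i)) (cf X))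
        + (alt n (cf X) (\<lambda>i. Z (cf Y i)) + alt n (\<lambda>i. Z (cf Y i)) (cf X))
        - (alt n (kap (cf X) (cf Y)) (cf Z) - alt n (kap (cf X) (cf Z)) (cf Y) + alt n (kap (cf Y) (cf Z)) (cf X))"
      unfolding ext_deriv_triple[OF V] D[OF V] D[OF V(2,1,3)] D[OF V(3,1,2)] lie[OF V] lie[OF V(1,3,2)] lie[OF V(2,3,1)]
      by (simp add: algebra_simps)
    also have "\<dots> = 0"
      unfolding alt_kap[OF assms] alt_antisym[OF assms, of "cf Y" "\<lambda>i. X (cf Z i)"]
        alt_antisym[OF assms, of "cf X" "\<lambda>i. Y (cf Z i)"] alt_antisym[OF assms, of "cf X" "\<lambda>i. Z (cf Y i)"]
      by simp
    finally show ?thesis unfolding xs by simp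
  next
    case False
    then show ?thesis
      using ext_deriv_length[OF om_forms[OF assms], of xs] ext_deriv_off[of xs man om]
      by (cases "set xs \<subseteq> VF") (auto simp: numeral_3_eq_3 numeral_2_eq_2)
  qed
qed

lemma symplectic_om:
  assumes "even n"
  shows "symplectic_form man om"
  unfolding symplectic_form_def
proof (intro conjI ballI impI om_forms om_closed assms)
  fix p X f assume p: "p \<in> topspace (mtop man)" and X: "X \<in> VF" and 0: "\<forall>Y\<in>VF. om [X, Y] p = 0" and f: "f \<in> C"
  obtain x where x: "x \<in> Rn n" "p = pt x" using p by (auto simp: topspace_qtop)
  have "cf X i p = 0" if i: "i < n" for i
  proof -
    \<comment> \<open>The symplectic partner of index \<open>i\<close>: pairing with
      \<open>fld ?j\<close> returns the \<open>i\<close>-th coefficient up to sign.\<close>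
    let ?j = "n - 1 - i"
    have j: "?j < n" using i by simp
    have "om [X, fld ?j] = (\<Sum>k<n. if k = i then (-1) ^ i * cf X i else 0)"
      unfolding om_pair[OF X fld_VF[OF j]] alt_def
    proof (intro sum.cong refl)
      fix k assume "k \<in> {..<n}"
      then have k: "k < n" "n - 1 - k < n" by auto
      then have "n - 1 - k = ?j \<longleftrightarrow> k = i" using i by auto
      then show "(-1) ^ k * (cf X k * cf (fld ?j) (n - 1 - k)) = (if k = i then (-1) ^ i * cf X i else 0)"
        unfolding cf_fld[OF j k(2)] using mult_one(1)[OF cf_C[OF X i]] by auto
    qed
    also have "\<dots> = (-1) ^ i * cf X i" using i by simp
    finally have "((-1) ^ i * cf X i) p = 0" using 0 fld_VF[OF j] by metis
    then show ?thesis by (cases "even i") auto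
  qed
  then show "X f p = 0"
    unfolding cf_expand[OF X f] by (simp add: sum_fun_apply)
qed

section \<open>The Poincare lemma in the frame\<close>

definition cotr :: "real \<Rightarrow> (nat \<Rightarrow> real) \<Rightarrow> nat \<Rightarrow> real" where
  "cotr s Q i = (if i = 0 then Q 0 else \<Sum>j=i..n-1. pw s (j - i) * Q j)"

text \<open>\<open>cotr\<close> is the transpose of \<open>tr\<close>: it takes the coordinate
  components of a 1-form to its frame components, and \<open>cotr\<close> with the negative argument
  goes back.\<close>

lemma fr_cotr: "fr i F x = cotr (x 0) (\<lambda>j. partial_deriv j F x) i"
  by (simp add: fr_def cotr_def)

lemma cotr_cong: "(\<And>j. j < n \<Longrightarrow> Q j = Q' j) \<Longrightarrow> cotr s Q i = cotr s Q' i"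
  using two_le_n unfolding cotr_def by (auto intro!: sum.cong)

lemma cotr_cotr: "cotr s (cotr r Q) i = cotr (s + r) Q i"
proof (cases "i = 0")
  case False
  have "cotr s (cotr r Q) i = (\<Sum>l=i..n-1. \<Sum>j=l..n-1. pw r (j - l) * pw s (l - i) * Q j)"
    using False by (simp add: cotr_def sum_distrib_left mult_ac)
  also have "\<dots> = (\<Sum>j=i..n-1. \<Sum>l=i..j. pw r (j - l) * pw s (l - i) * Q j)"
    by (rule sum_triangle_swap[symmetric])
  also have "\<dots> = (\<Sum>j=i..n-1. pw (r + s) (j - i) * Q j)"
    by (intro sum.cong refl) (simp add: pw_add flip: sum_distrib_right)
  finally show ?thesis using False by (simp add: cotr_def add.commute)
qed (simp add: cotr_def)

lemma cotr_0: "i < n \<Longrightarrow> cotr 0 Q i = Q i"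
proof -
  assume i: "i < n"
  have "(\<Sum>j=i..n-1. pw 0 (j - i) * Q j) = (\<Sum>j\<in>{i}. pw 0 (j - i) * Q j)"
    by (rule sum.mono_neutral_right) (use i in \<open>auto simp: pw_zero\<close>)
  then show ?thesis by (simp add: cotr_def)
qed

lemma partial_cotr: "i < n \<Longrightarrow> partial_deriv i F x = cotr (- x 0) (\<lambda>j. fr j F x) i"
  unfolding fr_cotr by (simp add: cotr_cotr cotr_0)

lemma fr_pw_neg:
  assumes "e < n" "x \<in> Rn n"
  shows "fr e (\<lambda>x. pw (- x 0) k) x = (if e = 0 \<and> 0 < k then - pw (- x 0) (k - 1) else 0)"
proof -
  have "partial_deriv j (\<lambda>x. pw (- x 0) k) x = (if j = 0 \<and> 0 < k then - pw (- x 0) (k - 1) else 0)" for j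
  proof (cases "j = 0")
    case True
    have d: "((\<lambda>t. pw (- t) k) has_real_derivative - (real k * (- x 0) ^ (k - 1) / fact k)) (at (x 0))"
      unfolding pw_def by (auto intro!: derivative_eq_intros)
    have "- (real k * (- x 0) ^ (k - 1) / fact k) = (if 0 < k then - pw (- x 0) (k - 1) else 0)"
      by (cases k) (simp_all add: pw_def del: of_nat_Suc)
    with d show ?thesis
      using True by (intro partial_derivI) simp
  next
    case False
    then show ?thesis
      by (intro partial_derivI) (simp add: pw_def)
  qed
  then show ?thesis by (simp add: fr_def)
qed

lemma smooth_pw_neg [smooth_intros]: "smooth_Rn n (\<lambda>x. pw (- x i) k)"
proof -
  have "smooth_Rn n (\<lambda>x. (0 - x i) ^ k / fact k)"
    unfolding divide_inverse by (intro smooth_intros)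
  then show ?thesis by (simp add: pw_def)
qed

text \<open>For \<open>f \<ge> 1\<close>, the value of the 1-form with frame components
  \<open>Q\<close> on the bracket of the frame fields \<open>e\<close> and \<open>f\<close>.\<close>

definition br :: "(nat \<Rightarrow> (nat \<Rightarrow> real) \<Rightarrow> real) \<Rightarrow> nat \<Rightarrow> nat \<Rightarrow> (nat \<Rightarrow> real) \<Rightarrow> real" where
  "br Q e f x = (if e = 0 \<and> Suc f < n then Q (Suc f) x else 0)"

text \<open>The form is converted to coordinate components \<open>P\<close>. For two positive
  indices the coefficients of \<open>P\<close> may be treated as constants; for index 0 their
  derivative cancels the bracket term. No invariance is involved: the primitive lives on the
  universal cover.\<close>

lemma frame_Poincare:
  assumes Q: "\<And>e. e < n \<Longrightarrow> smooth_Rn n (Q e)"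
    and closed: "\<And>e f x. e < n \<Longrightarrow> 1 \<le> f \<Longrightarrow> f < n \<Longrightarrow> x \<in> Rn n \<Longrightarrow> fr e (Q f) x - fr f (Q e) x = br Q e f x"
  obtains G where "smooth_Rn n G" "\<And>x e. x \<in> Rn n \<Longrightarrow> e < n \<Longrightarrow> fr e G x = Q e x"
proof -
  define P where "P = (\<lambda>i x. cotr (- x 0) (\<lambda>j. Q j x) i)"
  have n0: "0 < n" using two_le_n by simp
  have P_pos: "P i = (\<lambda>x. \<Sum>j=i..n-1. pw (- x 0) (j - i) * Q j x)" if "1 \<le> i" for i
    using that by (simp add: P_def cotr_def)
  have P_0: "P 0 = Q 0" by (simp add: P_def cotr_def)
  have P: "smooth_Rn n (P i)" if "i < n" for i
    by (cases "i = 0") (use that Q n0 in \<open>auto simp: P_0 P_pos intro!: smooth_intros\<close>)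
  have fr_P: "fr e (P i) x = (\<Sum>j=i..n-1. (if e = 0 \<and> i < j then - pw (- x 0) (j - Suc i) * Q j x else 0) + pw (- x 0) (j - i) * fr e (Q j) x)"
    if e: "e < n" and i: "1 \<le> i" "i < n" and x: "x \<in> Rn n" for e i x
  proof -
    have "fr e (P i) x = (\<Sum>j=i..n-1. fr e (\<lambda>x. pw (- x 0) (j - i) * Q j x) x)"
      unfolding P_pos[OF i(1)]
      by (rule fr_sum_fun[OF e x]) (use i in \<open>auto intro!: smooth_intros Q\<close>)
    also have "\<dots> = (\<Sum>j=i..n-1. (if e = 0 \<and> i < j then - pw (- x 0) (j - Suc i) * Q j x else 0) + pw (- x 0) (j - i) * fr e (Q j) x)"
    proof (intro sum.cong refl)
      fix j assume "j \<in> {i..n-1}"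
      then have j: "j < n" using i by auto
      show "fr e (\<lambda>x. pw (- x 0) (j - i) * Q j x) x =
        (if e = 0 \<and> i < j then - pw (- x 0) (j - Suc i) * Q j x else 0) + pw (- x 0) (j - i) * fr e (Q j) x"
        unfolding fr_mult[OF e x smooth_pw_neg Q[OF j]] fr_pw_neg[OF e x] by auto
    qed
    finally show ?thesis .
  qed
  have pos: "partial_deriv i (P l) x = partial_deriv l (P i) x" if i: "1 \<le> i" "i < n" and l: "1 \<le> l" "l < n" and x: "x \<in> Rn n" for i l x
  proof -
    have *: "partial_deriv i (P l) x = (\<Sum>a=i..n-1. \<Sum>m=l..n-1. pw (- x 0) (a - i) * (pw (- x 0) (m - l) * fr a (Q m) x))"
      if i: "1 \<le> i" "i < n" and l: "1 \<le> l" "l < n" for i l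
    proof -
      have "partial_deriv i (P l) x = (\<Sum>a=i..n-1. pw (- x 0) (a - i) * fr a (P l) x)"
        using partial_cotr[OF i(2), of "P l" x] i by (simp add: cotr_def)
      also have "\<dots> = (\<Sum>a=i..n-1. \<Sum>m=l..n-1. pw (- x 0) (a - i) * (pw (- x 0) (m - l) * fr a (Q m) x))"
        using i l x by (intro sum.cong refl) (subst fr_P, auto simp: sum_distrib_left)
      finally show ?thesis .
    qed
    have sw: "fr a (Q m) x = fr m (Q a) x" if "a \<in> {i..n-1}" "m \<in> {l..n-1}" for a m
      using closed[of a m x] that i l x by (auto simp: br_def)
    have "partial_deriv i (P l) x = (\<Sum>a=i..n-1. \<Sum>m=l..n-1. pw (- x 0) (m - l) * (pw (- x 0) (a - i) * fr m (Q a) x))"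
      unfolding *[OF i l]
    proof (intro sum.cong refl)
      fix a m assume "a \<in> {i..n-1}" "m \<in> {l..n-1}"
      from sw[OF this] show "pw (- x 0) (a - i) * (pw (- x 0) (m - l) * fr a (Q m) x) =
          pw (- x 0) (m - l) * (pw (- x 0) (a - i) * fr m (Q a) x)"
        by simp
    qed
    also have "\<dots> = partial_deriv l (P i) x"
      unfolding *[OF l i] by (rule sum.swap)
    finally show ?thesis .
  qed
  have zero: "partial_deriv 0 (P l) x = partial_deriv l (P 0) x" if l: "1 \<le> l" "l < n" and x: "x \<in> Rn n" for l x
  proof -
    have "partial_deriv 0 (P l) x = fr 0 (P l) x" by (simp add: fr_def)
    also have "\<dots> = (\<Sum>j=l..n-1. (if l < j then - pw (- x 0) (j - Suc l) * Q j x else 0)) + (\<Sum>j=l..n-1. pw (- x 0) (j - l) * fr 0 (Q j) x)"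
      using fr_P[OF n0 l x] by (simp add: sum.distrib)
    also have "(\<Sum>j=l..n-1. pw (- x 0) (j - l) * fr 0 (Q j) x) =
        (\<Sum>j=l..n-1. pw (- x 0) (j - l) * fr j (Q 0) x) + (\<Sum>j=l..n-1. pw (- x 0) (j - l) * (if Suc j < n then Q (Suc j) x else 0))"
      unfolding sum.distrib[symmetric]
    proof (intro sum.cong refl)
      fix j assume "j \<in> {l..n-1}"
      then have "fr 0 (Q j) x = fr j (Q 0) x + (if Suc j < n then Q (Suc j) x else 0)"
        using closed[of 0 j x] l x n0 by (auto simp: br_def)
      then show "pw (- x 0) (j - l) * fr 0 (Q j) x =
          pw (- x 0) (j - l) * fr j (Q 0) x + pw (- x 0) (j - l) * (if Suc j < n then Q (Suc j) x else 0)"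
        by (simp add: algebra_simps)
    qed
    also have "(\<Sum>j=l..n-1. if l < j then - pw (- x 0) (j - Suc l) * Q j x else 0) = (\<Sum>j=Suc l..n-1. - pw (- x 0) (j - Suc l) * Q j x)"
      by (rule sum.mono_neutral_cong_right) auto
    also have "(\<Sum>j=l..n-1. pw (- x 0) (j - l) * (if Suc j < n then Q (Suc j) x else 0)) = (\<Sum>j=l..<n-1. pw (- x 0) (j - l) * Q (Suc j) x)"
      by (rule sum.mono_neutral_cong_right) auto
    also have "\<dots> = (\<Sum>j=Suc l..n-1. pw (- x 0) (j - Suc l) * Q j x)"
      by (rule sum.reindex_bij_witness[of _ "\<lambda>i. i - 1" Suc]) auto
    also have "(\<Sum>j=l..n-1. pw (- x 0) (j - l) * fr j (Q 0) x) = partial_deriv l (P 0) x"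
      using partial_cotr[OF l(2), of "P 0" x] l by (simp add: cotr_def P_0)
    finally show ?thesis by (simp add: sum_negf)
  qed
  have "partial_deriv i (P j) x = partial_deriv j (P i) x" if "x \<in> Rn n" "i < n" "j < n" for x i j
    using pos[of i j x] zero[of i x] zero[of j x] that by (cases "i = 0"; cases "j = 0") auto
  then obtain G where G: "smooth_Rn n G" "\<And>x i. x \<in> Rn n \<Longrightarrow> i < n \<Longrightarrow> partial_deriv i G x = P i x"
    using Poincare[of n P] P by metis
  show ?thesis
  proof (rule that[OF G(1)])
    fix x e assume x: "x \<in> Rn n" and e: "e < n"
    have "fr e G x = cotr (x 0) (\<lambda>j. P j x) e"
      unfolding fr_cotr by (rule cotr_cong) (rule G(2)[OF x])
    also have "\<dots> = Q e x"
      unfolding P_def using e by (simp add: cotr_cotr cotr_0)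
    finally show "fr e G x = Q e x" .
  qed
qed

lemma fr_zero_const:
  assumes H: "smooth_Rn n H" and z: "\<And>e x. e < n \<Longrightarrow> x \<in> Rn n \<Longrightarrow> fr e H x = 0" and x: "x \<in> Rn n"
  shows "H x = H (\<lambda>_. 0)"
proof -
  have p: "partial_deriv j H y = 0" if "j < n" "y \<in> Rn n" for j y
  proof -
    have "cotr (- y 0) (\<lambda>j. fr j H y) j = cotr (- y 0) (\<lambda>j. 0) j"
      by (rule cotr_cong) (rule z[OF _ that(2)])
    then show ?thesis
      unfolding partial_cotr[OF that(1)] by (simp add: cotr_def)
  qed
  have z0: "(\<lambda>_. 0) \<in> Rn n" by (simp add: Rn_def)
  have c: "(\<lambda>j. if j < n then 0 + s * x j else 0) \<in> Rn n" for s by (simp add: Rn_def)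
  have "((\<lambda>s. H (\<lambda>j. if j < n then 0 + s * x j else 0)) has_real_derivative 0) (at s)" for s
  proof (rule DERIV_cong[OF chain_rule_ray[OF H z0 x]])
    show "(\<Sum>j<n. x j * partial_deriv j H (\<lambda>j. if j < n then 0 + s * x j else 0)) = 0"
      by (intro sum.neutral ballI) (simp only: lessThan_iff p[OF _ c] mult_zero_right)
  qed
  from DERIV_isconst_all[OF allI[OF this], of 1 0]
  have "H (\<lambda>j. if j < n then 0 + 1 * x j else 0) = H (\<lambda>j. if j < n then 0 + 0 * x j else 0)" .
  moreover have "(\<lambda>j. if j < n then 0 + 1 * x j else 0) = x" "(\<lambda>j. if j < n then 0 + 0 * x j else 0) = (\<lambda>_. 0)"
    using x by (auto simp: Rn_def)
  ultimately show ?thesis by (simp only:)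
qed

end

section \<open>Transport of unipotent connections\<close>

text \<open>
  A family of invariant 1-forms \<open>A u v\<close>, given by their components in the frame, that is strictly upper
  triangular with respect to \<open>lev\<close> and satisfies \<open>d A + A \<and> A = 0\<close> except in the corner from level
  \<open>0\<close> to level \<open>l\<close>.
\<close>

locale flat_system = filiform n for n +
  fixes I :: "'i set" and lev :: "'i \<Rightarrow> nat" and l :: nat
    and A :: "'i \<Rightarrow> 'i \<Rightarrow> nat \<Rightarrow> (nat \<Rightarrow> real) \<Rightarrow> real"
  assumes finite_I: "finite I" and lev_le: "u \<in> I \<Longrightarrow> lev u \<le> l" and l_pos: "1 \<le> l" and l_less: "l < n"
    and A_smooth: "u \<in> I \<Longrightarrow> v \<in> I \<Longrightarrow> e < n \<Longrightarrow> smooth_Rn n (A u v e)"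
    and A_inv: "u \<in> I \<Longrightarrow> v \<in> I \<Longrightarrow> e < n \<Longrightarrow> invariant (A u v e)"
    and A_zero: "u \<in> I \<Longrightarrow> v \<in> I \<Longrightarrow> lev v \<le> lev u \<Longrightarrow> A u v e x = 0"
    and A_flat: "u \<in> I \<Longrightarrow> v \<in> I \<Longrightarrow> lev u < lev v \<Longrightarrow> lev u \<noteq> 0 \<or> lev v \<noteq> l \<Longrightarrow>
      e < n \<Longrightarrow> 1 \<le> f \<Longrightarrow> f < n \<Longrightarrow> x \<in> Rn n \<Longrightarrow>
      fr e (A u v f) x - fr f (A u v e) x = br (A u v) e f x - (\<Sum>w\<in>I. A u w e x * A w v f x - A u w f x * A w v e x)"
begin

definition dlt :: "'i \<Rightarrow> 'i \<Rightarrow> real" where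
  "dlt u v = (if u = v then 1 else 0)"

text \<open>Excludes exactly the pairs from level \<open>0\<close> to level \<open>l\<close>, whose
  transport would have to use the corner entry.\<close>

definition admissible :: "'i \<Rightarrow> 'i \<Rightarrow> bool" where
  "admissible u v \<longleftrightarrow> lev u \<noteq> 0 \<or> lev v \<noteq> l"

text \<open>One entry of row \<open>u\<close> of the equation \<open>dG = G A\<close> with the
  identity as value at the origin; \<open>g\<close> holds the other entries of that row.\<close>

definition transport :: "'i \<Rightarrow> ('i \<Rightarrow> (nat \<Rightarrow> real) \<Rightarrow> real) \<Rightarrow> 'i \<Rightarrow> ((nat \<Rightarrow> real) \<Rightarrow> real) \<Rightarrow> bool" where
  "transport u g v h \<longleftrightarrow> smooth_Rn n h \<and> h (\<lambda>_. 0) = dlt u v \<and> (lev v \<le> lev u \<longrightarrow> (\<forall>x. h x = dlt u v)) \<and>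
     (\<forall>e<n. \<forall>x\<in>Rn n. fr e h x = (\<Sum>w\<in>I. g w x * A w v e x))"

lemma transport_cong:
  assumes "v \<in> I" "\<And>w. w \<in> I \<Longrightarrow> lev w < lev v \<Longrightarrow> g w = g' w" "transport u g v h"
  shows "transport u g' v h"
proof -
  have "(\<Sum>w\<in>I. g w x * A w v e x) = (\<Sum>w\<in>I. g' w x * A w v e x)" for x e
  proof (intro sum.cong refl)
    fix w assume "w \<in> I"
    then show "g w x * A w v e x = g' w x * A w v e x"
      using assms(2)[of w] A_zero[OF _ assms(1), of w] by (cases "lev w < lev v") auto
  qed
  then show ?thesis using assms(3) by (simp add: transport_def)
qed

text \<open>The right-hand side for \<open>v\<close> involves entries of lower level only. By the
  product rule and the flatness of \<open>A\<close> it is a closed 1-form, so it has a primitive,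
  which is normalised at the origin.\<close>

lemma transport_exists:
  assumes u: "u \<in> I" and v: "v \<in> I" "admissible u v"
    and g: "\<And>w. w \<in> I \<Longrightarrow> lev w < lev v \<Longrightarrow> transport u g w (g w)"
  shows "\<exists>h. transport u g v h"
proof (cases "lev v \<le> lev u")
  case True
  have "(\<Sum>w\<in>I. g w x * A w v e x) = 0" for x e
  proof (intro sum.neutral ballI)
    fix w assume w: "w \<in> I"
    show "g w x * A w v e x = 0"
    proof (cases "lev w < lev v")
      case True
      then have "g w x = dlt u w" and "u \<noteq> w"
        using g[OF w] \<open>lev v \<le> lev u\<close> by (auto simp: transport_def)
      then show ?thesis by (simp add: dlt_def)
    qed (use A_zero[OF w v(1)] in simp)
  qed
  then have "transport u g v (\<lambda>x. dlt u v)"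
    by (simp add: transport_def smooth_intros fr_def)
  then show ?thesis by blast
next
  case False
  define J where "J = {w \<in> I. lev w < lev v}"
  have finJ: "finite J" unfolding J_def using finite_I by simp
  have J: "w \<in> I" "lev w < lev v" "smooth_Rn n (g w)"
      "\<And>e x. e < n \<Longrightarrow> x \<in> Rn n \<Longrightarrow> fr e (g w) x = (\<Sum>r\<in>I. g r x * A r w e x)" if "w \<in> J" for w
    using that g by (auto simp: J_def transport_def)
  define Q where "Q = (\<lambda>e x. \<Sum>w\<in>J. g w x * A w v e x)"
  have QI: "Q e x = (\<Sum>w\<in>I. g w x * A w v e x)" for e x
    unfolding Q_def by (rule sum.mono_neutral_left) (use finite_I A_zero[OF _ v(1)] in \<open>auto simp: J_def not_less\<close>)
  have Q: "smooth_Rn n (Q e)" if "e < n" for e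
    unfolding Q_def using J A_smooth[OF _ v(1) that] by (intro smooth_intros) auto
  have closed: "fr e (Q f) x - fr f (Q e) x = br Q e f x" if e: "e < n" and f: "1 \<le> f" "f < n" and x: "x \<in> Rn n" for e f x
  proof -
    let ?cur = "\<lambda>w. \<Sum>r\<in>I. A w r e x * A r v f x - A w r f x * A r v e x"
    have D: "fr a (Q b) x = (\<Sum>w\<in>J. (\<Sum>r\<in>I. g r x * A r w a x) * A w v b x + g w x * fr a (A w v b) x)"
      if ab: "a < n" "b < n" for a b
      unfolding Q_def
      by (subst fr_sum_fun[OF ab(1) x], use J A_smooth[OF _ v(1) ab(2)] in \<open>auto intro!: smooth_intros\<close>)
        (intro sum.cong refl, subst fr_mult[OF ab(1) x], use J A_smooth[OF _ v(1) ab(2)] x ab in auto)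
    have S: "g w x * (fr e (A w v f) x - fr f (A w v e) x) = g w x * br (A w v) e f x - g w x * ?cur w" if w: "w \<in> J" for w
    proof (cases "lev w \<noteq> 0 \<or> lev v \<noteq> l")
      case True
      show ?thesis
        unfolding A_flat[OF J(1)[OF w] v(1) J(2)[OF w] True e f x] by (simp add: right_diff_distrib)
    next
      case False
      \<comment> \<open>The one place where flatness is missing: a pair from level \<open>0\<close>
        to level \<open>l\<close>. Admissibility then puts \<open>u\<close> above level
        \<open>0\<close>, so the factor \<open>g w\<close> is 0.\<close>
      then have "lev w < lev u" using v(2) by (auto simp: admissible_def)
      then have "g w x = 0"
        using g[OF J(1,2)[OF w]] by (auto simp: transport_def dlt_def)
      then show ?thesis by simp
    qed
    \<comment> \<open>The quadratic terms coming from \<open>dg = g A\<close> are those of the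
      curvature. Extending both sums to \<open>I\<close> adds only zeros and allows them to be
      exchanged.\<close>
    have T: "(\<Sum>w\<in>J. (\<Sum>r\<in>I. g r x * A r w e x) * A w v f x - (\<Sum>r\<in>I. g r x * A r w f x) * A w v e x) = (\<Sum>w\<in>J. g w x * ?cur w)"
    proof -
      have "(\<Sum>w\<in>J. (\<Sum>r\<in>I. g r x * A r w e x) * A w v f x - (\<Sum>r\<in>I. g r x * A r w f x) * A w v e x) =
          (\<Sum>w\<in>J. \<Sum>r\<in>I. g r x * (A r w e x * A w v f x - A r w f x * A w v e x))"
        by (intro sum.cong refl) (simp add: sum_distrib_right right_diff_distrib sum_subtractf mult.assoc)
      also have "\<dots> = (\<Sum>w\<in>I. \<Sum>r\<in>I. g r x * (A r w e x * A w v f x - A r w f x * A w v e x))"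
        by (rule sum.mono_neutral_left) (use finite_I A_zero[OF _ v(1)] in \<open>auto simp: J_def not_less\<close>)
      also have "\<dots> = (\<Sum>r\<in>I. \<Sum>w\<in>I. g r x * (A r w e x * A w v f x - A r w f x * A w v e x))"
        by (rule sum.swap)
      also have "\<dots> = (\<Sum>r\<in>I. g r x * ?cur r)"
        by (simp add: sum_distrib_left)
      also have "\<dots> = (\<Sum>r\<in>J. g r x * ?cur r)"
      proof (rule sum.mono_neutral_right)
        show "\<forall>r\<in>I - J. g r x * ?cur r = 0"
        proof
          fix r assume r: "r \<in> I - J"
          have zz: "A r w a x * A w v b x = 0" if w: "w \<in> I" for w a b
          proof (cases "lev w \<le> lev r")
            case True
            then show ?thesis using A_zero[of r w] r w by simp
          next
            case False
            then have "lev v \<le> lev w" using r by (auto simp: J_def)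
            then show ?thesis using A_zero[OF w v(1)] by simp
          qed
          have "?cur r = 0" by (intro sum.neutral ballI) (simp only: zz diff_zero)
          then show "g r x * ?cur r = 0" by simp
        qed
      qed (use finite_I in \<open>auto simp: J_def\<close>)
      finally show ?thesis .
    qed
    have "fr e (Q f) x - fr f (Q e) x =
        (\<Sum>w\<in>J. (\<Sum>r\<in>I. g r x * A r w e x) * A w v f x - (\<Sum>r\<in>I. g r x * A r w f x) * A w v e x) +
        (\<Sum>w\<in>J. g w x * (fr e (A w v f) x - fr f (A w v e) x))"
      unfolding D[OF e f(2)] D[OF f(2) e] by (simp add: sum.distrib sum_subtractf right_diff_distrib)
    also have "(\<Sum>w\<in>J. g w x * (fr e (A w v f) x - fr f (A w v e) x)) = (\<Sum>w\<in>J. g w x * br (A w v) e f x - g w x * ?cur w)"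
      by (intro sum.cong refl S)
    also have "(\<Sum>w\<in>J. (\<Sum>r\<in>I. g r x * A r w e x) * A w v f x - (\<Sum>r\<in>I. g r x * A r w f x) * A w v e x) +
        (\<Sum>w\<in>J. g w x * br (A w v) e f x - g w x * ?cur w) = (\<Sum>w\<in>J. g w x * br (A w v) e f x)"
      unfolding T by (simp add: sum_subtractf)
    also have "\<dots> = br Q e f x"
      by (simp add: br_def Q_def)
    finally show ?thesis .
  qed
  obtain G where G: "smooth_Rn n G" "\<And>x e. x \<in> Rn n \<Longrightarrow> e < n \<Longrightarrow> fr e G x = Q e x"
    using frame_Poincare[of Q] Q closed by metis
  let ?h = "\<lambda>x. G x - G (\<lambda>_. 0)"
  have "fr e ?h x = Q e x" if "e < n" "x \<in> Rn n" for e x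
    using fr_diff[OF that G(1) smooth_Rn_const, of "G (\<lambda>_. 0)"] fr_const[OF that] G(2)[OF that(2,1)] by simp
  moreover have "smooth_Rn n ?h" by (intro smooth_intros G(1))
  moreover have "dlt u v = 0" using False by (auto simp: dlt_def)
  ultimately have "transport u g v ?h"
    using False QI by (simp add: transport_def)
  then show ?thesis by blast
qed

text \<open>A single \<open>g\<close> has to solve a coupled system. The system is triangular in the
  levels, so a new level is adjoined without changing the lower ones, which are all that its
  equations involve.\<close>

lemma transport_system:
  assumes u: "u \<in> I"
  shows "\<exists>g. \<forall>v\<in>I. admissible u v \<longrightarrow> transport u g v (g v)"
proof -
  have "\<exists>g. \<forall>v\<in>I. lev v < m \<longrightarrow> admissible u v \<longrightarrow> transport u g v (g v)" for m
  proof (induction m)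
    case (Suc m)
    then obtain g where g: "\<And>v. v \<in> I \<Longrightarrow> lev v < m \<Longrightarrow> admissible u v \<Longrightarrow> transport u g v (g v)"
      by blast
    have "\<exists>h. transport u g v h" if "v \<in> I" "lev v = m" "admissible u v" for v
    proof (rule transport_exists[OF u that(1,3)])
      fix w assume "w \<in> I" "lev w < lev v"
      then show "transport u g w (g w)"
        using lev_le[OF that(1)] that(2) by (intro g) (auto simp: admissible_def)
    qed
    then obtain h where h: "\<And>v. v \<in> I \<Longrightarrow> lev v = m \<Longrightarrow> admissible u v \<Longrightarrow> transport u g v (h v)"
      by metis
    let ?g = "\<lambda>v. if lev v < m then g v else h v"
    have "transport u ?g v (?g v)" if v: "v \<in> I" "lev v < Suc m" "admissible u v" for v
    proof (rule transport_cong[OF v(1), of g])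
      show "transport u g v (?g v)"
        using g[OF v(1) _ v(3)] h[OF v(1) _ v(3)] v(2) by (cases "lev v < m") auto
    qed (use v in auto)
    then show ?case by blast
  qed auto
  from this[of "Suc l"] show ?thesis
    using lev_le by (auto simp: less_Suc_eq_le)
qed

text \<open>The transport from the origin on the universal cover. The value 0 stands in for the
  corner entries, so that sums may run over all of \<open>I\<close>.\<close>

definition G :: "'i \<Rightarrow> 'i \<Rightarrow> (nat \<Rightarrow> real) \<Rightarrow> real" where
  "G u v x = (if admissible u v then (SOME g. \<forall>v\<in>I. admissible u v \<longrightarrow> transport u g v (g v)) v x else 0)"

lemma admissible_less:
  assumes "u \<in> I" "v \<in> I" "lev w < lev v"
  shows "admissible u w"
  using lev_le[OF assms(2)] assms(3) by (auto simp: admissible_def)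

lemma G_not_admissible: "\<not> admissible u v \<Longrightarrow> G u v x = 0"
  by (simp add: G_def)

lemma transport_G:
  assumes u: "u \<in> I" and v: "v \<in> I" "admissible u v"
  shows "transport u (G u) v (G u v)"
proof -
  let ?g = "SOME g. \<forall>v\<in>I. admissible u v \<longrightarrow> transport u g v (g v)"
  have "\<forall>v\<in>I. admissible u v \<longrightarrow> transport u ?g v (?g v)"
    by (rule someI_ex[OF transport_system[OF u]])
  moreover have "G u w = ?g w" if "admissible u w" for w
    using that by (simp add: G_def fun_eq_iff)
  ultimately show ?thesis
    using v admissible_less[OF u v(1)] transport_cong[OF v(1), of ?g "G u" u "G u v"] by auto
qed

lemma
  assumes uv: "u \<in> I" "v \<in> I"
  shows G_smooth: "smooth_Rn n (G u v)" and G_0: "G u v (\<lambda>_. 0) = dlt u v"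
    and G_low: "lev v \<le> lev u \<Longrightarrow> G u v x = dlt u v"
proof -
  have na: "lev u < lev v" "G u v = (\<lambda>x. 0)" if "\<not> admissible u v"
    using that l_pos G_not_admissible[OF that] by (auto simp: admissible_def)
  show "smooth_Rn n (G u v)" "G u v (\<lambda>_. 0) = dlt u v"
    using transport_G[OF uv] na by (cases "admissible u v"; force simp: transport_def dlt_def smooth_intros)+
  show "G u v x = dlt u v" if "lev v \<le> lev u"
    using transport_G[OF uv] na that by (cases "admissible u v"; force simp: transport_def)
qed

lemma G_fr:
  assumes "u \<in> I" "v \<in> I" "admissible u v" "e < n" "x \<in> Rn n"
  shows "fr e (G u v) x = (\<Sum>w\<in>I. G u w x * A w v e x)"
  using transport_G[OF assms(1-3)] assms(4,5) by (simp add: transport_def)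

text \<open>Since \<open>A\<close> is invariant, both sides solve the same linear system in
  \<open>x\<close>, and they agree at the origin; induction on the level of \<open>v\<close> gives
  equality. The values of \<open>G\<close> on the orbit of the origin thus form the
  holonomy.\<close>

lemma holonomy:
  assumes u: "u \<in> I" and v: "v \<in> I" "admissible u v" and x: "x \<in> Rn n"
    and sw: "lat s" "\<And>i. 1 \<le> i \<Longrightarrow> i < n \<Longrightarrow> w i \<in> \<int>"
  shows "G u v (act s w x) = (\<Sum>r\<in>I. G u r (act s w (\<lambda>_. 0)) * G r v x)"
  using v x
proof (induction "lev v" arbitrary: v x rule: less_induct)
  case less
  let ?\<rho> = "\<lambda>r. G u r (act s w (\<lambda>_. 0))"
  let ?H = "\<lambda>x. G u v (act s w x) - (\<Sum>r\<in>I. ?\<rho> r * G r v x)"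
  have z: "(\<lambda>_. 0) \<in> Rn n" by (simp add: Rn_def)
  have sm1: "smooth_Rn n (\<lambda>x. G u v (act s w x))"
    by (rule smooth_Rn_compose_act[OF G_smooth[OF u less.prems(1)]])
  have sm2: "smooth_Rn n (\<lambda>x. ?\<rho> r * G r v x)" if "r \<in> I" for r
    by (intro smooth_intros G_smooth that less.prems)
  have sm3: "smooth_Rn n (\<lambda>x. \<Sum>r\<in>I. ?\<rho> r * G r v x)"
    by (rule smooth_Rn_sum) (rule sm2)
  have "?H y = ?H (\<lambda>_. 0)" if y: "y \<in> Rn n" for y
  proof (rule fr_zero_const[OF _ _ y])
    show "smooth_Rn n ?H" by (rule smooth_Rn_diff[OF sm1 sm3])
    fix e y assume e: "e < n" and y: "y \<in> Rn n"
    have fr_term: "fr e (\<lambda>x. ?\<rho> r * G r v x) y = (\<Sum>w'\<in>I. ?\<rho> r * (G r w' y * A w' v e y))" if r: "r \<in> I" for r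
    proof -
      have "fr e (\<lambda>x. ?\<rho> r * G r v x) y = ?\<rho> r * fr e (G r v) y"
        using fr_mult[OF e y smooth_Rn_const G_smooth[OF r less.prems(1)], of "?\<rho> r"] fr_const[OF e y] by simp
      also have "\<dots> = ?\<rho> r * (\<Sum>w'\<in>I. G r w' y * A w' v e y)"
      proof (cases "admissible r v")
        case False
        \<comment> \<open>A missing corner entry is multiplied by \<open>?\<rho> r\<close>, which is
          0 because \<open>r\<close> differs from \<open>u\<close> and is not above it.\<close>
        then have "lev r \<le> lev u" "r \<noteq> u"
          using less.prems by (auto simp: admissible_def)
        then show ?thesis using G_low[OF u r] by (simp add: dlt_def)
      qed (simp add: G_fr[OF r less.prems(1) _ e y])
      finally show ?thesis by (simp add: sum_distrib_left)
    qed
    have "fr e ?H y = fr e (G u v) (act s w y) - (\<Sum>r\<in>I. \<Sum>w'\<in>I. ?\<rho> r * (G r w' y * A w' v e y))"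
    proof -
      have "fr e (\<lambda>x. \<Sum>r\<in>I. ?\<rho> r * G r v x) y = (\<Sum>r\<in>I. fr e (\<lambda>x. ?\<rho> r * G r v x) y)"
        by (rule fr_sum_fun[OF e y]) (rule sm2)
      then show ?thesis
        unfolding fr_diff[OF e y sm1 sm3] fr_act[OF G_smooth[OF u less.prems(1)] y e] by (simp add: fr_term)
    qed
    also have "fr e (G u v) (act s w y) = (\<Sum>w'\<in>I. G u w' (act s w y) * A w' v e y)"
    proof -
      have "A w' v e (act s w y) = A w' v e y" if "w' \<in> I" for w'
        using A_inv[OF that less.prems(1) e, unfolded invariant_def, rule_format, OF rel_act[OF y sw]] by simp
      then show ?thesis
        unfolding G_fr[OF u less.prems(1,2) e act_Rn] by simp
    qed
    also have "(\<Sum>r\<in>I. \<Sum>w'\<in>I. ?\<rho> r * (G r w' y * A w' v e y)) = (\<Sum>w'\<in>I. (\<Sum>r\<in>I. ?\<rho> r * G r w' y) * A w' v e y)"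
      by (subst sum.swap) (simp add: sum_distrib_right mult.assoc)
    also have "\<dots> = (\<Sum>w'\<in>I. G u w' (act s w y) * A w' v e y)"
    proof (intro sum.cong refl)
      fix w' assume w': "w' \<in> I"
      show "(\<Sum>r\<in>I. ?\<rho> r * G r w' y) * A w' v e y = G u w' (act s w y) * A w' v e y"
      proof (cases "lev w' < lev v")
        case True
        then show ?thesis
          using less.hyps[OF True w' admissible_less[OF u less.prems(1) True] y] by simp
      qed (use A_zero[OF w' less.prems(1)] in simp)
    qed
    finally show "fr e ?H y = 0" by simp
  qed
  moreover have "(\<Sum>r\<in>I. ?\<rho> r * G r v (\<lambda>_. 0)) = ?\<rho> v"
  proof -
    have "(\<Sum>r\<in>I. ?\<rho> r * G r v (\<lambda>_. 0)) = (\<Sum>r\<in>I. if r = v then ?\<rho> v else 0)"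
      by (intro sum.cong refl) (simp add: G_0 less.prems dlt_def)
    then show ?thesis using finite_I less.prems by simp
  qed
  ultimately show ?case using less.prems(3) by simp
qed

end

section \<open>Relations among the deck transformations\<close>

context filiform
begin

text \<open>The image of the origin under the translation by \<open>a\<close>: at this point
  \<open>G\<close> has the holonomy of the translation as its value.\<close>

definition pv :: "(nat \<Rightarrow> real) \<Rightarrow> nat \<Rightarrow> real" where
  "pv a = act 0 a (\<lambda>_. 0)"

lemma pv_eq: "pv a i = (if 1 \<le> i \<and> i < n then a i else 0)"
  by (simp add: pv_def act_def flow_def)

lemma act_pv: "act 0 a (pv b) = pv (\<lambda>i. a i + b i)"
  by (auto simp: fun_eq_iff pv_eq act_def flow_0)

text \<open>The conjugation relation of the deck group: shifting time by \<open>per\<close> after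
  translating by \<open>b\<close> is translating by \<open>flow per b\<close> after shifting. Both
  sides are evaluated at the origin.\<close>

lemma act_per_pv: "act per (\<lambda>_. 0) (pv b) = act 0 (flow per b) (act per (\<lambda>_. 0) (\<lambda>_. 0))"
proof
  fix i
  have "flow per (pv b) i = flow per b i" if "i < n"
    by (rule flow_cong) (use that in \<open>simp add: pv_eq\<close>)
  moreover have "flow 0 (act per (\<lambda>_. 0) (\<lambda>_. 0)) i = 0" if "i < n" "i \<noteq> 0"
    using that by (simp add: flow_0) (simp add: act_def flow_def)
  ultimately show "act per (\<lambda>_. 0) (pv b) i = act 0 (flow per b) (act per (\<lambda>_. 0) (\<lambda>_. 0)) i"
    by (cases "i = 0") (auto simp: act_def pv_eq)
qed

text \<open>Filtration of the integral translations by support; it takes the place of the lower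
  central series.\<close>

definition intv :: "(nat \<Rightarrow> real) \<Rightarrow> nat \<Rightarrow> bool" where
  "intv a k \<longleftrightarrow> (\<forall>i. 1 \<le> i \<and> i < n \<longrightarrow> a i \<in> \<int> \<and> (i < k \<longrightarrow> a i = 0))"

lemma intv_add: "intv a k \<Longrightarrow> intv b k \<Longrightarrow> intv (\<lambda>i. a i + b i) k"
  and intv_mult: "intv a k \<Longrightarrow> intv (\<lambda>i. real m * a i) k"
  and intv_mono: "intv a k' \<Longrightarrow> k \<le> k' \<Longrightarrow> intv a k"
  by (auto simp: intv_def)

lemma intv_flow:
  assumes "intv b k" "1 \<le> k"
  shows "intv (flow per b) k"
  unfolding intv_def
proof (intro allI impI conjI)
  fix i assume i: "1 \<le> i \<and> i < n"
  show "flow per b i \<in> \<int>"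
    by (rule flow_Ints[OF lat_per]) (use assms i in \<open>auto simp: intv_def\<close>)
  show "flow per b i = 0" if "i < k"
    unfolding flow_def by (rule sum.neutral) (use assms i that in \<open>auto simp: intv_def\<close>)
qed

text \<open>
  Every integral vector \<open>per a\<close> supported from index \<open>m\<close> on is, up to vectors supported from \<open>m + 1\<close> on, the
  commutator of the first generator with the shift of \<open>a\<close>.
\<close>

lemma flow_shift:
  assumes a: "intv a m" and m: "2 \<le> m" and R: "R = (\<lambda>i. flow per (\<lambda>j. a (Suc j) * of_bool (Suc j < n)) i - a (Suc i) * of_bool (Suc i < n) - per * a i)"
  shows "intv R (Suc m)" "intv (\<lambda>j. a (Suc j) * of_bool (Suc j < n)) (m - 1)"
proof -
  let ?b = "\<lambda>j. a (Suc j) * of_bool (Suc j < n)"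
  show b: "intv ?b (m - 1)"
    using a m by (auto simp: intv_def)
  show "intv R (Suc m)"
    unfolding intv_def
  proof (intro allI impI conjI)
    fix i assume i: "1 \<le> i \<and> i < n"
    have f1: "flow per ?b i \<in> \<int>"
      using intv_flow[OF b] m i by (auto simp: intv_def)
    have f2: "?b i \<in> \<int>" and f3: "a i \<in> \<int>"
      using a b i by (auto simp: intv_def)
    have f4: "per \<in> \<int>"
      unfolding per_def by (rule fact_in_Ints)
    show "R i \<in> \<int>"
      unfolding R by (rule Ints_diff[OF Ints_diff[OF f1 f2] Ints_mult[OF f4 f3]])
    show "R i = 0" if "i < Suc m"
    proof -
      have "flow per ?b i = (\<Sum>j\<in>{i - 1, i} \<inter> {1..i}. pw per (i - j) * ?b j)"
        unfolding flow_def
      proof (rule sum.mono_neutral_right)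
        show "\<forall>j\<in>{1..i} - {i - 1, i} \<inter> {1..i}. pw per (i - j) * ?b j = 0"
        proof
          fix j assume "j \<in> {1..i} - {i - 1, i} \<inter> {1..i}"
          then have "1 \<le> j" "j < m - 1" "j < n" using that i by auto
          then show "pw per (i - j) * ?b j = 0" using b by (auto simp: intv_def)
        qed
      qed auto
      also have "\<dots> = ?b i + per * a i"
      proof (cases "i = 1")
        case True
        then show ?thesis using a m i by (auto simp: intv_def)
      next
        case False
        then obtain j where j: "i = Suc j" "1 \<le> j" using i by (cases i) auto
        have "{j, Suc j} \<inter> {1..Suc j} = {j, Suc j}" using j by auto
        then show ?thesis using i j by (simp add: pw_1)
      qed
      finally show ?thesis by (simp add: R)
    qed
  qed
qed

end

context flat_system
begin

text \<open>An entry of a product of unipotent matrices. If the intermediate terms vanish, only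
  \<open>r = u\<close> and \<open>r = v\<close> are left, so this entry is additive.\<close>

lemma sum_two:
  assumes uv: "u \<in> I" "v \<in> I" "lev u < lev v"
    and mid: "\<And>r. r \<in> I \<Longrightarrow> lev u < lev r \<Longrightarrow> lev r < lev v \<Longrightarrow> G u r p = 0 \<or> G r v q = 0"
  shows "(\<Sum>r\<in>I. G u r p * G r v q) = G u v p + G u v q"
proof -
  have "(\<Sum>r\<in>I. G u r p * G r v q) = (\<Sum>r\<in>I. (if r = u then G u v q else 0) + (if r = v then G u v p else 0))"
  proof (intro sum.cong refl)
    fix r assume r: "r \<in> I"
    consider "r = u" | "r = v" | "r \<noteq> u" "lev r \<le> lev u" | "r \<noteq> v" "lev v \<le> lev r" | "lev u < lev r" "lev r < lev v"
      by linarith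
    then show "G u r p * G r v q = (if r = u then G u v q else 0) + (if r = v then G u v p else 0)"
    proof cases
      case 1
      then show ?thesis using uv G_low[OF uv(1,1)] by (auto simp: dlt_def)
    next
      case 2
      then show ?thesis using uv G_low[OF uv(2,2)] by (auto simp: dlt_def)
    next
      case 3
      then show ?thesis using uv G_low[OF uv(1) r] by (auto simp: dlt_def)
    next
      case 4
      then show ?thesis using uv G_low[OF r uv(2)] by (auto simp: dlt_def)
    next
      case 5
      then show ?thesis using mid[OF r] by auto
    qed
  qed
  then show ?thesis
    using finite_I uv by (simp add: sum.distrib)
qed

text \<open>
  Up to a translation supported from a larger index on, \<open>per\<close> times a translation supported from index \<open>m + 1\<close>
  on is the commutator of the first generator with one supported from \<open>m\<close> on. The transport along the latter
  is trivial between levels that differ by less than \<open>m\<close>, hence between levels that differ by \<open>m\<close> it is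
  unchanged by the conjugation.
\<close>

lemma transport_deep:
  assumes "u \<in> I" "v \<in> I" "admissible u v" "lev v \<le> lev u + d" "intv a (Suc d)"
  shows "G u v (pv a) = dlt u v"
  using assms
proof (induction d arbitrary: u v a)
  case 0
  then show ?case using G_low[OF 0(1,2)] by simp
next
  case (Suc d)
  show ?case
  proof (cases "lev v \<le> lev u + d")
    case True
    then show ?thesis
      using Suc.IH[OF Suc.prems(1-3) True] intv_mono[OF Suc.prems(5)] by simp
  next
    case False
    note uv = Suc.prems(1,2)
    have lt: "lev u < lev v" using False by simp
    have lvl: "lev v = lev u + Suc d" using False Suc.prems(4) by simp
    define h where "h a = G u v (pv a)" for a
    have mid1: "G u r (pv a) = 0" if "r \<in> I" "lev u < lev r" "lev r < lev v" "intv a (Suc d)" for r a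
    proof -
      have "G u r (pv a) = dlt u r"
        using that lvl by (intro Suc.IH uv admissible_less[OF uv that(3)]) auto
      then show ?thesis using that by (auto simp: dlt_def)
    qed
    have mid2: "G r v (pv a) = 0" if "r \<in> I" "lev u < lev r" "lev r < lev v" "intv a (Suc d)" for r a
    proof -
      have "G r v (pv a) = dlt r v"
        using that lvl by (intro Suc.IH uv) (auto simp: admissible_def)
      then show ?thesis using that by (auto simp: dlt_def)
    qed
    have int: "a i \<in> \<int>" if "intv a k" "1 \<le> i" "i < n" for a k i
      using that by (auto simp: intv_def)
    have add: "h (\<lambda>i. a i + b i) = h a + h b" if a: "intv a (Suc d)" and b: "intv b (Suc d)" for a b
    proof -
      have "h (\<lambda>i. a i + b i) = (\<Sum>r\<in>I. G u r (pv a) * G r v (pv b))"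
        unfolding h_def act_pv[symmetric]
        by (subst holonomy[OF Suc.prems(1-3) _ lat_0]) (use int[OF a] in \<open>auto simp: pv_def\<close>)
      also have "\<dots> = h a + h b"
        unfolding h_def by (rule sum_two[OF uv lt]) (use mid1 a in blast)
      finally show ?thesis .
    qed
    \<comment> \<open>The holonomy of both sides of the conjugation relation; the term of the time
      shift is common and cancels.\<close>
    have conj: "h (flow per b) = h b" if b: "intv b (Suc d)" for b
    proof -
      let ?S = "act per (\<lambda>_. 0) (\<lambda>_. 0)"
      have fb: "intv (flow per b) (Suc d)" by (rule intv_flow[OF b]) simp
      have "G u v (act per (\<lambda>_. 0) (pv b)) = (\<Sum>r\<in>I. G u r ?S * G r v (pv b))"
        by (rule holonomy[OF Suc.prems(1-3) _ lat_per]) (auto simp: pv_def)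
      also have "\<dots> = G u v ?S + h b"
        unfolding h_def by (rule sum_two[OF uv lt]) (use mid2 b in blast)
      finally have 1: "G u v (act per (\<lambda>_. 0) (pv b)) = G u v ?S + h b" .
      have "G u v (act 0 (flow per b) ?S) = (\<Sum>r\<in>I. G u r (pv (flow per b)) * G r v ?S)"
        unfolding pv_def by (rule holonomy[OF Suc.prems(1-3) _ lat_0]) (use int[OF fb] in auto)
      also have "\<dots> = h (flow per b) + G u v ?S"
        unfolding h_def by (rule sum_two[OF uv lt]) (use mid1 fb in blast)
      finally show ?thesis using 1 by (simp add: act_per_pv)
    qed
    have zero: "h a = 0" if "\<And>i. 1 \<le> i \<Longrightarrow> i < n \<Longrightarrow> a i = 0" for a
    proof -
      have "pv a = (\<lambda>_. 0)" using that by (auto simp: pv_eq)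
      then show ?thesis
        using G_0[OF uv] lt by (auto simp: h_def dlt_def)
    qed
    have mult: "h (\<lambda>i. real k * a i) = real k * h a" if a: "intv a (Suc d)" for k a
    proof (induction k)
      case (Suc k)
      then show ?case
        using add[OF a intv_mult[OF a], of k] by (simp add: algebra_simps)
    qed (simp add: zero)
    \<comment> \<open>Downward induction on the support: the remainder \<open>R\<close> is supported
      from a larger index on, so \<open>h\<close> already vanishes on it. Vectors supported from
      \<open>n\<close> on are trivial.\<close>
    have "h a = 0" if "intv a m" "Suc (Suc d) \<le> m" for m a
      using that
    proof (induction "n - m" arbitrary: m a)
      case 0
      then show ?case by (intro zero) (auto simp: intv_def)
    next
      case (Suc j)
      define b where "b = (\<lambda>j. a (Suc j) * of_bool (Suc j < n))"
      define R where "R = (\<lambda>i. flow per b i - b i - per * a i)"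
      have m: "2 \<le> m" using Suc.prems by simp
      have R: "intv R (Suc m)" and b: "intv b (m - 1)"
        using flow_shift[OF Suc.prems(1) m R_def[unfolded b_def]] by (simp_all add: b_def)
      have R0: "h R = 0" by (rule Suc.hyps(1)[OF _ R]) (use Suc in auto)
      have b': "intv b (Suc d)" and R': "intv R (Suc d)" and a': "intv a (Suc d)"
        using intv_mono[OF b] intv_mono[OF R] intv_mono[OF Suc.prems(1)] Suc.prems(2) by simp_all
      have pa: "intv (\<lambda>i. per * a i) (Suc d)" and hpa: "h (\<lambda>i. per * a i) = per * h a"
        using intv_mult[OF a', of "fact n"] mult[OF a', of "fact n"] by (simp_all add: per_def)
      have "h (flow per b) = h (\<lambda>i. b i + (per * a i + R i))"
        by (rule arg_cong[where f=h]) (simp add: R_def fun_eq_iff)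
      also have "\<dots> = h b + (per * h a + h R)"
        by (simp add: add b' R' pa intv_add hpa)
      finally have "per * h a = 0" using conj[OF b'] R0 by simp
      \<comment> \<open>Here torsion-freeness is used: the values of \<open>h\<close> are real, so
        the factor \<open>per\<close> can be divided out.\<close>
      then show ?case using per_pos by simp
    qed
    from this[OF Suc.prems(5)] have "h a = 0" by simp
    then show ?thesis using lt by (auto simp: h_def dlt_def)
  qed
qed

text \<open>The central vector is supported from \<open>n - 1\<close> on, and admissible pairs
  differ by at most \<open>l - 1 \<le> n - 2\<close> levels, so its holonomy is trivial. Here
  \<open>l < n\<close> is used.\<close>

lemma transport_central:
  assumes u: "u \<in> I" and v: "v \<in> I" "admissible u v" and x: "x \<in> Rn n"
  shows "G u v (act 0 (\<lambda>i. of_bool (i = n - 1)) x) = G u v x"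
proof -
  let ?z = "\<lambda>i. of_bool (i = n - 1) :: real"
  have z: "intv ?z (Suc (n - 2))" using two_le_n by (auto simp: intv_def)
  have "G u v (act 0 ?z x) = (\<Sum>r\<in>I. G u r (pv ?z) * G r v x)"
    unfolding pv_def by (rule holonomy[OF assms lat_0]) simp
  also have "\<dots> = (\<Sum>r\<in>I. dlt u r * G r v x)"
  proof (intro sum.cong refl)
    fix r assume r: "r \<in> I"
    show "G u r (pv ?z) * G r v x = dlt u r * G r v x"
    proof (cases "admissible u r")
      case True
      have "lev r \<le> lev u + (n - 2)"
        using True lev_le[OF r] l_less by (cases "lev u = 0") (auto simp: admissible_def)
      then show ?thesis
        using transport_deep[OF u r True _ z] by simp
    next
      case False
      \<comment> \<open>The undefined holonomy entry from \<open>u\<close> to \<open>r\<close> meets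
        a factor from level \<open>l\<close> down to a lower level, which is 0.\<close>
      then have "lev r = l" "lev u = 0" "lev v < l"
        using v lev_le[OF v(1)] by (auto simp: admissible_def)
      then have "G r v x = 0" using G_low[OF r v(1)] by (auto simp: dlt_def)
      then show ?thesis by simp
    qed
  qed
  also have "\<dots> = (\<Sum>r\<in>I. if r = u then G u v x else 0)"
    by (intro sum.cong refl) (auto simp: dlt_def)
  finally show ?thesis using u finite_I by simp
qed

end

section \<open>Integration over the 2-torus\<close>

context filiform
begin

text \<open>The plane of the first and the last coordinate. The rectangle
  \<open>[0, per] \<times> [0, 1]\<close> in it covers the torus: the flow fixes the last unit
  vector, so \<open>line_per\<close> and \<open>line_central\<close> identify opposite sides by deck
  transformations.\<close>

definition line :: "real \<Rightarrow> real \<Rightarrow> nat \<Rightarrow> real" where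
  "line t s = (\<lambda>i. if i = 0 then t else if i = n - 1 then s else 0)"

lemma line_Rn: "line t s \<in> Rn n"
  using two_le_n by (simp add: line_def Rn_def)

lemma n1: "n - 1 < n" "0 < n" "n - 1 \<noteq> 0"
  using two_le_n by auto

lemma continuous_on_line:
  assumes "smooth_Rn n F" "continuous_on S f" "continuous_on S g"
  shows "continuous_on S (\<lambda>z. F (line (f z) (g z)))"
proof (rule continuous_on_Rn_compose[OF smooth_Rn_continuous[OF assms(1)], where a="\<lambda>z. line (f z) (g z)"])
  fix i show "continuous_on S (\<lambda>z. line (f z) (g z) i)"
    unfolding line_def by (cases "i = 0"; cases "i = n - 1") (use assms in auto)
qed (rule line_Rn)

lemma integral_line:
  assumes F: "smooth_Rn n F"
  shows "integral {0..1} (\<lambda>s. partial_deriv (n - 1) F (line t s)) = F (line t 1) - F (line t 0)"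
proof (rule integral_unique, rule fundamental_theorem_of_calculus)
  fix s
  have "((\<lambda>s'. F ((line t s)(n - 1 := s'))) has_real_derivative partial_deriv (n - 1) F (line t s)) (at (line t s (n - 1)))"
    by (rule smooth_Rn_deriv[OF F line_Rn n1(1)])
  moreover have "(line t s)(n - 1 := s') = line t s'" for s'
    using n1 by (auto simp: line_def)
  moreover have "line t s (n - 1) = s" using n1 by (simp add: line_def)
  ultimately have "((\<lambda>s. F (line t s)) has_real_derivative partial_deriv (n - 1) F (line t s)) (at s)"
    by (simp only:)
  then show "((\<lambda>s. F (line t s)) has_vector_derivative partial_deriv (n - 1) F (line t s)) (at s within {0..1})"
    by (rule has_vector_derivative_at_within[OF has_real_derivative_iff_has_vector_derivative[THEN iffD1]])
qed simp

lemma integral_line_0: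
  assumes F: "smooth_Rn n F"
  shows "integral {0..per} (\<lambda>t. partial_deriv 0 F (line t s)) = F (line per s) - F (line 0 s)"
proof (rule integral_unique, rule fundamental_theorem_of_calculus)
  show "0 \<le> per" using per_pos by simp
  fix t
  have "((\<lambda>t'. F ((line t s)(0 := t'))) has_real_derivative partial_deriv 0 F (line t s)) (at (line t s 0))"
    by (rule smooth_Rn_deriv[OF F line_Rn n1(2)])
  moreover have "(line t s)(0 := t') = line t' s" for t'
    by (auto simp: line_def)
  moreover have "line t s 0 = t" by (simp add: line_def)
  ultimately have "((\<lambda>t. F (line t s)) has_real_derivative partial_deriv 0 F (line t s)) (at t)"
    by (simp only:)
  then show "((\<lambda>t. F (line t s)) has_vector_derivative partial_deriv 0 F (line t s)) (at t within {0..per})"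
    by (rule has_vector_derivative_at_within[OF has_real_derivative_iff_has_vector_derivative[THEN iffD1]])
qed

definition torus_integral :: "((nat \<Rightarrow> real) \<Rightarrow> real) \<Rightarrow> real" where
  "torus_integral F = integral {0..per} (\<lambda>t. integral {0..1} (\<lambda>s. F (line t s)))"

lemma integrable_line:
  assumes "smooth_Rn n F"
  shows "(\<lambda>s. F (line t s)) integrable_on {0..1}" "(\<lambda>t. F (line t s)) integrable_on {0..per}"
    "(\<lambda>t. integral {0..1} (\<lambda>s. F (line t s))) integrable_on {0..per}"
proof -
  show "(\<lambda>s. F (line t s)) integrable_on {0..1}" "(\<lambda>t. F (line t s)) integrable_on {0..per}"
    by (rule integrable_continuous_real, rule continuous_on_line[OF assms]; intro continuous_intros)+
  have "continuous_on {0..per} (\<lambda>t. integral (cbox 0 1) (\<lambda>s. F (line t s)))"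
    by (rule integral_continuous_on_param)
      (unfold case_prod_beta, rule continuous_on_line[OF assms]; intro continuous_intros)
  then show "(\<lambda>t. integral {0..1} (\<lambda>s. F (line t s))) integrable_on {0..per}"
    by (intro integrable_continuous_real) simp
qed

lemma torus_integral_diff:
  assumes "smooth_Rn n F" "smooth_Rn n H"
  shows "torus_integral (\<lambda>x. F x - H x) = torus_integral F - torus_integral H"
  unfolding torus_integral_def by (simp add: integral_diff integrable_line assms)

lemma torus_integral_add:
  assumes "smooth_Rn n F" "smooth_Rn n H"
  shows "torus_integral (\<lambda>x. F x + H x) = torus_integral F + torus_integral H"
  unfolding torus_integral_def by (simp add: integral_add integrable_line assms)

lemma torus_integral_mult: "torus_integral (\<lambda>x. c * F x) = c * torus_integral F"
  unfolding torus_integral_def by simp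

lemma torus_integral_const: "torus_integral (\<lambda>x. c) = per * c"
  unfolding torus_integral_def using per_pos by simp

lemma torus_integral_partial_last:
  assumes "smooth_Rn n F"
  shows "torus_integral (partial_deriv (n - 1) F) = integral {0..per} (\<lambda>t. F (line t 1) - F (line t 0))"
  unfolding torus_integral_def integral_line[OF assms] ..

lemma torus_integral_partial_0:
  assumes F: "smooth_Rn n F"
  shows "torus_integral (partial_deriv 0 F) = integral {0..1} (\<lambda>s. F (line per s) - F (line 0 s))"
proof -
  let ?f = "\<lambda>(t, s). partial_deriv 0 F (line t s)"
  have "continuous_on (cbox (0, 0) (per, 1)) ?f"
    unfolding case_prod_beta
    by (rule continuous_on_line[OF smooth_Rn_partial[OF F n1(2)]]) (intro continuous_intros)+
  from integral_swap_continuous[OF this]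
  have "torus_integral (partial_deriv 0 F) = integral {0..1} (\<lambda>s. integral {0..per} (\<lambda>t. partial_deriv 0 F (line t s)))"
    by (simp add: torus_integral_def)
  then show ?thesis unfolding integral_line_0[OF F] .
qed

lemma fr_last: "fr (n - 1) F x = partial_deriv (n - 1) F x"
  using n1 by (simp add: fr_def)

lemma line_central: "line t 1 = act 0 (\<lambda>i. of_bool (i = n - 1)) (line t 0)"
proof
  fix i
  have "flow 0 (line t 0) i = line t 0 i" if "i \<noteq> 0" using that by (simp add: flow_0)
  then show "line t 1 i = act 0 (\<lambda>i. of_bool (i = n - 1)) (line t 0) i"
    using n1 by (auto simp: act_def line_def)
qed

lemma line_per: "line per s = act per (\<lambda>_. 0) (line 0 s)"
proof
  fix i
  have "flow per (line 0 s) i = line 0 s i" if "i \<noteq> 0" "i < n"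
  proof -
    have "flow per (line 0 s) i = (\<Sum>l=1..i. if l = i then line 0 s i else 0)"
      unfolding flow_def by (intro sum.cong refl) (use that in \<open>auto simp: line_def\<close>)
    then show ?thesis using that by simp
  qed
  then show "line per s i = act per (\<lambda>_. 0) (line 0 s) i"
    using n1 by (auto simp: act_def line_def)
qed

end

section \<open>Vanishing of the corner integral\<close>

context flat_system
begin

text \<open>The integrand is \<open>d \<beta>\<close> evaluated on \<open>fld 0\<close> and
  \<open>fld (n - 1)\<close>, with the 1-form \<open>\<beta>\<close> on the universal cover built
  from transport and connection. It is not invariant, so boundary terms remain. Opposite sides in
  the central direction agree by \<open>transport_central\<close>. In direction 0 they differ by a
  combination of derivatives of \<open>G r v\<close> along the central circle, whose integrals are 0
  by \<open>transport_central\<close> again.\<close>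

lemma corner_integral:
  assumes u: "u \<in> I" "lev u = 0" and v: "v \<in> I" "lev v = l"
  shows "torus_integral (\<lambda>x. \<Sum>w\<in>I. A u w 0 x * A w v (n - 1) x - A u w (n - 1) x * A w v 0 x) = 0"
proof -
  \<comment> \<open>Intermediate levels only: the term for \<open>w = u\<close> would be the corner
    entry itself, for which no equation is available.\<close>
  define K where "K = {w \<in> I. 0 < lev w \<and> lev w < l}"
  have K: "w \<in> I" "0 < lev w" "lev w < l" "admissible u w" "admissible w v" if "w \<in> K" for w
    using that by (auto simp: K_def admissible_def)
  have K_sub: "K \<subseteq> I" by (auto simp: K_def)
  define \<beta> where "\<beta> = (\<lambda>e x. \<Sum>w\<in>K. G u w x * A w v e x)"
  have \<beta>: "smooth_Rn n (\<beta> e)" if "e < n" for e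
    unfolding \<beta>_def by (intro smooth_intros G_smooth[OF u(1)] A_smooth[OF _ v(1) that]) (use K in auto)
  let ?cur = "\<lambda>w x. \<Sum>r\<in>I. A w r 0 x * A r v (n - 1) x - A w r (n - 1) x * A r v 0 x"
  have d\<beta>: "?cur u x = fr 0 (\<beta> (n - 1)) x - fr (n - 1) (\<beta> 0) x" if x: "x \<in> Rn n" for x
  proof -
    have D: "fr a (\<beta> b) x = (\<Sum>w\<in>K. (\<Sum>r\<in>I. G u r x * A r w a x) * A w v b x + G u w x * fr a (A w v b) x)"
      if ab: "a < n" "b < n" for a b
    proof -
      have "fr a (\<beta> b) x = (\<Sum>w\<in>K. fr a (\<lambda>x. G u w x * A w v b x) x)"
        unfolding \<beta>_def
        by (rule fr_sum_fun[OF ab(1) x]) (intro smooth_intros G_smooth[OF u(1)] A_smooth[OF _ v(1) ab(2)] K)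
      also have "\<dots> = (\<Sum>w\<in>K. (\<Sum>r\<in>I. G u r x * A r w a x) * A w v b x + G u w x * fr a (A w v b) x)"
      proof (intro sum.cong refl)
        fix w assume w: "w \<in> K"
        show "fr a (\<lambda>x. G u w x * A w v b x) x = (\<Sum>r\<in>I. G u r x * A r w a x) * A w v b x + G u w x * fr a (A w v b) x"
          unfolding fr_mult[OF ab(1) x G_smooth[OF u(1) K(1)[OF w]] A_smooth[OF K(1)[OF w] v(1) ab(2)]]
            G_fr[OF u(1) K(1,4)[OF w] ab(1) x] ..
      qed
      finally show ?thesis .
    qed
    have S: "G u w x * (fr 0 (A w v (n - 1)) x - fr (n - 1) (A w v 0) x) = - (G u w x * ?cur w x)" if w: "w \<in> K" for w
    proof -
      have "br (A w v) 0 (n - 1) x = 0" using n1 by (simp add: br_def)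
      moreover have "fr 0 (A w v (n - 1)) x - fr (n - 1) (A w v 0) x = br (A w v) 0 (n - 1) x - ?cur w x"
        by (rule A_flat) (use K[OF w] v n1 x in auto)
      ultimately show ?thesis by simp
    qed
    have T: "(\<Sum>w\<in>K. (\<Sum>r\<in>I. G u r x * A r w 0 x) * A w v (n - 1) x - (\<Sum>r\<in>I. G u r x * A r w (n - 1) x) * A w v 0 x)
        = ?cur u x + (\<Sum>w\<in>K. G u w x * ?cur w x)"
    proof -
      have "(\<Sum>w\<in>K. (\<Sum>r\<in>I. G u r x * A r w 0 x) * A w v (n - 1) x - (\<Sum>r\<in>I. G u r x * A r w (n - 1) x) * A w v 0 x) =
          (\<Sum>w\<in>K. \<Sum>r\<in>I. G u r x * (A r w 0 x * A w v (n - 1) x - A r w (n - 1) x * A w v 0 x))"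
        by (intro sum.cong refl) (simp add: sum_distrib_right right_diff_distrib sum_subtractf mult.assoc)
      also have "\<dots> = (\<Sum>w\<in>I. \<Sum>r\<in>I. G u r x * (A r w 0 x * A w v (n - 1) x - A r w (n - 1) x * A w v 0 x))"
      proof (rule sum.mono_neutral_left[OF finite_I K_sub])
        show "\<forall>w\<in>I - K. (\<Sum>r\<in>I. G u r x * (A r w 0 x * A w v (n - 1) x - A r w (n - 1) x * A w v 0 x)) = 0"
        proof (intro ballI sum.neutral)
          fix w r assume w: "w \<in> I - K" and r: "r \<in> I"
          then consider "lev w = 0" | "lev w = l" using lev_le[of w] by (auto simp: K_def)
          then show "G u r x * (A r w 0 x * A w v (n - 1) x - A r w (n - 1) x * A w v 0 x) = 0"
            by cases (use w r v A_zero[of r w] A_zero[of w v] in auto)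
        qed
      qed
      also have "\<dots> = (\<Sum>r\<in>I. \<Sum>w\<in>I. G u r x * (A r w 0 x * A w v (n - 1) x - A r w (n - 1) x * A w v 0 x))"
        by (rule sum.swap)
      also have "\<dots> = (\<Sum>r\<in>I. G u r x * ?cur r x)"
        by (simp add: sum_distrib_left)
      also have "\<dots> = (\<Sum>r\<in>I. (if r = u then ?cur u x else 0) + (if r \<in> K then G u r x * ?cur r x else 0))"
      proof (intro sum.cong refl)
        fix r assume r: "r \<in> I"
        have "lev r = 0 \<or> lev r = l \<or> 0 < lev r \<and> lev r < l"
          using lev_le[OF r] by linarith
        with r consider "r = u" | "r \<noteq> u" "lev r = 0" | "r \<noteq> u" "lev r = l" "lev r \<noteq> 0" | "r \<in> K" "r \<noteq> u"
          unfolding K_def by (cases "r = u"; cases "lev r = 0") auto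
        then show "G u r x * ?cur r x = (if r = u then ?cur u x else 0) + (if r \<in> K then G u r x * ?cur r x else 0)"
        proof cases
          case 1
          then show ?thesis using G_low[OF u(1) u(1)] u by (simp add: dlt_def K_def)
        next
          case 2
          then show ?thesis using G_low[OF u(1) r] u by (simp add: dlt_def K_def)
        next
          case 3
          have "A r w a x * A w v b x = 0" if "w \<in> I" for w a b
            using A_zero[OF r that] lev_le[OF that] 3 by simp
          then have "?cur r x = 0" by (intro sum.neutral ballI) (simp only: diff_zero)
          then show ?thesis using 3 by (simp add: K_def)
        next
          case 4
          then show ?thesis by simp
        qed
      qed
      also have "\<dots> = ?cur u x + (\<Sum>r\<in>I. if r \<in> K then G u r x * ?cur r x else 0)"
        unfolding sum.distrib using finite_I u by simp
      also have "(\<Sum>r\<in>I. if r \<in> K then G u r x * ?cur r x else 0) = (\<Sum>r\<in>K. G u r x * ?cur r x)"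
        using K_sub by (intro sum.mono_neutral_cong_right finite_I) auto
      finally show ?thesis .
    qed
    have "fr 0 (\<beta> (n - 1)) x - fr (n - 1) (\<beta> 0) x =
        (\<Sum>w\<in>K. (\<Sum>r\<in>I. G u r x * A r w 0 x) * A w v (n - 1) x - (\<Sum>r\<in>I. G u r x * A r w (n - 1) x) * A w v 0 x) +
        (\<Sum>w\<in>K. G u w x * (fr 0 (A w v (n - 1)) x - fr (n - 1) (A w v 0) x))"
      unfolding D[OF n1(2,1)] D[OF n1(1,2)] by (simp add: sum.distrib sum_subtractf right_diff_distrib)
    also have "(\<Sum>w\<in>K. G u w x * (fr 0 (A w v (n - 1)) x - fr (n - 1) (A w v 0) x)) = (\<Sum>w\<in>K. - (G u w x * ?cur w x))"
      by (intro sum.cong refl S)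
    finally show ?thesis unfolding T by (simp add: sum_negf)
  qed
  have inv: "A w v e (act s z x) = A w v e x" if "w \<in> I" "e < n" "x \<in> Rn n" "lat s" "\<And>i. z i \<in> \<int>" for w e s z x
    using A_inv[OF that(1) v(1) that(2), unfolded invariant_def, rule_format, OF rel_act[OF that(3,4)], of z] that(5) by simp
  have central: "\<beta> 0 (line t 1) = \<beta> 0 (line t 0)" for t
    unfolding \<beta>_def line_central
  proof (intro sum.cong refl)
    let ?z = "\<lambda>i. of_bool (i = n - 1) :: real"
    fix w assume w: "w \<in> K"
    have "A w v 0 (act 0 ?z (line t 0)) = A w v 0 (line t 0)"
      by (rule inv[OF K(1)[OF w] n1(2) line_Rn lat_0]) simp
    then show "G u w (act 0 ?z (line t 0)) * A w v 0 (act 0 ?z (line t 0)) = G u w (line t 0) * A w v 0 (line t 0)"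
      by (simp only: transport_central[OF u(1) K(1,4)[OF w] line_Rn])
  qed
  let ?\<rho> = "\<lambda>r. G u r (act per (\<lambda>_. 0) (\<lambda>_. 0))"
  define L where "L = {r \<in> I. lev r \<noteq> 0}"
  \<comment> \<open>By holonomy the far side is a combination of sums over \<open>w\<close> for all
    rows \<open>r\<close>. Row \<open>u\<close> returns \<open>\<beta>\<close> itself and other rows
    of level \<open>0\<close> drop out; for a row of positive level the sum is a derivative of
    \<open>G r v\<close>, an admissible entry.\<close>
  have shift: "\<beta> (n - 1) (line per s) - \<beta> (n - 1) (line 0 s) =
      (\<Sum>r\<in>L. ?\<rho> r * partial_deriv (n - 1) (G r v) (line 0 s))" for s
  proof -
    let ?x = "line 0 s"
    have "\<beta> (n - 1) (line per s) = (\<Sum>w\<in>K. \<Sum>r\<in>I. ?\<rho> r * (G r w ?x * A w v (n - 1) ?x))"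
      unfolding \<beta>_def line_per
    proof (intro sum.cong refl)
      fix w assume w: "w \<in> K"
      show "G u w (act per (\<lambda>_. 0) ?x) * A w v (n - 1) (act per (\<lambda>_. 0) ?x) = (\<Sum>r\<in>I. ?\<rho> r * (G r w ?x * A w v (n - 1) ?x))"
        unfolding inv[OF K(1)[OF w] n1(1) line_Rn lat_per Ints_0]
        by (subst holonomy[OF u(1) K(1,4)[OF w] line_Rn lat_per]) (simp_all add: sum_distrib_right mult.assoc)
    qed
    also have "\<dots> = (\<Sum>r\<in>I. ?\<rho> r * (\<Sum>w\<in>K. G r w ?x * A w v (n - 1) ?x))"
      by (subst sum.swap) (simp add: sum_distrib_left)
    also have "\<dots> = (\<Sum>r\<in>I. (if r = u then \<beta> (n - 1) ?x else 0) +
        (if r \<in> L then ?\<rho> r * partial_deriv (n - 1) (G r v) ?x else 0))"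
    proof (intro sum.cong refl)
      fix r assume r: "r \<in> I"
      show "?\<rho> r * (\<Sum>w\<in>K. G r w ?x * A w v (n - 1) ?x) =
          (if r = u then \<beta> (n - 1) ?x else 0) + (if r \<in> L then ?\<rho> r * partial_deriv (n - 1) (G r v) ?x else 0)"
      proof (cases "lev r = 0")
        case True
        then have "?\<rho> r = dlt u r" using G_low[OF u(1) r] u by simp
        with True show ?thesis by (auto simp: dlt_def L_def \<beta>_def)
      next
        case False
        have "(\<Sum>w\<in>K. G r w ?x * A w v (n - 1) ?x) = (\<Sum>w\<in>I. G r w ?x * A w v (n - 1) ?x)"
        proof (rule sum.mono_neutral_left[OF finite_I K_sub], intro ballI)
          fix w assume w: "w \<in> I - K"
          then consider "lev w = 0" | "lev w = l" using lev_le[of w] by (auto simp: K_def)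
          then show "G r w ?x * A w v (n - 1) ?x = 0"
          proof cases
            case 1
            then show ?thesis using G_low[OF r, of w] w False by (auto simp: dlt_def)
          next
            case 2
            then show ?thesis using A_zero[of w v] w v by simp
          qed
        qed
        also have "\<dots> = partial_deriv (n - 1) (G r v) ?x"
          using G_fr[OF r v(1) _ n1(1) line_Rn, of 0 s] False unfolding fr_last by (simp add: admissible_def)
        finally show ?thesis using False u r by (auto simp: L_def)
      qed
    qed
    also have "\<dots> = \<beta> (n - 1) ?x + (\<Sum>r\<in>I. if r \<in> L then ?\<rho> r * partial_deriv (n - 1) (G r v) ?x else 0)"
      unfolding sum.distrib using finite_I u by simp
    also have "(\<Sum>r\<in>I. if r \<in> L then ?\<rho> r * partial_deriv (n - 1) (G r v) ?x else 0) =
        (\<Sum>r\<in>L. ?\<rho> r * partial_deriv (n - 1) (G r v) ?x)"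
      by (intro sum.mono_neutral_cong_right finite_I) (auto simp: L_def)
    finally show ?thesis by simp
  qed
  have L: "r \<in> I" "admissible r v" if "r \<in> L" for r
    using that by (auto simp: L_def admissible_def)
  have "integral {0..1} (\<lambda>s. \<Sum>r\<in>L. ?\<rho> r * partial_deriv (n - 1) (G r v) (line 0 s)) = 0"
  proof -
    have "integral {0..1} (\<lambda>s. \<Sum>r\<in>L. ?\<rho> r * partial_deriv (n - 1) (G r v) (line 0 s)) =
        (\<Sum>r\<in>L. ?\<rho> r * integral {0..1} (\<lambda>s. partial_deriv (n - 1) (G r v) (line 0 s)))"
    proof (subst integral_sum)
      show "finite L" using finite_I by (simp add: L_def)
      show "(\<lambda>s. ?\<rho> r * partial_deriv (n - 1) (G r v) (line 0 s)) integrable_on {0..1}" if "r \<in> L" for r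
        by (rule integrable_line) (intro smooth_intros G_smooth L[OF that] v n1)
    qed simp
    also have "\<dots> = 0"
    proof (intro sum.neutral ballI)
      fix r assume r: "r \<in> L"
      show "?\<rho> r * integral {0..1} (\<lambda>s. partial_deriv (n - 1) (G r v) (line 0 s)) = 0"
        unfolding integral_line[OF G_smooth[OF L(1)[OF r] v(1)]] line_central
          transport_central[OF L(1)[OF r] v(1) L(2)[OF r] line_Rn] by simp
    qed
    finally show ?thesis .
  qed
  then have "torus_integral (partial_deriv 0 (\<beta> (n - 1))) = 0"
    unfolding torus_integral_partial_0[OF \<beta>[OF n1(1)]] shift .
  moreover have "torus_integral (partial_deriv (n - 1) (\<beta> 0)) = 0"
    unfolding torus_integral_partial_last[OF \<beta>[OF n1(2)]] central by simp
  moreover have "torus_integral (?cur u) = torus_integral (\<lambda>x. partial_deriv 0 (\<beta> (n - 1)) x - partial_deriv (n - 1) (\<beta> 0) x)"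
    unfolding torus_integral_def d\<beta>[OF line_Rn] fr_last by (simp add: fr_def)
  ultimately show ?thesis
    by (simp add: torus_integral_diff smooth_intros \<beta> n1)
qed

end

section \<open>Matrix Massey products of the nilmanifold\<close>

lemma dim_deg_star [simp]: "dim_row (deg_star D E) = dim_row D" "dim_col (deg_star D E) = dim_col E"
  by (simp_all add: deg_star_def)

lemma dim_deg_mat:
  assumes "i \<le> j"
  shows "dim_row (deg_mat Vs i j) = dim_row (fst (Vs ! i))" "dim_col (deg_mat Vs i j) = dim_col (fst (Vs ! j))"
proof -
  have row: "dim_row (foldl (\<lambda>D r. deg_star D (f r)) Z rs) = dim_row Z" for f :: "nat \<Rightarrow> nat mat" and Z rs
    by (induction rs arbitrary: Z) auto
  show "dim_row (deg_mat Vs i j) = dim_row (fst (Vs ! i))"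
    by (simp add: deg_mat_def row)
  show "dim_col (deg_mat Vs i j) = dim_col (fst (Vs ! j))"
  proof (cases "i = j")
    case False
    then have "[Suc i..<Suc j] = [Suc i..<j] @ [j]" using assms by simp
    then show ?thesis unfolding deg_mat_def by (simp del: upt_Suc)
  qed (simp add: deg_mat_def)
qed

lemma deg_mat_pos: "a < dim_row (deg_mat Vs i j) \<Longrightarrow> b < dim_col (deg_mat Vs i j) \<Longrightarrow> 1 \<le> deg_mat Vs i j $$ (a, b)"
  by (simp add: deg_mat_def)

context filiform
begin

lemma lie_bracket_fld:
  assumes "e < n" "1 \<le> f" "f < n"
  shows "lie_bracket (fld e) (fld f) = (if e = 0 \<and> Suc f < n then fld (Suc f) else 0)"
proof
  fix h
  show "lie_bracket (fld e) (fld f) h = (if e = 0 \<and> Suc f < n then fld (Suc f) else 0) h"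
  proof (cases "h \<in> C")
    case True
    then show ?thesis
      using fld_commute_0[OF True assms(2,3)] fld_commute[OF True _ assms(1-3)]
      by (cases "e = 0") (auto simp: lie_bracket_def)
  next
    case False
    have "fld i 0 = 0" if "i < n" for i using VF_0[OF fld_VF[OF that]] .
    then show ?thesis
      using False assms by (simp add: lie_bracket_def fld_def[of _ h])
  qed
qed

lemma forms_value:
  assumes "\<omega> \<in> forms man d" "set xs \<subseteq> VF"
  shows "\<omega> xs \<in> C"
  using assms C_0 by (cases "length xs = d") (auto simp: forms_def)

lemma forms_length: "\<omega> \<in> forms man d \<Longrightarrow> length xs \<noteq> d \<Longrightarrow> \<omega> xs = 0"
  by (auto simp: forms_def)

lemma zero_VF: "0 \<in> VF"
  by (rule vector_fieldsI) (auto simp: C_0)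

text \<open>Needed because a bracket that vanishes is inserted into a form; it follows from
  linearity with zero coefficients.\<close>

lemma forms_zero_field:
  assumes "\<omega> \<in> forms man d"
  shows "\<omega> [0] = 0"
proof (cases "d = 1")
  case True
  have "\<forall>xs. length xs = 1 \<and> set xs \<subseteq> VF \<longrightarrow>
      (\<forall>i<1. \<forall>X\<in>VF. \<forall>Y\<in>VF. \<forall>f\<in>C. \<forall>g\<in>C.
        \<omega> (xs[i := (\<lambda>h. f * X h + g * Y h)]) = f * \<omega> (xs[i := X]) + g * \<omega> (xs[i := Y]))"
    using assms unfolding forms_def True by blast
  from this[rule_format, of "[0]" 0 0 0 0 0]
  have "\<omega> ([0][0 := (\<lambda>h. 0 * 0 h + 0 * 0 h)]) = 0 * \<omega> ([0][0 := 0]) + 0 * \<omega> ([0][0 := 0])"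
    using zero_VF C_0 by simp
  moreover have "(\<lambda>h. 0 * 0 h + 0 * 0 h) = (0 :: point vfield)"
    by (simp add: fun_eq_iff)
  ultimately show ?thesis by simp
qed (use forms_length[OF assms] in simp)

lemma bracket_value:
  assumes "\<omega> \<in> forms man d" "e < n" "1 \<le> f" "f < n"
  shows "\<omega> [lie_bracket (fld e) (fld f)] = (if e = 0 \<and> Suc f < n then \<omega> [fld (Suc f)] else 0)"
  unfolding lie_bracket_fld[OF assms(2-4)] using forms_zero_field[OF assms(1)] by simp

end

section \<open>Defining systems of short products as connections\<close>

locale massey_system = filiform n for n +
  fixes p :: point and Ws :: "(nat mat \<times> point dform set mat) list" and X :: "nat \<Rightarrow> nat \<Rightarrow> point dform mat"
  assumes tuple: "massey_tuple (de_Rham man p) Ws" and system: "defining_system (de_Rham man p) Ws X"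
    and short: "length Ws < n"
begin

definition len :: nat where "len = length Ws"

text \<open>Block sizes: \<open>len\<close> consecutive matrices connect \<open>len + 1\<close>
  levels, the last of which is given by the columns of the last matrix.\<close>

definition size_at :: "nat \<Rightarrow> nat" where
  "size_at i = (if i < len then dim_row (fst (Ws ! i)) else dim_col (fst (Ws ! (len - 1))))"

definition idx :: "(nat \<times> nat) set" where
  "idx = Sigma {..len} (\<lambda>i. {..<size_at i})"

text \<open>Block \<open>(i, j)\<close> of the connection is \<open>X i (j - 1)\<close>. Evaluation
  on a single field selects the 1-forms among the entries, since forms of other degrees vanish
  there. The corner is set to 0 because a defining system does not constrain it.\<close>

definition comp :: "nat \<times> nat \<Rightarrow> nat \<times> nat \<Rightarrow> nat \<Rightarrow> (nat \<Rightarrow> real) \<Rightarrow> real" where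
  "comp u v e x = (if fst u < fst v \<and> (fst u \<noteq> 0 \<or> fst v \<noteq> len)
     then (X (fst u) (fst v - 1) $$ (snd u, snd v)) [fld e] (pt x) else 0)"

lemma len_ge_2: "2 \<le> len"
  using tuple by (simp add: massey_tuple_def len_def)

lemma size_at_col:
  assumes "j < len"
  shows "dim_col (fst (Ws ! j)) = size_at (Suc j)"
proof (cases "Suc j < len")
  case True
  then show ?thesis
    using tuple by (auto simp: massey_tuple_def multipliable_def size_at_def len_def)
next
  case False
  then have "j = len - 1" using assms by simp
  then show ?thesis using False by (simp add: size_at_def)
qed

lemma entry:
  assumes ij: "i \<le> j" "j < len" "i \<noteq> 0 \<or> Suc j \<noteq> len"
  shows dim_X: "dim_row (X i j) = size_at i" "dim_col (X i j) = size_at (Suc j)"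
    and X_forms: "a < size_at i \<Longrightarrow> b < size_at (Suc j) \<Longrightarrow>
      X i j $$ (a, b) \<in> forms man (deg_mat Ws i j $$ (a, b)) \<and> 1 \<le> deg_mat Ws i j $$ (a, b)"
    and X_diff: "map_mat (ext_deriv man) (X i j) = massey_sum (de_Rham man p) Ws X i j"
proof -
  have "(i, j) \<noteq> (0, length Ws - 1)" using ij by (auto simp: len_def)
  then have h: "homog_mat (de_Rham man p) (deg_mat Ws i j) (X i j)"
    and d: "map_mat (diff (de_Rham man p)) (X i j) = massey_sum (de_Rham man p) Ws X i j"
    using system ij unfolding defining_system_def len_def by auto
  have dims: "dim_row (deg_mat Ws i j) = size_at i" "dim_col (deg_mat Ws i j) = size_at (Suc j)"
    using dim_deg_mat[OF ij(1), of Ws] size_at_col[OF ij(2)] ij by (auto simp: size_at_def)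
  show "dim_row (X i j) = size_at i" "dim_col (X i j) = size_at (Suc j)"
    using h dims by (auto simp: homog_mat_def)
  show "X i j $$ (a, b) \<in> forms man (deg_mat Ws i j $$ (a, b)) \<and> 1 \<le> deg_mat Ws i j $$ (a, b)"
    if "a < size_at i" "b < size_at (Suc j)"
    using h dims that deg_mat_pos[of a Ws i j b] by (auto simp: homog_mat_def de_Rham_def)
  show "map_mat (ext_deriv man) (X i j) = massey_sum (de_Rham man p) Ws X i j"
    using d by (simp add: de_Rham_def)
qed

text \<open>Positive degrees remove the products with a value on the empty list. The sign is -1 for
  \<open>d = 1\<close>, and for any other \<open>d\<close> the form vanishes on single fields, so
  the right-hand side does not depend on the degrees.\<close>

lemma wedge_bar_pair:
  assumes \<alpha>: "\<alpha> \<in> forms man d" "1 \<le> d" and \<beta>: "\<beta> \<in> forms man d'" "1 \<le> d'"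
  shows "wedge ((-1) ^ d *\<^sub>R \<alpha>) \<beta> [U, V] = - (\<alpha> [U] * \<beta> [V] - \<alpha> [V] * \<beta> [U])"
proof -
  have "\<alpha> [] = 0" "\<beta> [] = 0"
    using forms_length[OF \<alpha>(1), of "[]"] forms_length[OF \<beta>(1), of "[]"] \<alpha>(2) \<beta>(2) by auto
  moreover have "((-1) ^ d *\<^sub>R \<alpha>) [Z] = - \<alpha> [Z]" for Z
    using forms_length[OF \<alpha>(1), of "[Z]"] by (cases "d = 1") (auto simp: scaleR_fun_def fun_eq_iff)
  moreover have "((-1) ^ d *\<^sub>R \<alpha>) [] = (-1) ^ d *\<^sub>R \<alpha> []"
    by (simp add: scaleR_fun_def)
  ultimately show ?thesis
    by (simp add: wedge_pair)
qed

text \<open>The Massey sum is minus the product of the connection with itself. The summand with cut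
  after position \<open>r\<close> and inner index \<open>c\<close> belongs to the intermediate index
  \<open>(r + 1, c)\<close>, hence the shift between \<open>j - 1\<close> and level
  \<open>j\<close>.\<close>

lemma massey_sum_value:
  assumes ij: "i < j" "j \<le> len" and ab: "a < size_at i" "b < size_at j"
  shows "(massey_sum (de_Rham man p) Ws X i (j - 1) $$ (a, b)) [fld e, fld f] (pt x) =
    - (\<Sum>w\<in>idx. comp (i, a) w e x * comp w (j, b) f x - comp (i, a) w f x * comp w (j, b) e x)"
proof -
  let ?t = "\<lambda>m c. comp (i, a) (m, c) e x * comp (m, c) (j, b) f x - comp (i, a) (m, c) f x * comp (m, c) (j, b) e x"
  have ii: "dim_row (X i i) = size_at i" "dim_col (X (j - 1) (j - 1)) = size_at j"
  proof -
    have "i \<noteq> 0 \<or> Suc i \<noteq> len" "j - 1 \<noteq> 0 \<or> Suc (j - 1) \<noteq> len" "Suc (j - 1) = j"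
      using ij len_ge_2 by auto
    then show "dim_row (X i i) = size_at i" "dim_col (X (j - 1) (j - 1)) = size_at j"
      using dim_X(1)[of i i] dim_X(2)[of "j - 1" "j - 1"] ij by simp_all
  qed
  have "(\<Sum>w\<in>idx. comp (i, a) w e x * comp w (j, b) f x - comp (i, a) w f x * comp w (j, b) e x) =
      (\<Sum>m\<le>len. \<Sum>c<size_at m. ?t m c)"
    unfolding idx_def by (subst sum.Sigma) (auto simp: case_prod_beta)
  also have "\<dots> = (\<Sum>m=Suc i..<j. \<Sum>c<size_at m. ?t m c)"
    by (rule sum.mono_neutral_right) (use ij in \<open>auto simp: comp_def\<close>)
  also have "\<dots> = (\<Sum>r=i..<j - 1. \<Sum>c<size_at (Suc r). ?t (Suc r) c)"
    by (rule sum.reindex_bij_witness[of _ Suc "\<lambda>m. m - 1"]) auto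
  finally have R: "(\<Sum>w\<in>idx. comp (i, a) w e x * comp w (j, b) f x - comp (i, a) w f x * comp w (j, b) e x) =
      (\<Sum>r=i..<j - 1. \<Sum>c<size_at (Suc r). ?t (Suc r) c)" .
  have term_r: "(mat_prod (de_Rham man p) (bar (deg_mat Ws i r) (X i r)) (X (Suc r) (j - 1)) $$ (a, b)) [fld e, fld f] (pt x) =
      (\<Sum>c<size_at (Suc r). - ?t (Suc r) c)" if r: "i \<le> r" "r < j - 1" for r
  proof -
    have 1: "i \<le> r" "r < len" "i \<noteq> 0 \<or> Suc r \<noteq> len" and 2: "Suc r \<le> j - 1" "j - 1 < len" "Suc r \<noteq> 0 \<or> Suc (j - 1) \<noteq> len"
      using r ij by auto
    have j': "Suc (j - 1) = j" using ij by simp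
    have "mat_prod (de_Rham man p) (bar (deg_mat Ws i r) (X i r)) (X (Suc r) (j - 1)) $$ (a, b) =
        (\<Sum>c<size_at (Suc r). wedge ((-1) ^ (deg_mat Ws i r $$ (a, c)) *\<^sub>R X i r $$ (a, c)) (X (Suc r) (j - 1) $$ (c, b)))"
      using dim_X[OF 1] dim_X[OF 2] ab ij by (simp add: mat_prod_def bar_def de_Rham_def)
    then have "(mat_prod (de_Rham man p) (bar (deg_mat Ws i r) (X i r)) (X (Suc r) (j - 1)) $$ (a, b)) [fld e, fld f] (pt x) =
        (\<Sum>c<size_at (Suc r). wedge ((-1) ^ (deg_mat Ws i r $$ (a, c)) *\<^sub>R X i r $$ (a, c)) (X (Suc r) (j - 1) $$ (c, b)) [fld e, fld f] (pt x))"
      by (simp add: sum_fun_apply)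
    also have "\<dots> = (\<Sum>c<size_at (Suc r). - ?t (Suc r) c)"
    proof (intro sum.cong refl)
      fix c assume "c \<in> {..<size_at (Suc r)}"
      then have c: "c < size_at (Suc r)" by simp
      have "X i r $$ (a, c) \<in> forms man (deg_mat Ws i r $$ (a, c))" "1 \<le> deg_mat Ws i r $$ (a, c)"
        "X (Suc r) (j - 1) $$ (c, b) \<in> forms man (deg_mat Ws (Suc r) (j - 1) $$ (c, b))" "1 \<le> deg_mat Ws (Suc r) (j - 1) $$ (c, b)"
        using X_forms[OF 1 ab(1) c] X_forms[OF 2 c] ab(2) j' by simp_all
      from wedge_bar_pair[OF this, of "fld e" "fld f"]
      show "wedge ((-1) ^ (deg_mat Ws i r $$ (a, c)) *\<^sub>R X i r $$ (a, c)) (X (Suc r) (j - 1) $$ (c, b)) [fld e, fld f] (pt x) = - ?t (Suc r) c"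
        using r ij by (auto simp: comp_def)
    qed
    finally show ?thesis .
  qed
  have "(massey_sum (de_Rham man p) Ws X i (j - 1) $$ (a, b)) [fld e, fld f] (pt x) =
      (\<Sum>r=i..<j - 1. (mat_prod (de_Rham man p) (bar (deg_mat Ws i r) (X i r)) (X (Suc r) (j - 1)) $$ (a, b)) [fld e, fld f] (pt x))"
    unfolding massey_sum_def ii using ab by (simp add: sum_fun_apply)
  also have "\<dots> = (\<Sum>r=i..<j - 1. \<Sum>c<size_at (Suc r). - ?t (Suc r) c)"
    by (intro sum.cong refl term_r) auto
  also have "\<dots> = - (\<Sum>r=i..<j - 1. \<Sum>c<size_at (Suc r). ?t (Suc r) c)"
    by (simp only: sum_negf)
  finally show ?thesis unfolding R .
qed

lemma comp_C:
  assumes "u \<in> idx" "v \<in> idx" "fst u < fst v" "fst u \<noteq> 0 \<or> fst v \<noteq> len"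
  shows "\<exists>d. X (fst u) (fst v - 1) $$ (snd u, snd v) \<in> forms man d"
proof -
  have "fst u \<le> fst v - 1" "fst v - 1 < len" "fst u \<noteq> 0 \<or> Suc (fst v - 1) \<noteq> len" "Suc (fst v - 1) = fst v"
    using assms by (auto simp: idx_def)
  from X_forms[OF this(1-3), of "snd u" "snd v"] this(4) assms(1,2) show ?thesis
    by (auto simp: idx_def)
qed

text \<open>The flatness equation is the differential equation of the defining system evaluated on
  two frame fields; the Koszul formula supplies the term \<open>br\<close>.\<close>

lemma flat_system_comp: "flat_system n idx fst len comp"
proof
  show "finite idx" unfolding idx_def by auto
  show "fst u \<le> len" if "u \<in> idx" for u using that by (auto simp: idx_def)
  show "1 \<le> len" using len_ge_2 by simp
  show "len < n" using short by (simp add: len_def)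
  show "comp u v e x = 0" if "fst v \<le> fst u" for u v e x
    using that by (simp add: comp_def)
  fix u v e assume uv: "u \<in> idx" "v \<in> idx" and e: "e < n"
  have "smooth_Rn n (comp u v e) \<and> invariant (comp u v e)"
  proof (cases "fst u < fst v \<and> (fst u \<noteq> 0 \<or> fst v \<noteq> len)")
    case True
    then obtain d where "X (fst u) (fst v - 1) $$ (snd u, snd v) \<in> forms man d"
      using comp_C[OF uv] by blast
    then have "(X (fst u) (fst v - 1) $$ (snd u, snd v)) [fld e] \<in> C"
      using forms_value[of _ d "[fld e]"] fld_VF[OF e] by simp
    from smooth_functions_lift[OF this] invariant_lift[of "(X (fst u) (fst v - 1) $$ (snd u, snd v)) [fld e]"] True
    show ?thesis by (simp add: comp_def[abs_def])
  next
    case False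
    then have "comp u v e = (\<lambda>x. 0)" by (auto simp: comp_def)
    then show ?thesis by (simp add: smooth_intros invariant_def)
  qed
  then show "smooth_Rn n (comp u v e)" "invariant (comp u v e)" by blast+
next
  fix u v e f x
  assume uv: "u \<in> idx" "v \<in> idx" "fst u < fst v" "fst u \<noteq> 0 \<or> fst v \<noteq> len"
    and e: "e < n" and f: "1 \<le> f" "f < n" and x: "x \<in> Rn n"
  obtain i a j b where eq: "u = (i, a)" "v = (j, b)" by fastforce
  have ij: "i < j" "j \<le> len" "a < size_at i" "b < size_at j" "i \<noteq> 0 \<or> j \<noteq> len"
    using uv by (auto simp: eq idx_def)
  have ij': "i \<le> j - 1" "j - 1 < len" "i \<noteq> 0 \<or> Suc (j - 1) \<noteq> len" "Suc (j - 1) = j" using ij by auto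
  define \<alpha> where "\<alpha> = X i (j - 1) $$ (a, b)"
  obtain d where d: "\<alpha> \<in> forms man d" using comp_C[OF uv] by (auto simp: eq \<alpha>_def)
  have val: "comp u v e x = \<alpha> [fld e] (pt x)" for e x
    using ij by (auto simp: comp_def eq \<alpha>_def)
  have lift: "comp u v e = (\<lambda>x. \<alpha> [fld e] (pt x))" for e
    by (rule ext) (rule val)
  have C: "\<alpha> [fld e] \<in> C" if "e < n" for e
    using forms_value[OF d] fld_VF[OF that] by simp
  have "map_mat (ext_deriv man) (X i (j - 1)) $$ (a, b) = ext_deriv man \<alpha>"
    using dim_X[OF ij'(1-3)] ij ij'(4) by (simp add: \<alpha>_def)
  then have "ext_deriv man \<alpha> [fld e, fld f] (pt x) =
      (massey_sum (de_Rham man p) Ws X i (j - 1) $$ (a, b)) [fld e, fld f] (pt x)"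
    using X_diff[OF ij'(1-3)] by simp
  then have "ext_deriv man \<alpha> [fld e, fld f] (pt x) = - (\<Sum>w\<in>idx. comp u w e x * comp w v f x - comp u w f x * comp w v e x)"
    unfolding eq massey_sum_value[OF ij(1-4)] .
  moreover have "ext_deriv man \<alpha> [fld e, fld f] (pt x) =
      fr e (comp u v f) x - fr f (comp u v e) x - br (comp u v) e f x"
    unfolding ext_deriv_pair[OF fld_VF[OF e] fld_VF[OF f(2)]] bracket_value[OF d e f] lift
    by (simp add: fld_pt[OF C[OF f(2)] x e] fld_pt[OF C[OF e] x f(2)] br_def)
  ultimately show "fr e (comp u v f) x - fr f (comp u v e) x =
      br (comp u v) e f x - (\<Sum>w\<in>idx. comp u w e x * comp w v f x - comp u w f x * comp w v e x)"
    by simp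
qed

lemma massey_cocycle_integral:
  assumes ab: "a < dim_row (massey_sum (de_Rham man p) Ws X 0 (len - 1))" "b < dim_col (massey_sum (de_Rham man p) Ws X 0 (len - 1))"
  shows "torus_integral (\<lambda>x. (massey_sum (de_Rham man p) Ws X 0 (len - 1) $$ (a, b)) [fld 0, fld (n - 1)] (pt x)) = 0"
proof -
  interpret flat_system n idx fst len comp by (rule flat_system_comp)
  have ab': "a < size_at 0" "b < size_at len"
    using ab dim_X(1)[of 0 0] dim_X(2)[of "len - 1" "len - 1"] len_ge_2 by (auto simp: massey_sum_def)
  have "(0, a) \<in> idx" "(len, b) \<in> idx" using ab' by (auto simp: idx_def)
  then have "torus_integral (\<lambda>x. \<Sum>w\<in>idx. comp (0, a) w 0 x * comp w (len, b) (n - 1) x - comp (0, a) w (n - 1) x * comp w (len, b) 0 x) = 0"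
    by (intro corner_integral) auto
  then show ?thesis
    using torus_integral_mult[of "-1" "\<lambda>x. \<Sum>w\<in>idx. comp (0, a) w 0 x * comp w (len, b) (n - 1) x - comp (0, a) w (n - 1) x * comp w (len, b) 0 x"]
      massey_sum_value[OF _ order_refl ab'] len_ge_2 by simp
qed

end

section \<open>The torus functional on forms of mixed degree\<close>

context filiform
begin

lemma carrier_values:
  assumes "y \<in> dga_carrier (de_Rham man p)" "set xs \<subseteq> VF"
  shows "y xs \<in> C"
proof -
  have "y \<in> {y. y xs \<in> C}"
  proof (rule subsetD[OF span_minimal assms(1)[unfolded dga_carrier_def]])
    show "(\<Union>d. grade (de_Rham man p) d) \<subseteq> {y. y xs \<in> C}"
      using forms_value[OF _ assms(2)] by (auto simp: de_Rham_def)
    show "subspace {y :: point dform. y xs \<in> C}"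
      unfolding subspace_def by (auto simp: C_0 C_add C_scale scaleR_fun_def[of _ "_ :: point dform"])
  qed
  then show ?thesis by simp
qed

lemma carrier_zero_field:
  assumes "y \<in> dga_carrier (de_Rham man p)"
  shows "y [0] = 0"
proof -
  have "y \<in> {y. y [0] = 0}"
  proof (rule subsetD[OF span_minimal assms[unfolded dga_carrier_def]])
    show "(\<Union>d. grade (de_Rham man p) d) \<subseteq> {y. y [0] = 0}"
      using forms_zero_field by (auto simp: de_Rham_def)
    show "subspace {y :: point dform. y [0] = 0}"
      unfolding subspace_def by (auto simp: scaleR_fun_def[of _ "_ :: point dform"])
  qed
  then show ?thesis by simp
qed

text \<open>The fields \<open>fld 0\<close> and \<open>fld (n - 1)\<close> commute and span the torus of \<open>torus_integral\<close>.\<close>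

definition null_forms :: "point dform set" where
  "null_forms = {c. smooth_Rn n (\<lambda>x. c [fld 0, fld (n - 1)] (pt x)) \<and> torus_integral (\<lambda>x. c [fld 0, fld (n - 1)] (pt x)) = 0}"

lemma subspace_null_forms: "subspace null_forms"
  unfolding subspace_def
proof (intro conjI ballI allI)
  show "0 \<in> null_forms"
    by (simp add: null_forms_def smooth_intros torus_integral_const)
  show "c + c' \<in> null_forms" if "c \<in> null_forms" "c' \<in> null_forms" for c c'
    using that by (simp add: null_forms_def smooth_intros torus_integral_add)
  show "r *\<^sub>R c \<in> null_forms" if "c \<in> null_forms" for r c
    using that by (simp add: null_forms_def scaleR_fun_def smooth_intros torus_integral_mult)
qed

lemma line_ends: "pt (line per s) = pt (line 0 s)" "pt (line t 1) = pt (line t 0)"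
  unfolding line_per line_central by (rule pt_act[OF line_Rn]; simp add: lat_per)+

text \<open>Stokes' theorem on the torus. There is no bracket term, since the two fields commute,
  and the coefficients of \<open>y\<close> are functions on the quotient, so their values on
  opposite sides agree.\<close>

lemma ext_deriv_null_forms:
  assumes y: "y \<in> dga_carrier (de_Rham man p)"
  shows "ext_deriv man y \<in> null_forms"
proof -
  have V: "fld 0 \<in> VF" "fld (n - 1) \<in> VF" using fld_VF n1 by auto
  have C: "y [fld 0] \<in> C" "y [fld (n - 1)] \<in> C"
    using carrier_values[OF y] V by auto
  have "lie_bracket (fld 0) (fld (n - 1)) = 0"
    using lie_bracket_fld[of 0 "n - 1"] n1 by simp
  then have eq: "ext_deriv man y [fld 0, fld (n - 1)] = fld 0 (y [fld (n - 1)]) - fld (n - 1) (y [fld 0])"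
    unfolding ext_deriv_pair[OF V] using carrier_zero_field[OF y] by simp
  have sm: "smooth_Rn n (\<lambda>x. y [fld (n - 1)] (pt x))" "smooth_Rn n (\<lambda>x. y [fld 0] (pt x))"
    using C by (auto intro: smooth_functions_lift)
  have "torus_integral (\<lambda>x. ext_deriv man y [fld 0, fld (n - 1)] (pt x)) =
      torus_integral (\<lambda>x. partial_deriv 0 (\<lambda>x. y [fld (n - 1)] (pt x)) x - partial_deriv (n - 1) (\<lambda>x. y [fld 0] (pt x)) x)"
    unfolding torus_integral_def eq minus_apply fld_pt[OF C(2) line_Rn n1(2)] fld_pt[OF C(1) line_Rn n1(1)] fr_last
    by (simp add: fr_def)
  also have "\<dots> = 0"
    unfolding torus_integral_diff[OF smooth_Rn_partial[OF sm(1) n1(2)] smooth_Rn_partial[OF sm(2) n1(1)]]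
      torus_integral_partial_0[OF sm(1)] torus_integral_partial_last[OF sm(2)] line_ends
    by simp
  finally have "torus_integral (\<lambda>x. ext_deriv man y [fld 0, fld (n - 1)] (pt x)) = 0" .
  moreover have "smooth_Rn n (\<lambda>x. ext_deriv man y [fld 0, fld (n - 1)] (pt x))"
    unfolding eq by (rule smooth_functions_lift[OF C_diff[OF VF_C[OF V(1) C(2)] VF_C[OF V(2) C(1)]]])
  ultimately show ?thesis
    unfolding null_forms_def by blast
qed

text \<open>Cocycles of every degree are covered, since only the value on two fields is tested.
  Smoothness is recorded as well because additivity of the integral relies on it.\<close>

lemma massey_cocycle_null_forms:
  assumes Ws: "massey_tuple (de_Rham man p) Ws" "length Ws < n" and X: "defining_system (de_Rham man p) Ws X"
    and ab: "a < dim_row (massey_sum (de_Rham man p) Ws X 0 (length Ws - 1))" "b < dim_col (massey_sum (de_Rham man p) Ws X 0 (length Ws - 1))"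
  shows "massey_sum (de_Rham man p) Ws X 0 (length Ws - 1) $$ (a, b) \<in> null_forms"
proof -
  interpret massey_system n p Ws X
    by unfold_locales (use assms in auto)
  have ab': "a < size_at 0" "b < size_at len"
    using ab[folded len_def] dim_X(1)[of 0 0] dim_X(2)[of "len - 1" "len - 1"] len_ge_2
    by (auto simp: massey_sum_def)
  have n0: "0 < len" using len_ge_2 by simp
  interpret flat_system n idx fst len comp by (rule flat_system_comp)
  have mem: "(0, a) \<in> idx" "(len, b) \<in> idx" using ab' by (auto simp: idx_def)
  have "smooth_Rn n (\<lambda>x. -1 * (\<Sum>w\<in>idx. comp (0, a) w 0 x * comp w (len, b) (n - 1) x - comp (0, a) w (n - 1) x * comp w (len, b) 0 x))"
    by (intro smooth_intros A_smooth mem n1)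
  then have "smooth_Rn n (\<lambda>x. (massey_sum (de_Rham man p) Ws X 0 (len - 1) $$ (a, b)) [fld 0, fld (n - 1)] (pt x))"
    unfolding massey_sum_value[OF n0 order_refl ab'] by simp
  then show ?thesis
    using massey_cocycle_integral ab by (simp add: null_forms_def len_def)
qed

section \<open>The explicit product of length \<open>n\<close>\<close>

lemma ext_deriv_0: "ext_deriv man 0 = 0"
proof
  fix xs
  show "ext_deriv man 0 xs = 0 xs"
  proof (cases "set xs \<subseteq> VF")
    case True
    then have "(xs ! i) 0 = 0" if "i < length xs" for i
      using VF_0[of "xs ! i"] True nth_mem[OF that] by blast
    then show ?thesis by (simp add: ext_deriv_def)
  qed (simp add: ext_deriv_def)
qed

lemma wedge_0: "wedge 0 \<beta> = 0" "wedge \<alpha> 0 = 0"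
  by (simp_all add: wedge_def fun_eq_iff)

text \<open>The defining system of the product of \<open>n - 1\<close> copies of the class of \<open>cofr 0\<close> and the class of \<open>cofr 1\<close>.\<close>

definition ent :: "nat \<Rightarrow> nat \<Rightarrow> point dform" where
  "ent i j = (if j = n - 1 then cofr (n - i) else if i = j then cofr 0 else 0)"

lemma ent_forms:
  assumes "i \<le> j" "j < n" "(i, j) \<noteq> (0, n - 1)"
  shows "ent i j \<in> forms man 1"
  using assms cofr_forms zero_forms[OF C_0] by (auto simp: ent_def)

text \<open>Off the diagonal \<open>ent\<close> is 0 outside the last column, so only the cut right
  after position \<open>i\<close> contributes.\<close>

lemma ent_sum_last:
  assumes "i < n - 1"
  shows "(\<Sum>r=i..<n-1. wedge (- ent i r) (ent (Suc r) (n - 1))) = wedge (- cofr 0) (cofr (n - Suc i))"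
proof -
  have "(\<Sum>r=i..<n-1. wedge (- ent i r) (ent (Suc r) (n - 1))) =
      (\<Sum>r=i..<n-1. if r = i then wedge (- cofr 0) (cofr (n - Suc i)) else 0)"
    by (intro sum.cong refl) (auto simp: ent_def wedge_0)
  then show ?thesis using assms by simp
qed

lemma ent_diff:
  assumes ij: "i \<le> j" "j < n" "(i, j) \<noteq> (0, n - 1)"
  shows "ext_deriv man (ent i j) = (\<Sum>r=i..<j. wedge (- ent i r) (ent (Suc r) j))"
proof (cases "j = n - 1")
  case True
  then have i: "i \<noteq> 0" "n - i < n" using ij by auto
  show ?thesis
  proof (cases "i = n - 1")
    case True
    then show ?thesis using \<open>j = n - 1\<close> ext_deriv_cofr[OF i(2)] n1 by (simp add: ent_def)
  next
    case False
    then have "i < n - 1" using ij by simp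
    moreover have "2 \<le> n - i" "n - i - 1 = n - Suc i" using calculation by auto
    ultimately show ?thesis
      unfolding True ent_sum_last[OF \<open>i < n - 1\<close>] using ext_deriv_cofr[OF i(2)] by (simp add: ent_def)
  qed
next
  case False
  have "(\<Sum>r=i..<j. wedge (- ent i r) (ent (Suc r) j)) = 0"
    by (intro sum.neutral ballI) (use False ij in \<open>auto simp: ent_def wedge_0 wedge_cofr_0\<close>)
  moreover have "ext_deriv man (ent i j) = 0"
    using False ext_deriv_cofr[OF n1(2)] by (auto simp: ent_def ext_deriv_0)
  ultimately show ?thesis by simp
qed

text \<open>By \<open>coh_class_de_Rham\<close> the classes are the same for all base points, so the
  tuple is fixed once, with \<open>undefined\<close>.\<close>

definition Vs :: "(nat mat \<times> point dform set mat) list" where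
  "Vs = map (\<lambda>i. (mat 1 1 (\<lambda>_. 1), mat 1 1 (\<lambda>_. coh_class (de_Rham man undefined) (ent i i)))) [0..<n]"

lemma coh_class_de_Rham: "coh_class (de_Rham man p) = coh_class (de_Rham man q)"
  by (simp add: coh_class_def dga_carrier_def de_Rham_def fun_eq_iff)

lemma Vs: "length Vs = n" "i < n \<Longrightarrow> Vs ! i = (mat 1 1 (\<lambda>_. 1), mat 1 1 (\<lambda>_. coh_class (de_Rham man p) (ent i i)))"
  using coh_class_de_Rham[of p undefined] by (simp_all add: Vs_def)

lemma deg_mat_Vs:
  assumes "i \<le> j" "j < n"
  shows "deg_mat Vs i j = mat 1 1 (\<lambda>_. 1)"
proof -
  let ?Z = "mat 1 1 (\<lambda>_. 0) :: nat mat"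
  have Z: "map_mat (\<lambda>d. d - 1) (fst (Vs ! r)) = ?Z" if "r < n" for r
    unfolding Vs(2)[OF that, of undefined] fst_conv by (rule eq_matI) auto
  have star: "deg_star ?Z ?Z = ?Z" by (auto simp: deg_star_def)
  have "foldl (\<lambda>D r. deg_star D (map_mat (\<lambda>d. d - 1) (fst (Vs ! r)))) ?Z rs = ?Z" if "set rs \<subseteq> {..<n}" for rs
    using that by (induction rs) (auto simp: Z[simplified] star[simplified])
  moreover have "set [Suc i..<Suc j] \<subseteq> {..<n}" using assms by auto
  ultimately show ?thesis
    using Z[of i] assms by (auto simp: deg_mat_def simp del: upt_Suc)
qed

lemma massey_sum_Vs:
  assumes "i \<le> j" "j < n"
  shows "massey_sum (de_Rham man p) Vs (\<lambda>i j. mat 1 1 (\<lambda>_. ent i j)) i j =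
    mat 1 1 (\<lambda>_. \<Sum>r=i..<j. wedge (- ent i r) (ent (Suc r) j))"
proof (rule eq_matI)
  fix a b assume "a < dim_row (mat 1 1 (\<lambda>_. \<Sum>r=i..<j. wedge (- ent i r) (ent (Suc r) j)))"
    "b < dim_col (mat 1 1 (\<lambda>_. \<Sum>r=i..<j. wedge (- ent i r) (ent (Suc r) j)))"
  then have ab: "a = 0" "b = 0" by auto
  have "(\<Sum>r=i..<j. mat_prod (de_Rham man p) (bar (deg_mat Vs i r) (mat 1 1 (\<lambda>_. ent i r))) (mat 1 1 (\<lambda>_. ent (Suc r) j)) $$ (0, 0)) =
      (\<Sum>r=i..<j. wedge (- ent i r) (ent (Suc r) j))"
    by (intro sum.cong refl) (use assms in \<open>simp add: mat_prod_def bar_def deg_mat_Vs de_Rham_def\<close>)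
  then show "massey_sum (de_Rham man p) Vs (\<lambda>i j. mat 1 1 (\<lambda>_. ent i j)) i j $$ (a, b) =
      mat 1 1 (\<lambda>_. \<Sum>r=i..<j. wedge (- ent i r) (ent (Suc r) j)) $$ (a, b)"
    unfolding ab by (simp add: massey_sum_def)
qed (simp_all add: massey_sum_def)

lemma defining_system_Vs: "defining_system (de_Rham man p) Vs (\<lambda>i j. mat 1 1 (\<lambda>_. ent i j))"
  unfolding defining_system_def
proof (intro conjI allI impI)
  fix i assume "i < length Vs"
  then show "map_mat (coh_class (de_Rham man p)) (mat 1 1 (\<lambda>_. ent i i)) = snd (Vs ! i)"
    using Vs(2)[of i p] Vs(1) by auto
next
  fix j i assume "j < length Vs" "i \<le> j" "(i, j) \<noteq> (0, length Vs - 1)"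
  then have ij: "i \<le> j" "j < n" "(i, j) \<noteq> (0, n - 1)" by (simp_all add: Vs(1))
  show "homog_mat (de_Rham man p) (deg_mat Vs i j) (mat 1 1 (\<lambda>_. ent i j))"
    using ent_forms[OF ij] forms_length[OF ent_forms[OF ij], of "[]"]
    by (simp add: homog_mat_def deg_mat_Vs[OF ij(1,2)] de_Rham_def)
  show "map_mat (diff (de_Rham man p)) (mat 1 1 (\<lambda>_. ent i j)) =
      massey_sum (de_Rham man p) Vs (\<lambda>i j. mat 1 1 (\<lambda>_. ent i j)) i j"
    unfolding massey_sum_Vs[OF ij(1,2)] using ent_diff[OF ij] by (auto simp: de_Rham_def)
qed

lemma massey_tuple_Vs: "massey_tuple (de_Rham man p) Vs"
  unfolding massey_tuple_def
proof (intro conjI ballI allI impI)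
  show "2 \<le> length Vs" using two_le_n by (simp add: Vs(1))
  show "multipliable (fst (Vs ! i)) (fst (Vs ! Suc i))" if "Suc i < length Vs" for i
    using that Vs(2)[of i p] Vs(2)[of "Suc i" p] by (simp add: Vs(1) multipliable_def)
  fix V assume "V \<in> set Vs"
  then obtain i where i: "i < n" "V = Vs ! i" by (auto simp: in_set_conv_nth Vs(1))
  have "(i, i) \<noteq> (0, n - 1)" using n1 by auto
  then have "ent i i \<in> forms man 1" "ext_deriv man (ent i i) = 0"
    using ent_forms[of i i] ent_diff[of i i] i by simp_all
  then have "coh_class (de_Rham man p) (ent i i) \<in> cohomology (de_Rham man p) 1"
    by (auto simp: cohomology_def de_Rham_def)
  then show "coh_mat (de_Rham man p) V"
    unfolding i(2) Vs(2)[OF i(1), of p] by (simp add: coh_mat_def)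
qed

text \<open>On the two fields the form has the constant value -1, so its integral is minus the area
  \<open>per\<close> of the rectangle.\<close>

lemma cocycle_not_null: "wedge (- cofr 0) (cofr (n - 1)) \<notin> null_forms"
proof
  assume "wedge (- cofr 0) (cofr (n - 1)) \<in> null_forms"
  then have "torus_integral (\<lambda>x. wedge (- cofr 0) (cofr (n - 1)) [fld 0, fld (n - 1)] (pt x)) = 0"
    by (simp add: null_forms_def)
  moreover have "wedge (- cofr 0) (cofr (n - 1)) [fld 0, fld (n - 1)] = - (one * one)"
  proof -
    have "cofr i [] = 0" for i by (simp add: cofr_def)
    then show ?thesis
      using n1 by (simp add: wedge_pair cofr_single fld_VF cf_fld)
  qed
  ultimately have "torus_integral (\<lambda>x. -1) = 0"
    unfolding torus_integral_def by (simp add: line_Rn)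
  then show False using per_pos by (simp add: torus_integral_const)
qed

text \<open>\<open>null_forms\<close> is a linear subspace that contains the cocycles of all shorter
  products and all exact forms, hence every representative of every class in their span.\<close>

lemma strict_weight_Vs: "strict_weight (de_Rham man p) Vs"
proof -
  let ?A = "de_Rham man p" and ?X = "\<lambda>i j. mat 1 1 (\<lambda>_. ent i j)"
  let ?c = "wedge (- cofr 0) (cofr (n - 1))"
  define a where "a = map_mat (coh_class ?A) (massey_sum ?A Vs ?X 0 (length Vs - 1))"
  have a: "a \<in> massey_product ?A Vs"
    unfolding massey_product_def a_def using defining_system_Vs by blast
  have "massey_sum ?A Vs ?X 0 (length Vs - 1) = mat 1 1 (\<lambda>_. ?c)"
  proof -
    have "0 < n - 1" using n1 by simp
    show ?thesis
      unfolding Vs(1) massey_sum_Vs[OF le0 n1(1)] ent_sum_last[OF \<open>0 < n - 1\<close>] by simp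
  qed
  then have "coh_class ?A ?c \<in> elements_mat a"
    by (auto simp: a_def elements_mat_def)
  moreover have "coh_class ?A ?c \<notin> coh_span ?A (lower_massey_entries ?A (length Vs))"
  proof
    assume "coh_class ?A ?c \<in> coh_span ?A (lower_massey_entries ?A (length Vs))"
    then obtain s where s: "coh_class ?A ?c = coh_class ?A s" "s \<in> span (\<Union> (lower_massey_entries ?A (length Vs)))"
      by (auto simp: coh_span_def)
    have null_diff: "diff ?A y \<in> null_forms" if "y \<in> dga_carrier ?A" for y
      using ext_deriv_null_forms[OF that] by (simp add: de_Rham_def)
    \<comment> \<open>Elements of the union are arbitrary representatives, so each is a Massey
      cocycle plus an exact form.\<close>
    have "\<Union> (lower_massey_entries ?A (length Vs)) \<subseteq> null_forms"
    proof
      fix u assume "u \<in> \<Union> (lower_massey_entries ?A (length Vs))"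
      then obtain Ws X E where W: "massey_tuple ?A Ws" "length Ws < n" "defining_system ?A Ws X"
        "E \<in> elements_mat (map_mat (coh_class ?A) (massey_sum ?A Ws X 0 (length Ws - 1)))" "u \<in> E"
        by (auto simp: lower_massey_entries_def massey_product_def Vs(1))
      let ?S = "massey_sum ?A Ws X 0 (length Ws - 1)"
      obtain i j where ij: "i < dim_row ?S" "j < dim_col ?S" "E = coh_class ?A (?S $$ (i, j))"
        using W(4) by (auto simp: elements_mat_def)
      then obtain y where y: "y \<in> dga_carrier ?A" "u = ?S $$ (i, j) + diff ?A y"
        using W(5) by (auto simp: coh_class_def)
      show "u \<in> null_forms"
        unfolding y(2)
        by (intro subspace_add[OF subspace_null_forms] massey_cocycle_null_forms[OF W(1-3) ij(1,2)] null_diff y(1))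
    qed
    then have sn: "s \<in> null_forms"
      using span_minimal[OF _ subspace_null_forms] s(2) by blast
    have "0 \<in> dga_carrier ?A" unfolding dga_carrier_def by (rule span_zero)
    moreover have "?c = ?c + diff ?A 0" by (simp add: de_Rham_def ext_deriv_0)
    ultimately have "?c \<in> coh_class ?A ?c" unfolding coh_class_def by blast
    then obtain y where "y \<in> dga_carrier ?A" "?c = s + diff ?A y"
      unfolding s(1) by (auto simp: coh_class_def)
    then have "?c \<in> null_forms"
      using subspace_add[OF subspace_null_forms sn null_diff] by metis
    then show False using cocycle_not_null by blast
  qed
  ultimately show ?thesis
    unfolding strict_weight_def using massey_tuple_Vs a by blast
qed

end

theorem theorem6:
  fixes k :: nat
  assumes "1 \<le> k"
  shows "\<exists>(M :: point manifold) \<omega>. closed_manifold M \<and> symplectic_form M \<omega> \<and>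
           (\<exists>p \<in> topspace (mtop M). \<exists>Vs. length Vs = 2 * k \<and> strict_weight (de_Rham M p) Vs)"
proof -
  \<comment> \<open>For \<open>k = 1\<close> this is the 2-torus, and the product is a cup product
    of two classes of degree 1.\<close>
  interpret filiform "2 * k"
    by unfold_locales (use assms in simp)
  have "pt (\<lambda>_. 0) \<in> topspace (mtop man)"
    by (auto simp: topspace_qtop Rn_def)
  then show ?thesis
    using closed_manifold_man symplectic_om strict_weight_Vs Vs(1) by (intro exI[of _ man] exI[of _ om]) auto
qed

end
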